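(* Let $\gamma_k$ be the SINR of the uplink transmission from the $k$th terminal in the $l$th cell to its base station, with zero-forcing reception under delayed channels (defined in the context). Then $\gamma_k$ is distributed as $$\gamma_k\overset{d}{\sim}\frac{\alpha^2 p_r X_k[n-1]}{\alpha^2 p_r C X_k[n-1] + p_r Y_k[n] + 1},$$ where $C=\sum_{i\neq l}\left(\beta_{lik}/\beta_{llk}\right)^2$ is a deterministic constant, and $X_k$ and $Y_k$ are independent random variables whose probability density functions are, respectively, $$p_{X_k}(x)=\frac{e^{-x/\hat\beta_{llk}}}{(N-K)!\,\hat\beta_{llk}}\left(\frac{x}{\hat\beta_{llk}}\right)^{N-K},\quad x\ge 0,$$ $$p_{Y_k}(y)=\sum_{p=1}^{\varrho(\mathcal A_k)}\sum_{q=1}^{\tau_p(\mathcal A_k)}\mathcal X_{p,q}(\mathcal A_k)\frac{\mu_{k,p}^{-q}}{(q-1)!}\,y^{q-1}e^{-y/\mu_{k,p}},\quad y\ge 0.$$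
   Context: Setting: the uplink of a cellular network with $L$ cells, each with one $N$-antenna base station and $K$ single-antenna terminals, $N\ge K$, all terminals sharing the same time-frequency resource. $p_r$ is the average transmit power of each terminal; the noise at the base stations has unit-variance circularly symmetric complex Gaussian entries. $\mathcal{CN}(0,\Sigma)$ denotes the circularly symmetric complex Gaussian law. The channel at symbol $n$ from terminal $j$ of cell $i$ to base station $l$ is $g_{lij}[n]=\sqrt{\beta_{lij}}\,h_{lij}[n]\in\mathbb C^N$, with large-scale fading coefficient $\beta_{lij}$ and $h_{lij}[n]\sim\mathcal{CN}(0,I_N)$. Training: all cells reuse the same $K$ orthogonal pilot sequences of length $\tau\ge K$; $p_{\mathrm{tr}}=\tau p_r$. The MMSE estimate of $g_{lij}[n]$ is $\hat g_{lij}[n]=\beta_{lij}\big(\tfrac1{p_{\mathrm{tr}}}+\sum_{i'=1}^L\beta_{li'j}\big)^{-1}\big(\sum_{i'=1}^L g_{li'j}[n]+\tfrac1{\sqrt{p_{\mathrm{tr}}}}\tilde z_{lj}[n]\big)$, with $\tilde z_{lj}[n]\sim\mathcal{CN}(0,I_N)$ independent of the channels. With $\hat\beta_{lij}=\beta_{lij}^2/\big(\sum_{i'=1}^L\beta_{li'j}+1/p_{\mathrm{tr}}\big)$, one has $\hat g_{lij}[n]\sim\mathcal{CN}(0,\hat\beta_{lij}I_N)$, and the estimation error $\tilde g_{lij}[n]=g_{lij}[n]-\hat g_{lij}[n]\sim\mathcal{CN}(0,(\beta_{lij}-\hat\beta_{lij})I_N)$ is independent of $\hat g_{lij}[n]$.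 Delayed channel: $g_{lij}[n]=\alpha g_{lij}[n-1]+e_{lij}[n]$ with $e_{lij}[n]\sim\mathcal{CN}(0,(1-\alpha^2)\beta_{lij}I_N)$ independent of $g_{lij}[n-1]$, where $\alpha=J_0(2\pi f_DT_s)$ is the temporal correlation parameter ($J_0$ the zeroth-order Bessel function of the first kind, $f_D$ the maximum Doppler shift, $T_s$ the channel sampling period). Thus $g_{lij}[n]=\alpha\hat g_{lij}[n-1]+\tilde e_{lij}[n]$, where $\tilde e_{lij}[n]=\alpha\tilde g_{lij}[n-1]+e_{lij}[n]\sim\mathcal{CN}(0,(\beta_{lij}-\alpha^2\hat\beta_{lij})I_N)$ is independent of $\hat g_{lij}[n-1]$. Let $\hat G_{li}[n]$ and $\tilde E_{li}[n]$ be the $N\times K$ matrices with $j$th columns $\hat g_{lij}[n]$ and $\tilde e_{lij}[n]$; then $\hat G_{li}[n]=\hat G_{ll}[n]D_i$ with $D_i=\mathrm{diag}(\beta_{li1}/\beta_{ll1},\dots,\beta_{liK}/\beta_{llK})$. SINR: the received signal at base station $l$ is multiplied by $\alpha^{-1}\hat G_{ll}^\dagger[n-1]$ ($\dagger$ is the pseudo-inverse). With $[A]_k$ the $k$th row of $A$ and $\|\cdot\|$ the Euclidean norm, $$\gamma_k=\frac{\alpha^2p_r}{\alpha^2p_r\sum_{i\ne l}\big\|[\hat G_{ll}^\dagger[n-1]]_k\hat G_{li}[n-1]\big\|^2+p_r\sum_{i=1}^L\big\|[\hat G_{ll}^\dagger[n-1]]_k\tilde E_{li}[n]\big\|^2+\big\|[\hat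 G_{ll}^\dagger[n-1]]_k\big\|^2}.$$ Notation: $\mathcal A_k=\mathrm{diag}(\tilde D_{l1},\dots,\tilde D_{lL})$, where $\tilde D_{li}$ is the $K\times K$ diagonal matrix with $j$th diagonal element $\beta_{lij}-\alpha^2\hat\beta_{lij}$. $\varrho(\mathcal A_k)$ is the number of distinct diagonal elements of $\mathcal A_k$; $\mu_{k,1},\dots,\mu_{k,\varrho(\mathcal A_k)}$ are these distinct elements in decreasing order; $\tau_p(\mathcal A_k)$ is the multiplicity of $\mu_{k,p}$. $\mathcal X_{p,q}(\mathcal A_k)$ is the $(p,q)$th characteristic coefficient of $\mathcal A_k$, i.e. the partial-fraction coefficient in $\det(I+\xi\mathcal A_k)^{-1}=\sum_{p=1}^{\varrho(\mathcal A_k)}\sum_{q=1}^{\tau_p(\mathcal A_k)}\mathcal X_{p,q}(\mathcal A_k)(1+\xi\mu_{k,p})^{-q}$.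
   Formalization: The prediction errors ẽ_{lij}[n] are additionally assumed mutually independent over all cells i and terminals j, and jointly independent of the estimates ĝ_{llj}[n-1]; with independent channels, pilot contamination correlates them for L≥2, α≠0, and the stated law of Y_k then fails. *)

theory Defs
  imports "HOL-Probability.Probability"
begin

section \<open>Special functions, matrices, Gaussian vectors\<close>

definition bessel_J0 :: "real \<Rightarrow> real" where
  "bessel_J0 x = (\<Sum>m. (-1) ^ m / (fact m)\<^sup>2 * (x / 2) ^ (2 * m))"

definition conj_transpose :: "complex ^ 'k ^ 'n \<Rightarrow> complex ^ 'n ^ 'k" where
  "conj_transpose A = (\<chi> i j. cnj (A $ j $ i))"

text \<open>The Moore--Penrose pseudo-inverse, by the four Penrose equations (which have exactly one
  solution for every matrix, whatever its rank).\<close>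

definition is_pseudo_inverse :: "complex ^ 'k ^ 'n \<Rightarrow> complex ^ 'n ^ 'k \<Rightarrow> bool" where
  "is_pseudo_inverse A P \<longleftrightarrow>
     A ** P ** A = A \<and> P ** A ** P = P \<and>
     conj_transpose (A ** P) = A ** P \<and> conj_transpose (P ** A) = P ** A"

definition pseudo_inverse :: "complex ^ 'k ^ 'n \<Rightarrow> complex ^ 'n ^ 'k" where
  "pseudo_inverse A = (THE P. is_pseudo_inverse A P)"

text \<open>Density of the circularly symmetric law with mean 0 and covariance matrix \<open>v I\<^sub>N\<close>, \<open>v > 0\<close>,
  with respect to Lebesgue measure on the space of \<open>N\<close>-dimensional complex vectors
  (real dimension \<open>2 N\<close>); each entry has variance \<open>v\<close>, i.e. \<open>v/2\<close> per real component.\<close>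

definition cn_density :: "real \<Rightarrow> complex ^ 'n \<Rightarrow> ennreal" where
  "cn_density v x = ennreal (exp (- (norm x)\<^sup>2 / v) / (pi * v) ^ CARD('n))"

section \<open>Channel, pilot-based estimate, prediction error\<close>

text \<open>Types: \<open>'c\<close> indexes the \<open>L\<close> cells, \<open>'k\<close> the \<open>K\<close> terminals of a cell, \<open>'n\<close> the \<open>N\<close> antennas
  of a base station. Index order: \<open>h m l i j\<close> is the small-scale fading vector at symbol \<open>m\<close> from
  terminal \<open>j\<close> of cell \<open>i\<close> to base station \<open>l\<close>, and \<open>\<beta> l i j\<close> the large-scale coefficient.
  \<open>p_tr\<close> is the training power \<open>\<tau> p_r\<close>.\<close>

definition beta_hat :: "('c::finite \<Rightarrow> 'c \<Rightarrow> 'k \<Rightarrow> real) \<Rightarrow> real \<Rightarrow> 'c \<Rightarrow> 'c \<Rightarrow> 'k \<Rightarrow> real" where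
  "beta_hat \<beta> p_tr l i j = (\<beta> l i j)\<^sup>2 / ((\<Sum>i'\<in>UNIV. \<beta> l i' j) + 1 / p_tr)"

definition channel ::
  "('c \<Rightarrow> 'c \<Rightarrow> 'k \<Rightarrow> real) \<Rightarrow> (int \<Rightarrow> 'c \<Rightarrow> 'c \<Rightarrow> 'k \<Rightarrow> 'w \<Rightarrow> complex ^ 'n) \<Rightarrow>
   int \<Rightarrow> 'c \<Rightarrow> 'c \<Rightarrow> 'k \<Rightarrow> 'w \<Rightarrow> complex ^ 'n" where
  "channel \<beta> h m l i j \<omega> = sqrt (\<beta> l i j) *\<^sub>R h m l i j \<omega>"

definition mmse_estimate ::
  "('c::finite \<Rightarrow> 'c \<Rightarrow> 'k \<Rightarrow> real) \<Rightarrow> real \<Rightarrow>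
   (int \<Rightarrow> 'c \<Rightarrow> 'c \<Rightarrow> 'k \<Rightarrow> 'w \<Rightarrow> complex ^ 'n) \<Rightarrow>
   (int \<Rightarrow> 'c \<Rightarrow> 'k \<Rightarrow> 'w \<Rightarrow> complex ^ 'n) \<Rightarrow>
   int \<Rightarrow> 'c \<Rightarrow> 'c \<Rightarrow> 'k \<Rightarrow> 'w \<Rightarrow> complex ^ 'n" where
  "mmse_estimate \<beta> p_tr h z m l i j \<omega> =
     (\<beta> l i j * inverse (1 / p_tr + (\<Sum>i'\<in>UNIV. \<beta> l i' j))) *\<^sub>R
       ((\<Sum>i'\<in>UNIV. channel \<beta> h m l i' j \<omega>) + (1 / sqrt p_tr) *\<^sub>R z m l j \<omega>)"

text \<open>The total error made when the channel at symbol \<open>m\<close> is predicted by \<open>\<alpha>\<close> times its estimate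
  at symbol \<open>m - 1\<close>. If the channel evolves as \<open>g[m] = \<alpha> g[m-1] + e[m]\<close>, this is
  \<open>\<alpha> (g[m-1] - g_est[m-1]) + e[m]\<close>, i.e. the scaled estimation error plus the innovation.
  Mutual independence of these vectors over the cells \<open>i\<close> has to be a hypothesis: it does not follow
  from independent channels, noises and innovations, since the estimation errors of terminals
  sharing a pilot are correlated.\<close>

definition prediction_error ::
  "real \<Rightarrow> ('c::finite \<Rightarrow> 'c \<Rightarrow> 'k \<Rightarrow> real) \<Rightarrow> real \<Rightarrow>
   (int \<Rightarrow> 'c \<Rightarrow> 'c \<Rightarrow> 'k \<Rightarrow> 'w \<Rightarrow> complex ^ 'n) \<Rightarrow>
   (int \<Rightarrow> 'c \<Rightarrow> 'k \<Rightarrow> 'w \<Rightarrow> complex ^ 'n) \<Rightarrow>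
   int \<Rightarrow> 'c \<Rightarrow> 'c \<Rightarrow> 'k \<Rightarrow> 'w \<Rightarrow> complex ^ 'n" where
  "prediction_error \<alpha> \<beta> p_tr h z m l i j \<omega> =
     channel \<beta> h m l i j \<omega> - \<alpha> *\<^sub>R mmse_estimate \<beta> p_tr h z (m - 1) l i j \<omega>"

definition columns_matrix :: "('k \<Rightarrow> complex ^ 'n) \<Rightarrow> complex ^ 'k ^ 'n" where
  "columns_matrix c = (\<chi> a j. c j $ a)"

section \<open>SINR of the zero-forcing receiver\<close>

definition zf_sinr ::
  "real \<Rightarrow> real \<Rightarrow> ('c::finite \<Rightarrow> complex ^ 'k ^ 'n) \<Rightarrow> ('c \<Rightarrow> complex ^ 'k ^ 'n) \<Rightarrow> 'c \<Rightarrow> 'k \<Rightarrow> real" where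
  "zf_sinr \<alpha> p_r G E l k =
     \<alpha>\<^sup>2 * p_r /
       (\<alpha>\<^sup>2 * p_r * (\<Sum>i\<in>UNIV - {l}. (norm (row k (pseudo_inverse (G l)) v* G i))\<^sup>2)
        + p_r * (\<Sum>i\<in>UNIV. (norm (row k (pseudo_inverse (G l)) v* E i))\<^sup>2)
        + (norm (row k (pseudo_inverse (G l))))\<^sup>2)"

definition sinr ::
  "real \<Rightarrow> real \<Rightarrow> ('c::finite \<Rightarrow> 'c \<Rightarrow> 'k::finite \<Rightarrow> real) \<Rightarrow> real \<Rightarrow>
   (int \<Rightarrow> 'c \<Rightarrow> 'c \<Rightarrow> 'k \<Rightarrow> 'w \<Rightarrow> complex ^ 'n) \<Rightarrow>
   (int \<Rightarrow> 'c \<Rightarrow> 'k \<Rightarrow> 'w \<Rightarrow> complex ^ 'n) \<Rightarrow>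
   int \<Rightarrow> 'c \<Rightarrow> 'k \<Rightarrow> 'w \<Rightarrow> real" where
  "sinr \<alpha> p_r \<beta> p_tr h z n l k \<omega> =
     zf_sinr \<alpha> p_r
       (\<lambda>i. columns_matrix (\<lambda>j. mmse_estimate \<beta> p_tr h z (n - 1) l i j \<omega>))
       (\<lambda>i. columns_matrix (\<lambda>j. prediction_error \<alpha> \<beta> p_tr h z n l i j \<omega>))
       l k"

section \<open>Characteristic coefficients of a diagonal matrix\<close>

definition diag_values :: "real ^ 'm ^ 'm \<Rightarrow> real set" where
  "diag_values A = range (\<lambda>a. A $ a $ a)"

definition num_distinct :: "real ^ 'm ^ 'm \<Rightarrow> nat" where
  "num_distinct A = card (diag_values A)"

text \<open>\<open>diag_value A p\<close> is the \<open>p\<close>th largest distinct diagonal element,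
  \<open>p = 1, \<dots>, num_distinct A\<close>.\<close>

definition diag_value :: "real ^ 'm ^ 'm \<Rightarrow> nat \<Rightarrow> real" where
  "diag_value A p = rev (sorted_list_of_set (diag_values A)) ! (p - 1)"

definition diag_mult :: "real ^ 'm ^ 'm \<Rightarrow> nat \<Rightarrow> nat" where
  "diag_mult A p = card {a. A $ a $ a = diag_value A p}"

text \<open>The family of partial-fraction coefficients. For a diagonal matrix with positive diagonal
  it exists, and it is unique on the index range of the double sum; only those values are used.
  The expansion is required at every \<open>\<xi>\<close> that is not a pole.\<close>

definition char_coeff :: "real ^ 'm ^ 'm \<Rightarrow> nat \<Rightarrow> nat \<Rightarrow> real" where
  "char_coeff A = (SOME c. \<forall>\<xi>. det (mat 1 + \<xi> *\<^sub>R A) \<noteq> 0 \<longrightarrow>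
     inverse (det (mat 1 + \<xi> *\<^sub>R A)) =
       (\<Sum>p=1..num_distinct A. \<Sum>q=1..diag_mult A p.
          c p q * inverse ((1 + \<xi> * diag_value A p) ^ q)))"

text \<open>The block-diagonal matrix of size \<open>K L\<close>; the index \<open>(i, j)\<close> is the \<open>j\<close>th diagonal position
  of the \<open>i\<close>th block.\<close>

definition error_cov ::
  "real \<Rightarrow> ('c::finite \<Rightarrow> 'c \<Rightarrow> 'k::finite \<Rightarrow> real) \<Rightarrow> real \<Rightarrow> 'c \<Rightarrow> real ^ ('c \<times> 'k) ^ ('c \<times> 'k)" where
  "error_cov \<alpha> \<beta> p_tr l =
     (\<chi> a b. if a = b then \<beta> l (fst a) (snd a) - \<alpha>\<^sup>2 * beta_hat \<beta> p_tr l (fst a) (snd a) else 0)"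

section \<open>The two probability density functions\<close>

text \<open>Here \<open>d\<close> plays the role of \<open>N - K\<close>.\<close>

definition pdf_X :: "nat \<Rightarrow> real \<Rightarrow> real \<Rightarrow> real" where
  "pdf_X d b x = (if 0 \<le> x then exp (- x / b) / (fact d * b) * (x / b) ^ d else 0)"

definition pdf_Y :: "real ^ 'm ^ 'm \<Rightarrow> real \<Rightarrow> real" where
  "pdf_Y A y = (if 0 \<le> y then
     (\<Sum>p=1..num_distinct A. \<Sum>q=1..diag_mult A p.
        char_coeff A p q * (inverse (diag_value A p) ^ q / fact (q - 1)) *
          y ^ (q - 1) * exp (- y / diag_value A p))
     else 0)"

end

theory Submission
  imports Defs
begin

text \<open>Almost surely the estimate \<open>G\<close> of the own-cell channel has full column rank. Let \<open>w\<close> be the \<open>k\<close>th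
  row of its pseudo-inverse. The other estimates are diagonal multiples of \<open>G\<close>, so \<open>w\<close> turns them into
  deterministic interference, and the ratio takes the claimed form with \<open>X = 1 / (norm w)\<^sup>2\<close> and
  \<open>Y\<close> the error energy received along \<open>w / norm w\<close>. Given the other columns, \<open>X\<close> is the squared norm of
  the projection of the Gaussian column \<open>k\<close> onto a subspace of complex dimension \<open>N - K + 1\<close>, whose law
  does not depend on the subspace. Given \<open>G\<close>, the variable \<open>Y\<close> is a sum of independent exponential
  variables, whose law does not depend on \<open>G\<close>; hence \<open>Y\<close> is independent of \<open>X\<close>. Its density is found by
  comparing characteristic functions: the partial-fraction expansion, continued to the imaginary
  axis, is the Fourier transform of the stated mixture of Erlang densities.\<close>

section \<open>Isotropic Gaussian measures\<close>

text \<open>By Fubini and translation invariance, the image measure and Lebesgue measure are proportional;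
  the unit ball, which is invariant, fixes the constant.\<close>

lemma lborel_distr_orthogonal_transformation:
  fixes T :: "'a::euclidean_space \<Rightarrow> 'a"
  assumes T: "orthogonal_transformation T"
  shows "distr lborel borel T = lborel"
proof (rule measure_eqI)
  have lin: "linear T" and norm_T: "norm (T x) = norm x" for x
    using T by (auto simp: orthogonal_transformation)
  have [measurable]: "T \<in> borel_measurable borel"
    using lin by (intro borel_measurable_continuous_onI linear_continuous_on) (simp add: linear_conv_bounded_linear)
  have surj: "surj T" using T by (rule orthogonal_transformation_surj)
  have shift: "(\<integral>\<^sup>+x. F (x + c) \<partial>lborel) = (\<integral>\<^sup>+x. F x \<partial>lborel)"
    if "F \<in> borel_measurable borel" for F :: "'a \<Rightarrow> ennreal" and c
  proof -
    have "(\<integral>\<^sup>+x. F x \<partial>lborel) = (\<integral>\<^sup>+x. F x \<partial>(distr lborel borel ((+) c)))"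
      by (simp add: lborel_distr_plus)
    also have "\<dots> = (\<integral>\<^sup>+x. F (c + x) \<partial>lborel)"
      using that by (simp add: nn_integral_distr)
    finally show ?thesis by (simp add: add.commute)
  qed
  fix A assume "A \<in> sets (distr lborel borel T)"
  then have A[measurable]: "A \<in> sets borel" by simp
  define f :: "'a \<Rightarrow> ennreal" where "f = indicator A"
  define g :: "'a \<Rightarrow> ennreal" where "g = indicator (cball 0 1)"
  have [measurable]: "f \<in> borel_measurable borel" "g \<in> borel_measurable borel"
    by (auto simp: f_def g_def intro!: borel_measurable_indicator borel_closed)
  have shift_f: "(\<integral>\<^sup>+x. f (T x + y) \<partial>lborel) = (\<integral>\<^sup>+x. f (T x) \<partial>lborel)" for y
  proof -
    obtain c where c: "y = T c" using surj by auto
    have "(\<integral>\<^sup>+x. f (T x + y) \<partial>lborel) = (\<integral>\<^sup>+x. f (T (x + c)) \<partial>lborel)"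
      by (simp add: c linear_add[OF lin])
    also have "\<dots> = (\<integral>\<^sup>+x. f (T x) \<partial>lborel)"
      by (rule shift[of "\<lambda>x. f (T x)"]) simp
    finally show ?thesis .
  qed
  have shift_g: "(\<integral>\<^sup>+x. g (y - T x) \<partial>lborel) = (\<integral>\<^sup>+x. g x \<partial>lborel)" for y
  proof -
    obtain c where c: "y = T c" using surj by auto
    have "(\<integral>\<^sup>+x. g (y - T x) \<partial>lborel) = (\<integral>\<^sup>+x. g (y - T (x + c)) \<partial>lborel)"
      by (rule shift[of "\<lambda>x. g (y - T x)", symmetric]) simp
    also have "\<dots> = (\<integral>\<^sup>+x. g x \<partial>lborel)"
      by (simp add: c linear_add[OF lin] g_def indicator_def norm_T)
    finally show ?thesis .
  qed
  have "(\<integral>\<^sup>+x. f (T x) \<partial>lborel) * (\<integral>\<^sup>+y. g y \<partial>lborel)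
      = (\<integral>\<^sup>+y. (\<integral>\<^sup>+x. f (T x) \<partial>lborel) * g y \<partial>lborel)"
    by (simp add: nn_integral_cmult)
  also have "\<dots> = (\<integral>\<^sup>+y. (\<integral>\<^sup>+x. f (T x + y) * g y \<partial>lborel) \<partial>lborel)"
    by (simp add: shift_f nn_integral_multc)
  also have "\<dots> = (\<integral>\<^sup>+x. (\<integral>\<^sup>+y. f (T x + y) * g y \<partial>lborel) \<partial>lborel)"
    by (rule lborel_pair.Fubini') simp
  also have "\<dots> = (\<integral>\<^sup>+x. (\<integral>\<^sup>+y. f y * g (y - T x) \<partial>lborel) \<partial>lborel)"
  proof (rule nn_integral_cong)
    fix x show "(\<integral>\<^sup>+y. f (T x + y) * g y \<partial>lborel) = (\<integral>\<^sup>+y. f y * g (y - T x) \<partial>lborel)"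
      using shift[of "\<lambda>y. f y * g (y - T x)" "T x"] by (simp add: add.commute)
  qed
  also have "\<dots> = (\<integral>\<^sup>+y. (\<integral>\<^sup>+x. f y * g (y - T x) \<partial>lborel) \<partial>lborel)"
    by (rule lborel_pair.Fubini') simp
  also have "\<dots> = (\<integral>\<^sup>+y. f y \<partial>lborel) * (\<integral>\<^sup>+y. g y \<partial>lborel)"
    by (simp add: nn_integral_cmult shift_g nn_integral_multc)
  finally have eq: "(\<integral>\<^sup>+x. f (T x) \<partial>lborel) * (\<integral>\<^sup>+y. g y \<partial>lborel)
      = (\<integral>\<^sup>+y. f y \<partial>lborel) * (\<integral>\<^sup>+y. g y \<partial>lborel)" .
  have G: "(\<integral>\<^sup>+y. g y \<partial>lborel) = ennreal (unit_ball_vol (real DIM('a)))"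
    using emeasure_cball[of 1 "0::'a"] by (simp add: g_def)
  have "(\<integral>\<^sup>+x. f (T x) \<partial>lborel) = (\<integral>\<^sup>+y. f y \<partial>lborel)"
    using eq unit_ball_vol_pos[of "real DIM('a)", OF of_nat_0_le_iff] unfolding G by (simp add: mult.commute[of _ "ennreal _"] ennreal_mult_cancel_left)
  moreover have "emeasure (distr lborel borel T) A = (\<integral>\<^sup>+x. f (T x) \<partial>lborel)"
    unfolding f_def by (subst nn_integral_distr[symmetric, of T lborel borel]) auto
  ultimately show "emeasure (distr lborel borel T) A = emeasure lborel A"
    by (simp add: f_def)
qed simp

lemma PiM_density_lborel:
  fixes g :: "real \<Rightarrow> ennreal"
  assumes fin: "finite I" and g[measurable]: "g \<in> borel_measurable borel"
    and prob: "prob_space (density lborel g)"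
  shows "PiM I (\<lambda>_. density lborel g) = density (PiM I (\<lambda>_. lborel)) (\<lambda>f. \<Prod>i\<in>I. g (f i))"
proof -
  interpret G: prob_space "density lborel g" by fact
  interpret PG: product_sigma_finite "\<lambda>_. density lborel g"
    by (unfold_locales)
  interpret L: product_sigma_finite "\<lambda>_. lborel :: real measure" by standard
  have "density (PiM I (\<lambda>_. lborel)) (\<lambda>f. \<Prod>i\<in>I. g (f i)) = PiM I (\<lambda>_. density lborel g)"
  proof (rule PG.PiM_eqI[OF fin])
    show "sets (density (PiM I (\<lambda>_. lborel)) (\<lambda>f. \<Prod>i\<in>I. g (f i))) = sets (PiM I (\<lambda>_. density lborel g))"
      by (simp cong: sets_PiM_cong)
    fix A assume A: "\<And>i. i \<in> I \<Longrightarrow> A i \<in> sets (density lborel g)"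
    then have A'[measurable]: "\<And>i. i \<in> I \<Longrightarrow> A i \<in> sets borel" by simp
    have [measurable]: "Pi\<^sub>E I A \<in> sets (PiM I (\<lambda>_. lborel))"
      using A' fin by (intro sets_PiM_I_finite) auto
    have "emeasure (density (PiM I (\<lambda>_. lborel)) (\<lambda>f. \<Prod>i\<in>I. g (f i))) (Pi\<^sub>E I A)
        = (\<integral>\<^sup>+f. (\<Prod>i\<in>I. g (f i)) * indicator (Pi\<^sub>E I A) f \<partial>PiM I (\<lambda>_. lborel))"
      by (subst emeasure_density) (auto intro!: borel_measurable_prod)
    also have "\<dots> = (\<integral>\<^sup>+f. (\<Prod>i\<in>I. g (f i) * indicator (A i) (f i)) \<partial>PiM I (\<lambda>_. lborel))"
    proof (rule nn_integral_cong)
      fix f assume "f \<in> space (PiM I (\<lambda>_. lborel :: real measure))"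
      then have "f \<in> extensional I" by (simp add: space_PiM PiE_def)
      then have "indicator (Pi\<^sub>E I A) f = (\<Prod>i\<in>I. indicator (A i) (f i) :: ennreal)"
        using fin by (auto simp: indicator_def PiE_def Pi_iff)
      then show "(\<Prod>i\<in>I. g (f i)) * indicator (Pi\<^sub>E I A) f = (\<Prod>i\<in>I. g (f i) * indicator (A i) (f i))"
        by (simp add: prod.distrib)
    qed
    also have "\<dots> = (\<Prod>i\<in>I. \<integral>\<^sup>+x. g x * indicator (A i) x \<partial>lborel)"
      by (rule L.product_nn_integral_prod[OF fin]) simp
    also have "\<dots> = (\<Prod>i\<in>I. emeasure (density lborel g) (A i))"
      by (intro prod.cong refl) (simp add: emeasure_density)
    finally show "emeasure (density (PiM I (\<lambda>_. lborel)) (\<lambda>f. \<Prod>i\<in>I. g (f i))) (Pi\<^sub>E I A)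
        = (\<Prod>i\<in>I. emeasure (density lborel g) (A i))" .
  qed
  then show ?thesis by simp
qed

definition gauss_density :: "real \<Rightarrow> 'a::euclidean_space \<Rightarrow> real" where
  "gauss_density v x = exp (- (norm x)\<^sup>2 / v) / sqrt (pi * v) ^ DIM('a)"

abbreviation gauss :: "real \<Rightarrow> 'a::euclidean_space measure" where
  "gauss v \<equiv> density lborel (gauss_density v)"

lemma gauss_density_nonneg: "0 < v \<Longrightarrow> 0 \<le> gauss_density v x"
  by (simp add: gauss_density_def)

lemma borel_measurable_gauss_density [measurable]:
  "gauss_density v \<in> borel_measurable borel"
  unfolding gauss_density_def by measurable

lemma prob_space_gauss_real: "0 < v \<Longrightarrow> prob_space (gauss v :: real measure)"
proof -
  assume v: "0 < v"
  have "(gauss_density v :: real \<Rightarrow> real) = normal_density 0 (sqrt (v / 2))"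
    using v by (auto simp: gauss_density_def normal_density_def fun_eq_iff)
  then show ?thesis using prob_space_normal_density[of "sqrt (v/2)" 0] v by simp
qed

lemma gauss_eq_PiM:
  assumes v: "0 < v"
  shows "(gauss v :: 'a::euclidean_space measure) =
    distr (PiM Basis (\<lambda>_. gauss v)) borel (\<lambda>f. \<Sum>b\<in>Basis. f b *\<^sub>R b)"
proof -
  have *: "ennreal (gauss_density v (\<Sum>b\<in>Basis. f b *\<^sub>R b :: 'a)) = (\<Prod>b\<in>(Basis::'a set). ennreal (gauss_density v (f b)))" for f
  proof -
    have n: "(norm (\<Sum>b\<in>Basis. f b *\<^sub>R b :: 'a))\<^sup>2 = (\<Sum>b\<in>(Basis::'a set). (f b)\<^sup>2)"
      unfolding power2_norm_eq_inner by (subst euclidean_inner) (simp add: power2_eq_square)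
    show ?thesis
      using v by (simp add: prod_ennreal gauss_density_nonneg gauss_density_def n prod_dividef
          exp_sum[symmetric] sum_divide_distrib sum_negf)
  qed
  have "gauss v = density (distr (PiM (Basis::'a set) (\<lambda>_. lborel)) borel (\<lambda>f. \<Sum>b\<in>Basis. f b *\<^sub>R b)) (gauss_density v :: 'a \<Rightarrow> real)"
    by (subst lborel_eq) simp
  also have "\<dots> = distr (density (PiM (Basis::'a set) (\<lambda>_. lborel)) (\<lambda>f. ennreal (gauss_density v (\<Sum>b\<in>Basis. f b *\<^sub>R b :: 'a)))) borel (\<lambda>f. \<Sum>b\<in>Basis. f b *\<^sub>R b)"
    by (rule density_distr) auto
  also have "\<dots> = distr (PiM Basis (\<lambda>_. gauss v)) borel (\<lambda>f. \<Sum>b\<in>Basis. f b *\<^sub>R b)"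
    unfolding * by (subst PiM_density_lborel) (auto intro: prob_space_gauss_real[OF v])
  finally show ?thesis .
qed

lemma prob_space_gauss:
  assumes "0 < v" shows "prob_space (gauss v :: 'a::euclidean_space measure)"
proof -
  show ?thesis
    by (subst gauss_eq_PiM[OF assms], rule prob_space.prob_space_distr) (auto intro: prob_space_PiM prob_space_gauss_real assms)
qed

lemma distr_gauss_orthogonal_transformation:
  fixes T :: "'a::euclidean_space \<Rightarrow> 'a"
  assumes T: "orthogonal_transformation T"
  shows "distr (gauss v) borel T = gauss v"
proof -
  have lin: "linear T" and norm_T: "norm (T x) = norm x" for x
    using T by (auto simp: orthogonal_transformation)
  have [measurable]: "T \<in> borel_measurable borel"
    using lin by (intro borel_measurable_continuous_onI linear_continuous_on) (simp add: linear_conv_bounded_linear)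
  have "gauss v = density (distr lborel borel T) (gauss_density v :: 'a \<Rightarrow> real)"
    by (simp add: lborel_distr_orthogonal_transformation[OF T])
  also have "\<dots> = distr (density lborel (\<lambda>x. ennreal (gauss_density v (T x)))) borel T"
    by (rule density_distr) auto
  also have "\<dots> = distr (gauss v) borel T"
    by (simp add: gauss_density_def norm_T)
  finally show ?thesis by simp
qed

lemma distr_gauss_scaleR:
  assumes c: "c \<noteq> 0"
  shows "distr (gauss v) borel (\<lambda>x. c *\<^sub>R x) = (gauss (c\<^sup>2 * v) :: 'a::euclidean_space measure)"
proof -
  have [simp]: "sqrt (pi * (c\<^sup>2 * v)) = \<bar>c\<bar> * sqrt (pi * v)"
    by (simp add: real_sqrt_mult)
  have "(gauss (c\<^sup>2 * v) :: 'a measure) = density (density (distr lborel borel (\<lambda>x. 0 + c *\<^sub>R x)) (\<lambda>_. ennreal (\<bar>c\<bar> ^ DIM('a)))) (gauss_density (c\<^sup>2 * v))"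
    using lborel_affine[OF c, of "0::'a"] by simp
  also have "\<dots> = density (distr lborel borel (\<lambda>x. c *\<^sub>R x)) (gauss_density v \<circ> (\<lambda>x. x /\<^sub>R c))"
  proof -
    have "\<bar>c\<bar> ^ DIM('a) * gauss_density (c\<^sup>2 * v) x = gauss_density v (x /\<^sub>R c)" for x :: 'a
      using c by (simp add: gauss_density_def power_mult_distrib power_divide divide_simps)
    then show ?thesis
      by (subst density_density_eq) (auto simp: o_def ennreal_mult'[symmetric])
  qed
  also have "\<dots> = distr (gauss v) borel (\<lambda>x. c *\<^sub>R x)"
    using c by (subst density_distr) auto
  finally show ?thesis by simp
qed

text \<open>After rescaling, \<open>X + Y\<close> is the first coordinate of a rotation of a standard Gaussian pair.\<close>

lemma (in prob_space) distr_sum_indep_gauss: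
  fixes X Y :: "'a \<Rightarrow> 'b::euclidean_space"
  assumes ab: "0 < a" "0 < b" and ind: "indep_var borel X borel Y"
    and X: "distr M borel X = gauss a" and Y: "distr M borel Y = gauss b"
  shows "distr M borel (\<lambda>\<omega>. X \<omega> + Y \<omega>) = gauss (a + b)"
proof -
  interpret G: prob_space "gauss 1 :: 'b measure" by (rule prob_space_gauss) simp
  have [measurable]: "X \<in> borel_measurable M" "Y \<in> borel_measurable M"
    using ind by (auto dest: indep_var_rv1 indep_var_rv2)
  define c s where "c = sqrt (a / (a + b))" and "s = sqrt (b / (a + b))"
  have cs: "c\<^sup>2 + s\<^sup>2 = 1" "sqrt (a + b) * c = sqrt a" "sqrt (a + b) * s = sqrt b"
    using ab by (auto simp: c_def s_def add_divide_distrib[symmetric] real_sqrt_mult[symmetric])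
  define T :: "'b \<times> 'b \<Rightarrow> 'b \<times> 'b" where
    "T = (\<lambda>p. (c *\<^sub>R fst p + s *\<^sub>R snd p, (- s) *\<^sub>R fst p + c *\<^sub>R snd p))"
  have T: "orthogonal_transformation T"
    unfolding orthogonal_transformation_def
  proof safe
    show "linear T"
      by (rule linearI) (auto simp: T_def algebra_simps)
    fix p q :: "'b \<times> 'b"
    have "T p \<bullet> T q = (c\<^sup>2 + s\<^sup>2) * (fst p \<bullet> fst q) + (c\<^sup>2 + s\<^sup>2) * (snd p \<bullet> snd q)"
      by (simp add: T_def inner_prod_def inner_add inner_diff algebra_simps power2_eq_square)
    then show "T p \<bullet> T q = p \<bullet> q" by (simp add: cs inner_prod_def)
  qed
  have [measurable]: "T \<in> borel_measurable borel" "fst \<in> borel_measurable (borel :: ('b \<times> 'b) measure)"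
    unfolding T_def by (intro borel_measurable_continuous_onI continuous_intros)+
  have prod: "(gauss 1 \<Otimes>\<^sub>M gauss 1 :: ('b \<times> 'b) measure) = gauss 1"
  proof -
    have "(gauss 1 \<Otimes>\<^sub>M gauss 1 :: ('b \<times> 'b) measure) =
       density (lborel \<Otimes>\<^sub>M lborel) (\<lambda>(x, y). ennreal (gauss_density 1 x) * ennreal (gauss_density 1 y))"
      by (rule pair_measure_density) (auto intro: G.sigma_finite_measure_axioms sigma_finite_lborel)
    also have "\<dots> = gauss 1"
      unfolding lborel_prod
    proof (rule density_cong)
      show "(\<lambda>(x, y). ennreal (gauss_density 1 x) * ennreal (gauss_density 1 y))
          \<in> borel_measurable (lborel :: ('b \<times> 'b) measure)"
        unfolding lborel_prod[symmetric] by measurable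
      show "(\<lambda>p. ennreal (gauss_density 1 p)) \<in> borel_measurable (lborel :: ('b \<times> 'b) measure)"
        by simp
    qed (auto simp: gauss_density_def ennreal_mult'[symmetric] norm_prod_def
          power_add exp_add[symmetric] field_simps split: prod.split)
    finally show ?thesis .
  qed
  have "distr M borel (\<lambda>\<omega>. X \<omega> + Y \<omega>) = distr (distr M (borel \<Otimes>\<^sub>M borel) (\<lambda>\<omega>. (X \<omega>, Y \<omega>))) borel (\<lambda>p. fst p + snd p)"
    by (subst distr_distr) (auto simp: o_def)
  also have "\<dots> = distr (gauss a \<Otimes>\<^sub>M gauss b) borel (\<lambda>p. fst p + snd p)"
    using ind unfolding indep_var_distribution_eq X Y by simp
  also have "gauss a \<Otimes>\<^sub>M gauss b = distr (gauss 1) borel (\<lambda>x::'b. sqrt a *\<^sub>R x) \<Otimes>\<^sub>M distr (gauss 1) borel (\<lambda>x::'b. sqrt b *\<^sub>R x)"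
    using ab by (simp add: distr_gauss_scaleR)
  also have "\<dots> = distr (gauss 1 \<Otimes>\<^sub>M gauss 1) (borel \<Otimes>\<^sub>M borel) (\<lambda>(x, y). (sqrt a *\<^sub>R x, sqrt b *\<^sub>R y))"
    using ab by (intro pair_measure_distr) (auto simp: distr_gauss_scaleR intro!: prob_space_imp_sigma_finite prob_space_gauss)
  also have "distr \<dots> borel (\<lambda>p. fst p + snd p) = distr (gauss 1 \<Otimes>\<^sub>M gauss 1) borel (\<lambda>p. sqrt (a + b) *\<^sub>R fst (T p))"
    by (subst distr_distr) (auto simp: o_def T_def case_prod_beta scaleR_add_right cs intro!: distr_cong)
  also have "\<dots> = distr (distr (distr (gauss 1) borel T) borel fst) borel (\<lambda>x. sqrt (a + b) *\<^sub>R x)"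
    unfolding prod by (simp add: distr_distr o_def)
  also have "distr (distr (gauss 1) borel T) borel fst = (gauss 1 :: 'b measure)"
    unfolding distr_gauss_orthogonal_transformation[OF T]
    using G.distr_pair_fst[of "gauss 1 :: 'b measure"] unfolding prod by (simp cong: distr_cong)
  also have "distr \<dots> borel (\<lambda>x. sqrt (a + b) *\<^sub>R x) = gauss (a + b)"
    using ab by (simp add: distr_gauss_scaleR)
  finally show ?thesis .
qed

lemma distr_PiM_lborel_sum_squares:
  assumes fin: "finite A" and card: "card A = 2 * Suc m"
  shows "distr (PiM A (\<lambda>_. lborel)) borel (\<lambda>f. \<Sum>i\<in>A. (f i)\<^sup>2) =
    density lborel (\<lambda>t::real. ennreal (indicator {0..} t * (pi ^ Suc m * t ^ m / fact m)))"
    (is "?L = ?R")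
proof (rule measure_eqI_generator_eq_countable[where \<Omega>=UNIV and E="range atMost" and A="range (\<lambda>n::nat. {..real n})"])
  have L: "emeasure ?L {..t} = ennreal (pi ^ Suc m / fact (Suc m) * t ^ Suc m)" if t: "0 < t" for t :: real
  proof -
    have "emeasure ?L {..t} = emeasure (PiM A (\<lambda>_. lborel)) ({f. sqrt (\<Sum>i\<in>A. (f i)\<^sup>2) \<le> sqrt t} \<inter> space (PiM A (\<lambda>_. lborel)))"
      using t by (subst emeasure_distr) (auto intro!: arg_cong[where f="emeasure _"])
    also have "\<dots> = ennreal (unit_ball_vol (real (card A)) * sqrt t ^ card A)"
      using t fin by (intro emeasure_cball_aux) auto
    also have "sqrt t ^ card A = t ^ Suc m"
      using t unfolding card power_mult by simp
    finally show ?thesis unfolding card unit_ball_vol_even by simp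
  qed
  have R: "emeasure ?R {..t} = ennreal (pi ^ Suc m / fact (Suc m) * t ^ Suc m)" if t: "0 \<le> t" for t :: real
  proof -
    have deriv: "((\<lambda>x. pi ^ Suc m / fact (Suc m) * x ^ Suc m) has_real_derivative
          pi ^ Suc m * x ^ m / fact m) (at x within S)" for x S
    proof -
      have "((\<lambda>x. pi ^ Suc m / fact (Suc m) * x ^ Suc m) has_real_derivative
          pi ^ Suc m / fact (Suc m) * (real (Suc m) * x ^ m)) (at x within S)"
        using DERIV_cmult[OF DERIV_pow[of "Suc m" x S], of "pi ^ Suc m / fact (Suc m)"]
        unfolding diff_Suc_Suc minus_nat.diff_0 .
      moreover have "pi ^ Suc m / fact (Suc m) * (real (Suc m) * x ^ m) = pi ^ Suc m * x ^ m / fact m"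
        unfolding fact_Suc by (simp del: of_nat_Suc power_Suc)
      ultimately show ?thesis by metis
    qed
    have "emeasure ?R {..t} = (\<integral>\<^sup>+x. ennreal (pi ^ Suc m * x ^ m / fact m) * indicator {0..t} x \<partial>lborel)"
      by (subst emeasure_density) (auto intro!: nn_integral_cong simp: indicator_def)
    also have "\<dots> = ennreal (pi ^ Suc m / fact (Suc m) * t ^ Suc m - pi ^ Suc m / fact (Suc m) * 0 ^ Suc m)"
      using t deriv by (intro nn_integral_FTC_Icc) auto
    finally show ?thesis by simp
  qed
  have L0: "emeasure ?L {..t} = 0" if t: "t \<le> 0" for t :: real
  proof -
    have le: "emeasure ?L {..t} \<le> ennreal (pi ^ Suc m / fact (Suc m) * e ^ Suc m)" if "0 < e" for e
      unfolding L[OF that, symmetric] using t that by (intro emeasure_mono) auto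
    have "((\<lambda>e. ennreal (pi ^ Suc m / fact (Suc m) * e ^ Suc m)) \<longlongrightarrow> ennreal (pi ^ Suc m / fact (Suc m) * 0 ^ Suc m)) (at_right 0)"
      by (intro tendsto_intros)
    then have "emeasure ?L {..t} \<le> ennreal (pi ^ Suc m / fact (Suc m) * 0 ^ Suc m)"
      by (rule tendsto_lowerbound) (use le in \<open>auto simp: eventually_at_filter\<close>)
    then show ?thesis by simp
  qed
  show "emeasure ?L X = emeasure ?R X" if X: "X \<in> range atMost" for X
  proof -
    obtain t where t: "X = {..t}" using X by auto
    show ?thesis
    proof (cases "0 < t")
      case True then show ?thesis using L[of t] R[of t] by (simp add: t)
    next
      case False
      then have "emeasure ?R {..t} \<le> emeasure ?R {..0}" by (intro emeasure_mono) auto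
      then show ?thesis using R[of 0] L0[of t] False by (simp add: t)
    qed
  qed
  show "emeasure ?L a \<noteq> \<infinity>" if a: "a \<in> range (\<lambda>n::nat. {..real n})" for a
  proof -
    obtain n where "a = {..real n}" using a by auto
    moreover have "emeasure ?L {..real n} \<le> emeasure ?L {..real (Suc n)}" by (intro emeasure_mono) auto
    ultimately show ?thesis using L[of "real (Suc n)"] by (auto simp: top_unique)
  qed
  show "(\<Union> (range (\<lambda>n::nat. {..real n}))) = UNIV"
    using real_arch_simple by blast
  have borel: "sets (borel :: real measure) = sigma_sets UNIV (range atMost)"
    unfolding borel_eq_atMost by (rule sets_measure_of) simp
  then show "sets ?L = sigma_sets UNIV (range atMost)" "sets ?R = sigma_sets UNIV (range atMost)"
    by simp_all
  show "Int_stable (range (atMost :: real \<Rightarrow> _))"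
  proof (rule Int_stableI_image)
    fix a b :: real
    show "\<exists>c\<in>UNIV. {..a} \<inter> {..b} = {..c}" by (intro bexI[of _ "min a b"]) auto
  qed
  show "range (\<lambda>n::nat. {..real n}) \<subseteq> range atMost" by blast
qed simp_all

lemma distr_PiM_gauss_sum_squares:
  assumes v: "0 < v" and fin: "finite A" and card: "card A = 2 * Suc m"
  shows "distr (PiM A (\<lambda>_. gauss v)) borel (\<lambda>f. \<Sum>i\<in>A. (f i)\<^sup>2) = density lborel (erlang_density m (1 / v))"
proof -
  define h where "h t = exp (- t / v) / sqrt (pi * v) ^ card A" for t
  have [measurable]: "h \<in> borel_measurable borel" unfolding h_def by measurable
  have h: "(\<Prod>i\<in>A. ennreal (gauss_density v (f i))) = ennreal (h (\<Sum>i\<in>A. (f i)\<^sup>2))" for f :: "_ \<Rightarrow> real"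
    using v by (simp add: prod_ennreal gauss_density_nonneg gauss_density_def h_def prod_dividef
          exp_sum[OF fin, symmetric] sum_divide_distrib sum_negf)
  have "distr (PiM A (\<lambda>_. gauss v)) borel (\<lambda>f. \<Sum>i\<in>A. (f i)\<^sup>2) =
     distr (density (PiM A (\<lambda>_. lborel)) (\<lambda>f. ennreal (h (\<Sum>i\<in>A. (f i)\<^sup>2)))) borel (\<lambda>f. \<Sum>i\<in>A. (f i)\<^sup>2)"
    unfolding h[symmetric] by (subst PiM_density_lborel) (auto intro: prob_space_gauss_real v fin)
  also have "\<dots> = density (distr (PiM A (\<lambda>_. lborel)) borel (\<lambda>f. \<Sum>i\<in>A. (f i)\<^sup>2)) h"
    by (rule density_distr[symmetric]) auto
  also have "\<dots> = density lborel (\<lambda>t. ennreal (indicator {0..} t * (pi ^ Suc m * t ^ m / fact m)) * ennreal (h t))"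
    unfolding distr_PiM_lborel_sum_squares[OF fin card] by (rule density_density_eq) auto
  also have "\<dots> = density lborel (erlang_density m (1 / v))"
  proof (intro density_cong AE_I2)
    fix t :: real
    have "sqrt (pi * v) ^ card A = (pi * v) ^ Suc m"
      using v unfolding card power_mult by simp
    then have eq: "pi ^ Suc m * t ^ m / fact m * h t = erlang_density m (1 / v) t" if "0 \<le> t"
      using that v by (simp add: h_def erlang_density_def power_divide power_mult_distrib)
    show "ennreal (indicator {0..} t * (pi ^ Suc m * t ^ m / fact m)) * ennreal (h t) = ennreal (erlang_density m (1 / v) t)"
    proof (cases "0 \<le> t")
      case True
      have "0 \<le> h t" using v by (simp add: h_def)
      then have "ennreal (indicator {0..} t * (pi ^ Suc m * t ^ m / fact m)) * ennreal (h t) =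
          ennreal (pi ^ Suc m * t ^ m / fact m * h t)"
        using True by (simp add: ennreal_mult''[symmetric] del: power_Suc)
      then show ?thesis using eq[OF True] by simp
    qed (simp add: erlang_density_def)
  qed auto
  finally show ?thesis .
qed

lemma ex_orthogonal_transformation_to_Basis:
  fixes B :: "'a::euclidean_space set"
  assumes orth: "pairwise orthogonal B" and norm1: "\<And>b. b \<in> B \<Longrightarrow> norm b = 1"
  shows "\<exists>T::'a \<Rightarrow> 'a. orthogonal_transformation T \<and> inj_on T B \<and> T ` B \<subseteq> Basis"
proof -
  define S where "S = {y. \<forall>x\<in>span B. orthogonal x y}"
  have S: "subspace S" unfolding S_def by (rule subspace_orthogonal_to_vectors)
  obtain C where C: "C \<subseteq> S" "pairwise orthogonal C" "\<And>x. x \<in> C \<Longrightarrow> norm x = 1" "independent C" "card C = dim S" "span C = S"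
    using orthonormal_basis_subspace[OF S] by metis
  have "0 \<notin> B" using norm1 by fastforce
  then have indB: "independent B" by (rule pairwise_orthogonal_independent[OF orth])
  then have finB: "finite B" and cardB: "card B = dim B" by (auto intro: independent_imp_finite simp: dim_eq_card_independent)
  have finC: "finite C" using C(4) by (rule independent_imp_finite)
  have BC: "orthogonal b c" if "b \<in> B" "c \<in> C" for b c
    using that C(1) by (auto simp: S_def span_base)
  have disj: "B \<inter> C = {}"
    using BC norm1 by (force simp: orthogonal_def)
  have "dim {y \<in> UNIV. \<forall>x\<in>span B. orthogonal x y} + dim (span B) = dim (UNIV :: 'a set)"
    by (intro dim_subspace_orthogonal_to_vectors) auto
  then have "card (B \<union> C) = DIM('a)"
    using C(5) finB finC disj cardB by (simp add: card_Un_disjoint S_def)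
  then obtain \<sigma> where \<sigma>: "bij_betw \<sigma> (B \<union> C) (Basis :: 'a set)"
    using finB finC by (metis finite_Basis finite_UnI finite_same_card_bij)
  define T where "T x = (\<Sum>b\<in>B \<union> C. (x \<bullet> b) *\<^sub>R \<sigma> b)" for x
  have on: "b \<bullet> b' = (if b = b' then 1 else 0)" if "b \<in> B \<union> C" "b' \<in> B \<union> C" for b b'
  proof (cases "b = b'")
    case True then show ?thesis using that norm1 C(3) by (auto simp: norm_eq_1)
  next
    case False
    then have "orthogonal b b'"
      using that BC orth C(2) by (auto simp: pairwise_def intro: orthogonal_commute[THEN iffD1])
    then show ?thesis using False by (simp add: orthogonal_def)
  qed
  have T\<sigma>: "T b = \<sigma> b" if "b \<in> B \<union> C" for b
  proof -
    have "T b = (\<Sum>b'\<in>B \<union> C. if b = b' then \<sigma> b' else 0)"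
      unfolding T_def using that by (intro sum.cong) (auto simp: on)
    then show ?thesis using that finB finC by simp
  qed
  have "linear T" unfolding T_def
    by (rule linearI) (auto simp: inner_add_left scaleR_add_left sum.distrib scaleR_sum_right)
  have norm: "norm (T x) = norm x" for x
  proof -
    have ind: "independent (B \<union> C)"
    proof (rule pairwise_orthogonal_independent)
      show "pairwise orthogonal (B \<union> C)"
        by (auto simp: pairwise_def orthogonal_def on)
      show "0 \<notin> B \<union> C"
        using norm1 C(3) by fastforce
    qed
    then have "x \<in> span (B \<union> C)"
      using \<open>card (B \<union> C) = DIM('a)\<close>
      by (metis UNIV_I card_ge_dim_independent dim_UNIV le_refl subset_UNIV subsetD)
    then obtain u where u: "x = (\<Sum>b\<in>B \<union> C. u b *\<^sub>R b)"
      using finB finC by (auto simp: span_finite)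
    have xb: "x \<bullet> b = u b" if "b \<in> B \<union> C" for b
    proof -
      have "x \<bullet> b = (\<Sum>b'\<in>B \<union> C. if b' = b then u b' else 0)"
        unfolding u inner_sum_left using that by (intro sum.cong) (auto simp: on)
      then show ?thesis using that finB finC by simp
    qed
    have "(norm x)\<^sup>2 = (\<Sum>b\<in>B \<union> C. (u b)\<^sup>2)"
      unfolding power2_norm_eq_inner by (subst (2) u) (simp add: inner_sum_right xb power2_eq_square)
    moreover have "(norm (T x))\<^sup>2 = (\<Sum>b\<in>B \<union> C. (u b)\<^sup>2)"
    proof -
      have Tx: "T x = (\<Sum>b\<in>B \<union> C. u b *\<^sub>R \<sigma> b)"
        unfolding T_def by (intro sum.cong) (auto simp: xb)
      have "(norm (T x))\<^sup>2 = (\<Sum>b\<in>B \<union> C. \<Sum>b'\<in>B \<union> C. u b * (u b' * (\<sigma> b' \<bullet> \<sigma> b)))"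
        unfolding power2_norm_eq_inner Tx by (simp add: inner_sum_left inner_sum_right sum_distrib_left)
      also have "\<dots> = (\<Sum>b\<in>B \<union> C. \<Sum>b'\<in>B \<union> C. if b' = b then (u b)\<^sup>2 else 0)"
      proof (intro sum.cong refl)
        fix b b' assume b: "b \<in> B \<union> C" "b' \<in> B \<union> C"
        have "\<sigma> b \<in> Basis" "\<sigma> b' \<in> Basis" using bij_betw_apply[OF \<sigma>] b by auto
        moreover have "\<sigma> b' = \<sigma> b \<longleftrightarrow> b' = b"
          using inj_on_eq_iff[OF bij_betw_imp_inj_on[OF \<sigma>] b(2,1)] .
        ultimately show "u b * (u b' * (\<sigma> b' \<bullet> \<sigma> b)) = (if b' = b then (u b)\<^sup>2 else 0)"
          by (simp add: inner_Basis power2_eq_square)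
      qed
      also have "\<dots> = (\<Sum>b\<in>B \<union> C. (u b)\<^sup>2)" using finB finC by simp
      finally show ?thesis .
    qed
    ultimately show ?thesis by (metis norm_ge_zero power2_eq_iff_nonneg)
  qed
  have "orthogonal_transformation T" using \<open>linear T\<close> norm by (simp add: orthogonal_transformation)
  moreover have "inj_on T B" "T ` B \<subseteq> Basis"
    using \<sigma> T\<sigma> by (auto simp: bij_betw_def inj_on_def)
  ultimately show ?thesis by blast
qed

text \<open>After an orthogonal transformation the orthonormal set consists of coordinate vectors, so
  only the volumes of even-dimensional balls are needed.\<close>

lemma distr_gauss_sum_squares:
  fixes B :: "'a::euclidean_space set"
  assumes v: "0 < v" and orth: "pairwise orthogonal B" and norm1: "\<And>b. b \<in> B \<Longrightarrow> norm b = 1"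
    and card: "card B = 2 * Suc m"
  shows "distr (gauss v) borel (\<lambda>x. \<Sum>b\<in>B. (b \<bullet> x)\<^sup>2) = density lborel (erlang_density m (1 / v))"
proof -
  obtain T :: "'a \<Rightarrow> 'a" where T: "orthogonal_transformation T" and inj: "inj_on T B" and TB: "T ` B \<subseteq> Basis"
    using ex_orthogonal_transformation_to_Basis[OF orth norm1] by auto
  define A where "A = T ` B"
  have A: "A \<subseteq> Basis" "finite A" "card A = 2 * Suc m"
    using TB inj card finite_subset[OF TB] by (auto simp: A_def card_image)
  have lin: "linear T"
    using T by (auto simp: orthogonal_transformation)
  have [measurable]: "T \<in> borel_measurable borel"
    using lin by (intro borel_measurable_continuous_onI linear_continuous_on) (simp add: linear_conv_bounded_linear)
  have sum_eq: "(\<Sum>b\<in>B. (b \<bullet> x)\<^sup>2) = (\<Sum>i\<in>A. (i \<bullet> T x)\<^sup>2)" for x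
    unfolding A_def using inj T by (simp add: sum.reindex orthogonal_transformation_def)
  interpret G: prob_space "gauss v :: real measure" using v by (rule prob_space_gauss_real)
  interpret P: product_prob_space "\<lambda>_. gauss v :: real measure" "Basis :: 'a set" by unfold_locales
  have "distr (gauss v) borel (\<lambda>x. \<Sum>b\<in>B. (b \<bullet> x)\<^sup>2) = distr (distr (gauss v) borel T) borel (\<lambda>x. \<Sum>i\<in>A. (i \<bullet> x)\<^sup>2)"
    by (subst distr_distr) (auto simp: o_def sum_eq)
  also have "\<dots> = distr (gauss v) borel (\<lambda>x. \<Sum>i\<in>A. (i \<bullet> x)\<^sup>2)"
    by (simp add: distr_gauss_orthogonal_transformation[OF T])
  also have "\<dots> = distr (PiM Basis (\<lambda>_. gauss v)) borel (\<lambda>f. \<Sum>i\<in>A. (f i)\<^sup>2)"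
    using A(1)
    by (subst gauss_eq_PiM[OF v], subst distr_distr) (auto simp: o_def inner_commute[of _ "sum _ _"] subset_iff intro!: distr_cong sum.cong)
  also have "\<dots> = distr (distr (PiM Basis (\<lambda>_. gauss v)) (PiM A (\<lambda>_. gauss v)) (\<lambda>f. restrict f A)) borel (\<lambda>f. \<Sum>i\<in>A. (f i)\<^sup>2)"
    using A by (subst distr_distr) (auto simp: o_def intro!: measurable_restrict_subset)
  also have "distr (PiM Basis (\<lambda>_. gauss v)) (PiM A (\<lambda>_. gauss v)) (\<lambda>f. restrict f A) = PiM A (\<lambda>_. gauss v :: real measure)"
    by (rule P.distr_PiM_restrict_finite[OF A(2,1)])
  finally show ?thesis using distr_PiM_gauss_sum_squares[OF v A(2,3)] by simp
qed

section \<open>Sums of independent exponential variables\<close>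

lemma integrable_erlang_density:
  assumes "0 < l" shows "integrable lborel (erlang_density k l)"
proof -
  interpret prob_space "density lborel (erlang_density k l)" using assms by (rule prob_space_erlang_density)
  show ?thesis
    using assms emeasure_space_1 by (intro integrableI_nonneg) (auto simp: emeasure_density)
qed

lemma fourier_erlang_density:
  assumes l: "0 < l"
  shows "(CLINT x|lborel. of_real (erlang_density k l x) * iexp (t * x)) = inverse ((1 - \<i> * of_real (t / l)) ^ Suc k)"
proof -
  define s where "s = of_real l - \<i> * of_real t"
  have s0: "s \<noteq> 0" using l by (auto simp: s_def complex_eq_iff)
  define f where "f k x = of_real (x ^ k) * exp (- s * of_real x)" for k :: nat and x :: real
  have norm_f: "norm (f k x) = \<bar>x\<bar> ^ k * exp (- l * x)" for k x
    by (simp add: f_def norm_mult s_def norm_power)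
  have cont: "continuous_on UNIV (f k)" for k
    unfolding f_def by (intro continuous_intros)
  have [measurable]: "f k \<in> borel_measurable borel" for k
    using cont by (rule borel_measurable_continuous_onI)
  have erl: "of_real (erlang_density k l x) * iexp (t * x) =
      of_real (l ^ Suc k / fact k) * (indicator {0<..} x *\<^sub>R f k x)" if "x \<noteq> 0" for x k
    using that by (auto simp: f_def s_def erlang_density_def indicator_def exp_add[symmetric] exp_of_real[symmetric] algebra_simps)
  have AE_erl: "AE x in lborel. of_real (erlang_density k l x) * iexp (t * x) =
      of_real (l ^ Suc k / fact k) * (indicator {0<..} x *\<^sub>R f k x)" for k
    using AE_lborel_singleton[of 0] by eventually_elim (rule erl)
  have int: "set_integrable lborel {0<..} (f k)" for k
    unfolding set_integrable_def
  proof (rule Bochner_Integration.integrable_bound[where f="\<lambda>x. (fact k / l ^ Suc k) * erlang_density k l x"])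
    show "AE x in lborel. norm (indicat_real {0<..} x *\<^sub>R f k x) \<le> norm (fact k / l ^ Suc k * erlang_density k l x)"
      using l by (auto simp: indicator_def norm_f erlang_density_def)
  qed (auto intro!: integrable_erlang_density l)
  define J where "J k = (LBINT x=0..\<infinity>. f k x)" for k
  have J: "J k = (CLINT x|lborel. indicator {0<..} x *\<^sub>R f k x)" for k
    by (simp add: J_def interval_lebesgue_integral_def set_lebesgue_integral_def zero_ereal_def)
  have lim: "(f k \<longlongrightarrow> 0) at_top" for k
  proof -
    have "((\<lambda>x. (l * x) ^ k / exp (l * x)) \<longlongrightarrow> 0) at_top"
      using l by (intro filterlim_compose[OF tendsto_power_div_exp_0] filterlim_tendsto_pos_mult_at_top[OF tendsto_const]) (auto simp: filterlim_ident)
    then have "((\<lambda>x. (l * x) ^ k / exp (l * x) / l ^ k) \<longlongrightarrow> 0 / l ^ k) at_top"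
      using l by (intro tendsto_intros) auto
    moreover have "(l * x) ^ k / exp (l * x) / l ^ k = x ^ k * exp (- l * x)" for x
      using l by (simp add: power_mult_distrib exp_minus field_simps)
    ultimately have "((\<lambda>x. x ^ k * exp (- l * x)) \<longlongrightarrow> 0) at_top" by simp
    then have "((\<lambda>x. norm (f k x)) \<longlongrightarrow> 0) at_top"
      by (rule Lim_transform_eventually) (auto simp: norm_f eventually_at_top_linorder intro!: exI[of _ 0])
    then show ?thesis by (rule tendsto_norm_zero_cancel)
  qed
  have FTC: "(LBINT x=0..\<infinity>. of_nat k * f (k - 1) x - s * f k x) = 0 - f k 0" for k
  proof (rule interval_integral_FTC_integrable[where F="f k"])
    show "(f k has_vector_derivative of_nat k * f (k - 1) x - s * f k x) (at x)" for x
    proof -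
      have "((\<lambda>z. z ^ k * exp (- s * z)) has_field_derivative
          of_nat k * of_real x ^ (k - 1) * exp (- s * of_real x) - s * (of_real x ^ k * exp (- s * of_real x))) (at (of_real x))"
        by (rule derivative_eq_intros refl | simp)+
      from has_vector_derivative_real_field[OF this] show ?thesis
        by (simp add: f_def[abs_def] mult.assoc)
    qed
    show "isCont (\<lambda>x. of_nat k * f (k - 1) x - s * f k x) x" for x
      using cont by (intro continuous_intros) (auto simp: continuous_on_eq_continuous_at)
    show "set_integrable lborel (einterval 0 \<infinity>) (\<lambda>x. of_nat k * f (k - 1) x - s * f k x)"
      using int by (simp add: zero_ereal_def)
    show "((f k \<circ> real_of_ereal) \<longlongrightarrow> f k 0) (at_right 0)"
      unfolding zero_ereal_def ereal_tendsto_simps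
      using cont[of k] by (simp add: continuous_on_eq_continuous_at isCont_def filterlim_at_split)
    show "((f k \<circ> real_of_ereal) \<longlongrightarrow> 0) (at_left \<infinity>)"
      unfolding ereal_tendsto_simps by (rule lim)
  qed simp
  have rec: "of_nat k * J (k - 1) - s * J k = - f k 0" for k
  proof -
    have "(LBINT x=0..\<infinity>. of_nat k * f (k - 1) x - s * f k x) = of_nat k * J (k - 1) - s * J k"
      unfolding J_def using int
      by (subst interval_lebesgue_integral_diff) (auto simp: interval_lebesgue_integrable_def zero_ereal_def)
    then show ?thesis using FTC[of k] by simp
  qed
  have Jk: "J k = fact k / s ^ Suc k"
  proof (induction k)
    case 0 then show ?case using rec[of 0] s0 by (simp add: f_def field_simps)
  next
    case (Suc k)
    have "s * J (Suc k) = of_nat (Suc k) * J k" using rec[of "Suc k"] by (simp add: f_def)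
    then have "J (Suc k) = of_nat (Suc k) * (fact k / s ^ Suc k) / s"
      using s0 Suc by (metis nonzero_mult_div_cancel_left)
    then show ?case by (simp add: mult_ac)
  qed
  have "(CLINT x|lborel. of_real (erlang_density k l x) * iexp (t * x)) = of_real (l ^ Suc k / fact k) * J k"
    unfolding J by (subst integral_mult_right_zero[symmetric]) (intro integral_cong_AE AE_erl; measurable)
  also have "\<dots> = (of_real l / s) ^ Suc k"
    unfolding Jk by (simp add: power_divide)
  also have "of_real l / s = inverse (1 - \<i> * of_real (t / l))"
    using l s0 by (simp add: s_def field_simps)
  finally show ?thesis by (simp add: power_inverse)
qed

lemma integrable_mult_iexp:
  fixes f :: "real \<Rightarrow> real"
  assumes "integrable lborel f" shows "integrable lborel (\<lambda>x. of_real (f x) * iexp (t * x))"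
proof (rule Bochner_Integration.integrable_bound[OF assms])
  have [measurable]: "f \<in> borel_measurable borel" using assms by auto
  show "(\<lambda>x. of_real (f x) * iexp (t * x)) \<in> borel_measurable lborel" by measurable
qed (simp add: norm_mult)

text \<open>Stated for signed functions, since the partial-fraction density is not known in advance to be
  nonnegative: the uniqueness theorem for characteristic functions is applied to the normalised
  positive and negative parts of \<open>f - g\<close>.\<close>

lemma AE_eq_if_fourier_eq:
  fixes f g :: "real \<Rightarrow> real"
  assumes f: "integrable lborel f" and g: "integrable lborel g"
    and eq: "\<And>t. (CLINT x|lborel. of_real (f x) * iexp (t * x)) = (CLINT x|lborel. of_real (g x) * iexp (t * x))"
  shows "AE x in lborel. f x = g x"
proof -
  define p n where "p x = max (f x - g x) 0" and "n x = max (g x - f x) 0" for x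
  have int: "integrable lborel p" "integrable lborel n"
    unfolding p_def n_def using f g by (auto intro!: integrable_max)
  have nonneg: "0 \<le> p x" "0 \<le> n x" for x by (auto simp: p_def n_def)
  have [measurable]: "p \<in> borel_measurable borel" "n \<in> borel_measurable borel"
    using int by auto
  have "(CLINT x|lborel. of_real (p x) * iexp (t * x)) - (CLINT x|lborel. of_real (n x) * iexp (t * x))
      = (CLINT x|lborel. of_real (f x) * iexp (t * x)) - (CLINT x|lborel. of_real (g x) * iexp (t * x))" for t
  proof -
    have pn: "p x - n x = f x - g x" for x by (simp add: p_def n_def)
    have "(CLINT x|lborel. of_real (p x) * iexp (t * x)) - (CLINT x|lborel. of_real (n x) * iexp (t * x))
        = (CLINT x|lborel. of_real (p x) * iexp (t * x) - of_real (n x) * iexp (t * x))"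
      by (intro Bochner_Integration.integral_diff[symmetric] integrable_mult_iexp int)
    also have "\<dots> = (CLINT x|lborel. of_real (f x) * iexp (t * x) - of_real (g x) * iexp (t * x))"
      by (intro Bochner_Integration.integral_cong refl)
         (simp only: left_diff_distrib[symmetric] of_real_diff[symmetric] pn)
    also have "\<dots> = (CLINT x|lborel. of_real (f x) * iexp (t * x)) - (CLINT x|lborel. of_real (g x) * iexp (t * x))"
      by (intro Bochner_Integration.integral_diff integrable_mult_iexp f g)
    finally show ?thesis .
  qed
  then have ft: "(CLINT x|lborel. of_real (p x) * iexp (t * x)) = (CLINT x|lborel. of_real (n x) * iexp (t * x))" for t
    using eq by simp
  define m where "m = (\<integral>x. p x \<partial>lborel)"
  have m: "(\<integral>x. n x \<partial>lborel) = m"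
    using ft[of 0] by (simp add: m_def)
  have m0: "0 \<le> m" unfolding m_def using nonneg by simp
  have "AE x in lborel. p x = n x"
  proof (cases "m = 0")
    case True
    then have "AE x in lborel. p x = 0" "AE x in lborel. n x = 0"
      using integral_nonneg_eq_0_iff_AE[OF int(1)] integral_nonneg_eq_0_iff_AE[OF int(2)] nonneg m m_def by auto
    then show ?thesis by auto
  next
    case False
    then have m0: "0 < m" using m0 by simp
    have rd: "real_distribution (density lborel (\<lambda>x. ennreal (h x / m)))"
      if h: "integrable lborel h" "\<And>x. 0 \<le> h x" "(\<integral>x. h x \<partial>lborel) = m" for h
    proof -
      have [measurable]: "h \<in> borel_measurable borel" using h by auto
      have "(\<integral>\<^sup>+x. ennreal (h x / m) \<partial>lborel) = ennreal (\<integral>x. h x / m \<partial>lborel)"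
        using h m0 by (intro nn_integral_eq_integral) auto
      also have "\<dots> = 1" using h m0 by simp
      finally have "emeasure (density lborel (\<lambda>x. ennreal (h x / m))) (space (density lborel (\<lambda>x. ennreal (h x / m)))) = 1"
        by (simp add: emeasure_density)
      then interpret prob_space "density lborel (\<lambda>x. ennreal (h x / m))" by (rule prob_spaceI)
      show ?thesis by unfold_locales simp
    qed
    have char: "char (density lborel (\<lambda>x. ennreal (h x / m))) t = (CLINT x|lborel. of_real (h x) * iexp (t * x)) / of_real m"
      if h: "integrable lborel h" "\<And>x. 0 \<le> h x" for h t
    proof -
      have [measurable]: "h \<in> borel_measurable borel" using h by auto
      have "char (density lborel (\<lambda>x. ennreal (h x / m))) t = (CLINT x|lborel. (h x / m) *\<^sub>R iexp (t * x))"
        unfolding char_def using h m0 by (subst integral_density) auto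
      also have "\<dots> = (CLINT x|lborel. of_real (h x) * iexp (t * x) / of_real m)"
        by (intro Bochner_Integration.integral_cong) (auto simp: scaleR_conv_of_real)
      finally show ?thesis by simp
    qed
    have "density lborel (\<lambda>x. ennreal (p x / m)) = density lborel (\<lambda>x. ennreal (n x / m))"
    proof (intro Levy_uniqueness rd int nonneg m ext)
      show "integral\<^sup>L lborel p = m" by (simp add: m_def)
    qed (simp only: char[OF int(1) nonneg(1)] char[OF int(2) nonneg(2)] ft)
    then have "AE x in lborel. ennreal (p x / m) = ennreal (n x / m)"
      by (subst (asm) sigma_finite_measure.density_unique_iff[OF sigma_finite_lborel]) auto
    then show ?thesis
      by eventually_elim (use m0 nonneg in \<open>auto simp: ennreal_inj divide_nonneg_pos\<close>)
  qed
  then show ?thesis by eventually_elim (auto simp: p_def n_def max_def split: if_splits)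
qed

definition partial_fraction ::
  "'i set \<Rightarrow> ('i \<Rightarrow> real) \<Rightarrow> (real \<Rightarrow> real) \<Rightarrow> bool" where
  "partial_fraction I v f \<longleftrightarrow> (\<exists>c. \<forall>\<xi>. (\<forall>i\<in>I. 1 + \<xi> * v i \<noteq> 0) \<longrightarrow>
     f \<xi> = (\<Sum>\<mu>\<in>v ` I. \<Sum>q=1..card {i\<in>I. v i = \<mu>}. c \<mu> q * inverse ((1 + \<xi> * \<mu>) ^ q)))"

lemma partial_fraction_lincomb:
  assumes "partial_fraction I v f" "partial_fraction I v g"
  shows "partial_fraction I v (\<lambda>\<xi>. a * f \<xi> + b * g \<xi>)"
proof -
  obtain c where c: "\<forall>\<xi>. (\<forall>i\<in>I. 1 + \<xi> * v i \<noteq> 0) \<longrightarrow>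
       f \<xi> = (\<Sum>\<mu>\<in>v ` I. \<Sum>q=1..card {i\<in>I. v i = \<mu>}. c \<mu> q * inverse ((1 + \<xi> * \<mu>) ^ q))"
    using assms(1) unfolding partial_fraction_def by blast
  obtain d where d: "\<forall>\<xi>. (\<forall>i\<in>I. 1 + \<xi> * v i \<noteq> 0) \<longrightarrow>
       g \<xi> = (\<Sum>\<mu>\<in>v ` I. \<Sum>q=1..card {i\<in>I. v i = \<mu>}. d \<mu> q * inverse ((1 + \<xi> * \<mu>) ^ q))"
    using assms(2) unfolding partial_fraction_def by blast
  show ?thesis
    unfolding partial_fraction_def
  proof (intro exI allI impI)
    fix \<xi> assume nz: "\<forall>i\<in>I. 1 + \<xi> * v i \<noteq> 0"
    have "a * f \<xi> + b * g \<xi> = a * (\<Sum>\<mu>\<in>v ` I. \<Sum>q=1..card {i\<in>I. v i = \<mu>}. c \<mu> q * inverse ((1 + \<xi> * \<mu>) ^ q)) + b * (\<Sum>\<mu>\<in>v ` I. \<Sum>q=1..card {i\<in>I. v i = \<mu>}. d \<mu> q * inverse ((1 + \<xi> * \<mu>) ^ q))"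
      by (simp only: c[rule_format, OF nz[rule_format]] d[rule_format, OF nz[rule_format]])
    also have "\<dots> = (\<Sum>\<mu>\<in>v ` I. \<Sum>q=1..card {i\<in>I. v i = \<mu>}. (a * c \<mu> q + b * d \<mu> q) * inverse ((1 + \<xi> * \<mu>) ^ q))"
      by (simp only: sum_distrib_left sum.distrib[symmetric] distrib_right mult.assoc)
    finally show "a * f \<xi> + b * g \<xi> = (\<Sum>\<mu>\<in>v ` I. \<Sum>q=1..card {i\<in>I. v i = \<mu>}. (a * c \<mu> q + b * d \<mu> q) * inverse ((1 + \<xi> * \<mu>) ^ q))" .
  qed
qed

lemma partial_fraction_zero: "partial_fraction I v (\<lambda>_. 0)"
  unfolding partial_fraction_def by (rule exI[of _ "\<lambda>_ _. 0"]) simp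

lemma partial_fraction_sum:
  "finite S \<Longrightarrow> (\<And>s. s \<in> S \<Longrightarrow> partial_fraction I v (f s)) \<Longrightarrow> partial_fraction I v (\<lambda>\<xi>. \<Sum>s\<in>S. a s * f s \<xi>)"
proof (induction S rule: finite_induct)
  case (insert s S)
  then show ?case using partial_fraction_lincomb[of I v "f s" "\<lambda>\<xi>. \<Sum>s\<in>S. a s * f s \<xi>" "a s" 1] by simp
qed (simp add: partial_fraction_zero)

lemma partial_fraction_cong:
  assumes "\<And>\<xi>. (\<forall>i\<in>I. 1 + \<xi> * v i \<noteq> 0) \<Longrightarrow> f \<xi> = g \<xi>"
  shows "partial_fraction I v f \<longleftrightarrow> partial_fraction I v g"
  unfolding partial_fraction_def
  by (intro iff_exI iff_allI imp_cong refl, drule assms, simp only:)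

lemma partial_fraction_inverse_power:
  assumes I: "finite I" and \<mu>: "\<mu> \<in> v ` I" and q: "1 \<le> q" "q \<le> card {i\<in>I. v i = \<mu>}"
  shows "partial_fraction I v (\<lambda>\<xi>. inverse ((1 + \<xi> * \<mu>) ^ q))"
  unfolding partial_fraction_def
proof (intro exI allI impI)
  fix \<xi>
  have "(\<Sum>\<nu>\<in>v ` I. \<Sum>r=1..card {i\<in>I. v i = \<nu>}. (if \<nu> = \<mu> \<and> r = q then 1 else 0) * inverse ((1 + \<xi> * \<nu>) ^ r))
     = (\<Sum>\<nu>\<in>v ` I. if \<nu> = \<mu> then \<Sum>r=1..card {i\<in>I. v i = \<nu>}. if r = q then inverse ((1 + \<xi> * \<nu>) ^ r) else 0 else 0)"
    by (intro sum.cong refl) (auto simp: if_distrib[of "\<lambda>x. x * _"] cong: if_cong)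
  also have "\<dots> = inverse ((1 + \<xi> * \<mu>) ^ q)"
    using I \<mu> q by simp
  finally show "inverse ((1 + \<xi> * \<mu>) ^ q) = (\<Sum>\<nu>\<in>v ` I. \<Sum>r=1..card {i\<in>I. v i = \<nu>}.
     (if \<nu> = \<mu> \<and> r = q then 1 else 0) * inverse ((1 + \<xi> * \<nu>) ^ r))" by simp
qed

lemma partial_fraction_prod:
  assumes "finite I" "I \<noteq> {}" "\<And>i. i \<in> I \<Longrightarrow> 0 < v i"
  shows "partial_fraction I v (\<lambda>\<xi>. inverse (\<Prod>i\<in>I. 1 + \<xi> * v i))"
  using assms
proof (induction I rule: finite_ne_induct)
  case (singleton i)
  have "partial_fraction {i} v (\<lambda>\<xi>. inverse ((1 + \<xi> * v i) ^ 1))"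
    by (rule partial_fraction_inverse_power) (auto simp: conj_commute cong: conj_cong)
  then show ?case by simp
next
  case (insert j I)
  let ?J = "insert j I"
  let ?mult = "\<lambda>\<mu>. card {i\<in>?J. v i = \<mu>}"
  have fin: "finite ?J" using insert by simp
  have mult_pos: "1 \<le> ?mult (v j)"
    using fin by (auto simp: Suc_le_eq card_gt_0_iff)
  have basis: "partial_fraction ?J v (\<lambda>\<xi>. inverse ((1 + \<xi> * \<mu>) ^ q))" if "\<mu> \<in> v ` ?J" "1 \<le> q" "q \<le> ?mult \<mu>" for \<mu> q
    using fin that by (rule partial_fraction_inverse_power)
  have step: "partial_fraction ?J v (\<lambda>\<xi>. inverse ((1 + \<xi> * \<mu>) ^ q) * inverse (1 + \<xi> * v j))"
    if \<mu>: "\<mu> \<in> v ` I" "\<mu> \<noteq> v j" and q: "q \<le> ?mult \<mu>" for \<mu> q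
    using q
  proof (induction q)
    case 0
    show ?case using basis[of "v j" 1] mult_pos by simp
  next
    case (Suc q)
    have "partial_fraction ?J v (\<lambda>\<xi>. \<mu> / (\<mu> - v j) * inverse ((1 + \<xi> * \<mu>) ^ Suc q)
        + (- v j / (\<mu> - v j)) * (inverse ((1 + \<xi> * \<mu>) ^ q) * inverse (1 + \<xi> * v j)))"
      using Suc \<mu> by (intro partial_fraction_lincomb basis) auto
    then show ?case
    proof (subst partial_fraction_cong)
      fix \<xi> assume *: "\<forall>i\<in>?J. 1 + \<xi> * v i \<noteq> 0"
      then have nz: "1 + \<xi> * \<mu> \<noteq> 0" "1 + \<xi> * v j \<noteq> 0" using \<mu> by auto
      have "\<mu> / (\<mu> - v j) * inverse (1 + \<xi> * \<mu>) + (- v j / (\<mu> - v j)) * inverse (1 + \<xi> * v j)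
          = inverse (1 + \<xi> * \<mu>) * inverse (1 + \<xi> * v j)"
        using nz \<mu>(2) by (simp add: divide_simps) (simp add: algebra_simps)
      then have "inverse ((1 + \<xi> * \<mu>) ^ q) * (\<mu> / (\<mu> - v j) * inverse (1 + \<xi> * \<mu>) + (- v j / (\<mu> - v j)) * inverse (1 + \<xi> * v j))
          = inverse ((1 + \<xi> * \<mu>) ^ q) * (inverse (1 + \<xi> * \<mu>) * inverse (1 + \<xi> * v j))" by simp
      then show "inverse ((1 + \<xi> * \<mu>) ^ Suc q) * inverse (1 + \<xi> * v j) = \<mu> / (\<mu> - v j) * inverse ((1 + \<xi> * \<mu>) ^ Suc q)
        + (- v j / (\<mu> - v j)) * (inverse ((1 + \<xi> * \<mu>) ^ q) * inverse (1 + \<xi> * v j))"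
        unfolding power_Suc inverse_mult_distrib distrib_left by (simp only: mult_ac)
    qed
  qed
  have factor: "partial_fraction ?J v (\<lambda>\<xi>. inverse ((1 + \<xi> * \<mu>) ^ q) * inverse (1 + \<xi> * v j))"
    if \<mu>: "\<mu> \<in> v ` I" and q: "1 \<le> q" "q \<le> card {i\<in>I. v i = \<mu>}" for \<mu> q
  proof (cases "\<mu> = v j")
    case True
    have "{i\<in>?J. v i = \<mu>} = insert j {i\<in>I. v i = \<mu>}" using True by auto
    then have "?mult \<mu> = Suc (card {i\<in>I. v i = \<mu>})"
      using insert by simp
    then have "partial_fraction ?J v (\<lambda>\<xi>. inverse ((1 + \<xi> * \<mu>) ^ Suc q))"
      using q \<mu> by (intro basis) auto
    then show ?thesis by (simp add: True mult.commute)
  next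
    case False
    have "card {i\<in>I. v i = \<mu>} \<le> ?mult \<mu>" using fin by (intro card_mono) auto
    then show ?thesis using False \<mu> q by (intro step) auto
  qed
  obtain c where c: "\<And>\<xi>. (\<forall>i\<in>I. 1 + \<xi> * v i \<noteq> 0) \<Longrightarrow> inverse (\<Prod>i\<in>I. 1 + \<xi> * v i) =
      (\<Sum>\<mu>\<in>v ` I. \<Sum>q=1..card {i\<in>I. v i = \<mu>}. c \<mu> q * inverse ((1 + \<xi> * \<mu>) ^ q))"
    using insert.IH insert.prems unfolding partial_fraction_def by auto
  have "partial_fraction ?J v (\<lambda>\<xi>. \<Sum>\<mu>\<in>v ` I. 1 * (\<Sum>q\<in>{1..card {i\<in>I. v i = \<mu>}}. c \<mu> q * (inverse ((1 + \<xi> * \<mu>) ^ q) * inverse (1 + \<xi> * v j))))"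
    using insert.hyps by (intro partial_fraction_sum factor) auto
  then show ?case
  proof (subst partial_fraction_cong)
    fix \<xi> assume "\<forall>i\<in>?J. 1 + \<xi> * v i \<noteq> 0"
    then have "inverse (\<Prod>i\<in>?J. 1 + \<xi> * v i) = inverse (\<Prod>i\<in>I. 1 + \<xi> * v i) * inverse (1 + \<xi> * v j)"
      using insert.hyps by (simp add: mult.commute)
    also have "\<dots> = (\<Sum>\<mu>\<in>v ` I. \<Sum>q=1..card {i\<in>I. v i = \<mu>}. c \<mu> q * inverse ((1 + \<xi> * \<mu>) ^ q)) * inverse (1 + \<xi> * v j)"
      using \<open>\<forall>i\<in>?J. 1 + \<xi> * v i \<noteq> 0\<close> by (subst c) auto
    finally show "inverse (\<Prod>i\<in>?J. 1 + \<xi> * v i) = (\<Sum>\<mu>\<in>v ` I. 1 * (\<Sum>q\<in>{1..card {i\<in>I. v i = \<mu>}}. c \<mu> q * (inverse ((1 + \<xi> * \<mu>) ^ q) * inverse (1 + \<xi> * v j))))"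
      by (simp add: sum_distrib_right mult.assoc)
  qed
qed

text \<open>Clearing denominators turns the expansion into a polynomial identity, which extends from the
  real line to the complex plane.\<close>

lemma partial_fraction_identity_complex:
  fixes v :: "'m::finite \<Rightarrow> real" and \<mu> :: "nat \<Rightarrow> real" and mult :: "nat \<Rightarrow> nat" and c :: "nat \<Rightarrow> nat \<Rightarrow> real"
  assumes mult: "\<And>p. p \<in> P \<Longrightarrow> mult p = card {a. v a = \<mu> p}"
    and real: "\<And>\<xi>. (\<forall>a. 1 + \<xi> * v a \<noteq> 0) \<Longrightarrow> inverse (\<Prod>a\<in>UNIV. 1 + \<xi> * v a) =
      (\<Sum>p\<in>P. \<Sum>q=1..mult p. c p q * inverse ((1 + \<xi> * \<mu> p) ^ q))"
    and \<zeta>: "\<forall>a. 1 + \<zeta> * complex_of_real (v a) \<noteq> 0"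
  shows "inverse (\<Prod>a\<in>UNIV. 1 + \<zeta> * of_real (v a)) =
      (\<Sum>p\<in>P. \<Sum>q=1..mult p. of_real (c p q) * inverse ((1 + \<zeta> * of_real (\<mu> p)) ^ q))"
proof -
  define Q :: "nat \<Rightarrow> nat \<Rightarrow> complex poly" where
    "Q p q = [:1, of_real (\<mu> p):] ^ (mult p - q) * (\<Prod>a\<in>{a. v a \<noteq> \<mu> p}. [:1, of_real (v a):])" for p q
  define R where "R = 1 - (\<Sum>p\<in>P. \<Sum>q=1..mult p. smult (of_real (c p q)) (Q p q))"
  have Q: "poly (Q p q) z = (\<Prod>a\<in>UNIV. 1 + z * of_real (v a)) * inverse ((1 + z * of_real (\<mu> p)) ^ q)"
    if p: "p \<in> P" and q: "q \<in> {1..mult p}" and z: "\<forall>a. 1 + z * complex_of_real (v a) \<noteq> 0" for p q z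
  proof -
    have "{a. v a = \<mu> p} \<noteq> {}" using q mult[OF p] by (metis atLeastAtMost_iff card.empty le_trans not_one_le_zero)
    then have nz: "1 + z * of_real (\<mu> p) \<noteq> 0" using z by (metis (mono_tags, lifting) empty_Collect_eq)
    have "(\<Prod>a\<in>UNIV. 1 + z * of_real (v a)) = (\<Prod>a\<in>{a. v a = \<mu> p} \<union> {a. v a \<noteq> \<mu> p}. 1 + z * of_real (v a))"
      by (intro prod.cong) auto
    also have "\<dots> = (\<Prod>a\<in>{a. v a = \<mu> p}. 1 + z * of_real (v a)) * (\<Prod>a\<in>{a. v a \<noteq> \<mu> p}. 1 + z * of_real (v a))"
      by (intro prod.union_disjoint) auto
    also have "(\<Prod>a\<in>{a. v a = \<mu> p}. 1 + z * of_real (v a)) = (1 + z * of_real (\<mu> p)) ^ mult p"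
      by (simp add: mult[OF p])
    finally have "(\<Prod>a\<in>UNIV. 1 + z * of_real (v a)) * inverse ((1 + z * of_real (\<mu> p)) ^ q)
        = (1 + z * of_real (\<mu> p)) ^ (mult p - q) * (\<Prod>a\<in>{a. v a \<noteq> \<mu> p}. 1 + z * of_real (v a))"
      using nz q by (simp add: power_diff divide_inverse mult_ac)
    then show ?thesis by (simp add: Q_def poly_prod)
  qed
  have R: "poly R z = 1 - (\<Prod>a\<in>UNIV. 1 + z * of_real (v a)) *
      (\<Sum>p\<in>P. \<Sum>q=1..mult p. of_real (c p q) * inverse ((1 + z * of_real (\<mu> p)) ^ q))"
    if "\<forall>a. 1 + z * complex_of_real (v a) \<noteq> 0" for z
  proof -
    have "(\<Sum>p\<in>P. \<Sum>q=1..mult p. of_real (c p q) * poly (Q p q) z) = (\<Sum>p\<in>P. \<Sum>q=1..mult p. (\<Prod>a\<in>UNIV. 1 + z * of_real (v a)) *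
      (of_real (c p q) * inverse ((1 + z * of_real (\<mu> p)) ^ q)))"
      by (intro sum.cong refl) (simp add: Q that del: atLeastAtMost_iff)
    then show ?thesis by (simp add: R_def poly_sum sum_distrib_left)
  qed
  define N where "N = {\<xi>::real. \<forall>a. 1 + \<xi> * v a \<noteq> 0}"
  have "finite (- N)"
  proof (rule finite_subset)
    show "- N \<subseteq> (\<lambda>a. - 1 / v a) ` UNIV"
    proof
      fix \<xi> assume "\<xi> \<in> - N"
      then obtain a where a: "1 + \<xi> * v a = 0" by (auto simp: N_def)
      then have "v a \<noteq> 0" "\<xi> * v a = - 1" by auto
      then have "\<xi> = - 1 / v a" by (metis nonzero_mult_div_cancel_right)
      then show "\<xi> \<in> (\<lambda>a. - 1 / v a) ` UNIV" by blast
    qed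
  qed simp
  have "infinite N"
  proof
    assume "finite N"
    then have "finite (N \<union> - N)" using \<open>finite (- N)\<close> by blast
    then show False using infinite_UNIV_char_0[where 'a=real] by (simp only: Compl_partition)
  qed
  then have "infinite (complex_of_real ` N)" by (simp add: finite_image_iff inj_on_def)
  moreover have "complex_of_real ` N \<subseteq> {z. poly R z = 0}"
  proof safe
    fix \<xi> assume "\<xi> \<in> N"
    then have nz: "\<forall>a. 1 + \<xi> * v a \<noteq> 0" by (simp add: N_def)
    have nzc: "\<forall>a. 1 + complex_of_real \<xi> * complex_of_real (v a) \<noteq> 0"
    proof
      fix a have "complex_of_real (1 + \<xi> * v a) \<noteq> 0" unfolding of_real_eq_0_iff using nz by blast
      then show "1 + complex_of_real \<xi> * complex_of_real (v a) \<noteq> 0" by simp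
    qed
    have "poly R (of_real \<xi>) = of_real (1 - (\<Prod>a\<in>UNIV. 1 + \<xi> * v a) *
      (\<Sum>p\<in>P. \<Sum>q=1..mult p. c p q * inverse ((1 + \<xi> * \<mu> p) ^ q)))"
      by (simp add: R[OF nzc])
    also have "(\<Prod>a\<in>UNIV. 1 + \<xi> * v a) *
      (\<Sum>p\<in>P. \<Sum>q=1..mult p. c p q * inverse ((1 + \<xi> * \<mu> p) ^ q)) = 1"
      unfolding real[OF nz, symmetric] using nz by simp
    also have "complex_of_real (1 - 1) = 0" by simp
    finally show "poly R (of_real \<xi>) = 0" .
  qed
  ultimately have "R = 0" using poly_roots_finite[of R] finite_subset by blast
  then have "(\<Prod>a\<in>UNIV. 1 + \<zeta> * of_real (v a)) *
      (\<Sum>p\<in>P. \<Sum>q=1..mult p. of_real (c p q) * inverse ((1 + \<zeta> * of_real (\<mu> p)) ^ q)) = 1"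
    using R[OF \<zeta>] by simp
  then show ?thesis by (rule inverse_unique)
qed

lemma bij_betw_diag_value:
  fixes A :: "real ^ 'm::finite ^ 'm"
  shows "bij_betw (diag_value A) {1..num_distinct A} (diag_values A)"
proof -
  let ?xs = "rev (sorted_list_of_set (diag_values A))"
  have fin: "finite (diag_values A)" by (simp add: diag_values_def)
  have len: "length ?xs = num_distinct A"
    by (simp add: num_distinct_def)
  have "bij_betw ((!) ?xs) {..<length ?xs} (set ?xs)"
    by (rule bij_betw_nth) auto
  then have "bij_betw ((!) ?xs) {..<num_distinct A} (diag_values A)"
    using fin by (simp only: len) simp
  moreover have "bij_betw (\<lambda>p. p - 1) {1..num_distinct A} {..<num_distinct A}"
    by (rule bij_betw_byWitness[where f'=Suc]) auto
  ultimately have "bij_betw ((!) ?xs \<circ> (\<lambda>p. p - 1)) {1..num_distinct A} (diag_values A)"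
    by (metis bij_betw_trans)
  then show ?thesis by (simp add: diag_value_def[abs_def] o_def)
qed

context
  fixes A :: "real ^ 'm::finite ^ 'm"
  assumes diag: "\<And>a b. a \<noteq> b \<Longrightarrow> A $ a $ b = 0" and pos: "\<And>a. 0 < A $ a $ a"
begin

lemma diag_value_pos: "p \<in> {1..num_distinct A} \<Longrightarrow> 0 < diag_value A p"
  using bij_betw_apply[OF bij_betw_diag_value[of A], of p] pos by (auto simp: diag_values_def)

lemma det_mat_1_plus_diag: "det (mat 1 + \<xi> *\<^sub>R A) = (\<Prod>a\<in>UNIV. 1 + \<xi> * A $ a $ a)"
  by (subst det_diagonal) (auto simp: mat_def diag)

lemma char_coeff_expansion:
  assumes "\<forall>a. 1 + \<xi> * A $ a $ a \<noteq> 0"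
  shows "inverse (\<Prod>a\<in>UNIV. 1 + \<xi> * A $ a $ a) =
    (\<Sum>p=1..num_distinct A. \<Sum>q=1..diag_mult A p.
       char_coeff A p q * inverse ((1 + \<xi> * diag_value A p) ^ q))"
proof -
  obtain c where c: "\<And>\<xi>. (\<forall>a. 1 + \<xi> * A $ a $ a \<noteq> 0) \<Longrightarrow> inverse (\<Prod>a\<in>UNIV. 1 + \<xi> * A $ a $ a) =
      (\<Sum>\<mu>\<in>range (\<lambda>a. A $ a $ a). \<Sum>q=1..card {a. A $ a $ a = \<mu>}. c \<mu> q * inverse ((1 + \<xi> * \<mu>) ^ q))"
    using partial_fraction_prod[of UNIV "\<lambda>a. A $ a $ a"] pos unfolding partial_fraction_def by auto
  have "\<exists>c. \<forall>\<xi>. det (mat 1 + \<xi> *\<^sub>R A) \<noteq> 0 \<longrightarrow>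
     inverse (det (mat 1 + \<xi> *\<^sub>R A)) =
       (\<Sum>p=1..num_distinct A. \<Sum>q=1..diag_mult A p.
          c p q * inverse ((1 + \<xi> * diag_value A p) ^ q))"
  proof (intro exI allI impI)
    fix \<xi> assume "det (mat 1 + \<xi> *\<^sub>R A) \<noteq> 0"
    then have "\<forall>a. 1 + \<xi> * A $ a $ a \<noteq> 0" by (simp add: det_mat_1_plus_diag)
    from c[OF this] show "inverse (det (mat 1 + \<xi> *\<^sub>R A)) =
       (\<Sum>p=1..num_distinct A. \<Sum>q=1..diag_mult A p.
          c (diag_value A p) q * inverse ((1 + \<xi> * diag_value A p) ^ q))"
      unfolding det_mat_1_plus_diag
      by (subst sum.reindex_bij_betw[OF bij_betw_diag_value, symmetric, unfolded diag_values_def] |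
          simp add: diag_mult_def diag_values_def[symmetric] sum.reindex_bij_betw[OF bij_betw_diag_value, symmetric])+
  qed
  from someI_ex[OF this] have "\<forall>\<xi>. det (mat 1 + \<xi> *\<^sub>R A) \<noteq> 0 \<longrightarrow>
     inverse (det (mat 1 + \<xi> *\<^sub>R A)) =
       (\<Sum>p=1..num_distinct A. \<Sum>q=1..diag_mult A p.
          char_coeff A p q * inverse ((1 + \<xi> * diag_value A p) ^ q))"
    by (simp only: char_coeff_def)
  then show ?thesis using assms by (simp add: det_mat_1_plus_diag)
qed

lemma pdf_Y_eq_erlang:
  "pdf_Y A y = (\<Sum>p=1..num_distinct A. \<Sum>q=1..diag_mult A p.
     char_coeff A p q * erlang_density (q - 1) (1 / diag_value A p) y)"
proof (cases "0 \<le> y")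
  case True
  have "erlang_density (q - 1) (1 / diag_value A p) y = inverse (diag_value A p) ^ q / fact (q - 1) * y ^ (q - 1) * exp (- y / diag_value A p)"
    if "q \<in> {1..diag_mult A p}" for p q
    using that True by (simp add: erlang_density_def power_Suc[symmetric] inverse_eq_divide del: power_Suc)
  then show ?thesis
    using True by (auto simp: pdf_Y_def mult.assoc intro!: sum.cong)
next
  case False
  then show ?thesis by (simp add: pdf_Y_def erlang_density_def)
qed

lemma integrable_pdf_Y: "integrable lborel (pdf_Y A)"
  unfolding pdf_Y_eq_erlang[abs_def]
  by (intro Bochner_Integration.integrable_sum Bochner_Integration.integrable_mult_right integrable_erlang_density) (simp add: diag_value_pos)

lemma fourier_pdf_Y:
  "(CLINT y|lborel. of_real (pdf_Y A y) * iexp (t * y)) = inverse (\<Prod>a\<in>UNIV. 1 - \<i> * of_real (t * A $ a $ a))"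
proof -
  have nz: "\<forall>a. 1 + - (\<i> * of_real t) * complex_of_real (A $ a $ a) \<noteq> 0"
    by (auto simp: complex_eq_iff)
  have "(CLINT y|lborel. of_real (pdf_Y A y) * iexp (t * y)) =
     (CLINT y|lborel. (\<Sum>p=1..num_distinct A. \<Sum>q=1..diag_mult A p.
        of_real (char_coeff A p q) * (of_real (erlang_density (q - 1) (1 / diag_value A p) y) * iexp (t * y))))"
    by (intro Bochner_Integration.integral_cong refl)
       (simp add: pdf_Y_eq_erlang sum_distrib_right mult.assoc)
  also have "\<dots> = (\<Sum>p=1..num_distinct A. \<Sum>q=1..diag_mult A p.
        of_real (char_coeff A p q) * (CLINT y|lborel. of_real (erlang_density (q - 1) (1 / diag_value A p) y) * iexp (t * y)))"
    by (simp add: Bochner_Integration.integral_sum integrable_mult_iexp integrable_erlang_density diag_value_pos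
        integrable_mult_right integrable_sum del: of_real_mult)
  also have "\<dots> = (\<Sum>p=1..num_distinct A. \<Sum>q=1..diag_mult A p.
        of_real (char_coeff A p q) * inverse ((1 + - (\<i> * of_real t) * of_real (diag_value A p)) ^ q))"
  proof (intro sum.cong refl)
    fix p q assume p: "p \<in> {1..num_distinct A}" and q: "q \<in> {1..diag_mult A p}"
    have pos: "0 < 1 / diag_value A p" using diag_value_pos[OF p] by simp
    have "Suc (q - 1) = q" using q by simp
    then show "of_real (char_coeff A p q) * (CLINT y|lborel. of_real (erlang_density (q - 1) (1 / diag_value A p) y) * iexp (t * y))
        = of_real (char_coeff A p q) * inverse ((1 + - (\<i> * of_real t) * of_real (diag_value A p)) ^ q)"
      unfolding fourier_erlang_density[OF pos] by (simp add: mult.assoc)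
  qed
  also have "\<dots> = inverse (\<Prod>a\<in>UNIV. 1 + - (\<i> * of_real t) * of_real (A $ a $ a))"
    by (rule partial_fraction_identity_complex[symmetric, where v="\<lambda>a. A $ a $ a", OF _ char_coeff_expansion nz])
       (auto simp: diag_mult_def)
  finally show ?thesis by (simp add: mult.assoc)
qed

end

lemma (in prob_space) sum_indep_exponential_has_density:
  fixes Z :: "'i \<Rightarrow> 'a \<Rightarrow> real"
  assumes "finite I" "I \<noteq> {}" "\<And>i. i \<in> I \<Longrightarrow> distributed M lborel (Z i) (f i)" "indep_vars (\<lambda>_. borel) Z I"
  shows "\<exists>g. distributed M lborel (\<lambda>\<omega>. \<Sum>i\<in>I. Z i \<omega>) g"
  using assms
proof (induction I rule: finite_ne_induct)
  case (insert i I)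
  then obtain g where g: "distributed M lborel (\<lambda>\<omega>. \<Sum>i\<in>I. Z i \<omega>) g"
    using indep_vars_subset[of "\<lambda>_. borel" Z "insert i I" I] by auto
  have "indep_var borel (Z i) borel (\<lambda>\<omega>. \<Sum>i\<in>I. Z i \<omega>)"
    using insert by (intro indep_vars_sum) auto
  from distributed_convolution[OF this insert.prems(1) g] show ?case
    using insert.hyps by auto
qed auto

lemma (in prob_space) distributed_sum_exponential:
  fixes A :: "real ^ 'm::finite ^ 'm" and Z :: "'m \<Rightarrow> 'a \<Rightarrow> real"
  assumes diag: "\<And>a b. a \<noteq> b \<Longrightarrow> A $ a $ b = 0" and pos: "\<And>a. 0 < A $ a $ a"
    and indep: "indep_vars (\<lambda>_. borel) Z UNIV"
    and Z: "\<And>a. distributed M lborel (Z a) (erlang_density 0 (1 / A $ a $ a))"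
  shows "distributed M lborel (\<lambda>\<omega>. \<Sum>a\<in>UNIV. Z a \<omega>) (\<lambda>y. ennreal (pdf_Y A y))"
proof -
  let ?S = "\<lambda>\<omega>. \<Sum>a\<in>UNIV. Z a \<omega>"
  obtain g where g: "distributed M lborel ?S g"
    using sum_indep_exponential_has_density[of UNIV Z, OF _ _ Z indep] by auto
  have [measurable]: "g \<in> borel_measurable borel" "?S \<in> borel_measurable M"
    using g by (auto simp: distributed_def)
  have S: "distr M borel ?S = density lborel g"
    using g by (simp add: distributed_def cong: distr_cong)
  have g1: "(\<integral>\<^sup>+x. g x \<partial>lborel) = 1"
  proof -
    have "prob_space (density lborel g)" unfolding S[symmetric] by (rule prob_space_distr) simp
    from prob_space.emeasure_space_1[OF this] show ?thesis by (simp add: emeasure_density)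
  qed
  then have "AE x in lborel. g x \<noteq> \<infinity>" by (intro nn_integral_PInf_AE) auto
  then have g_eq: "AE x in lborel. g x = ennreal (enn2real (g x))"
    by eventually_elim (simp add: less_top)
  define f where "f x = enn2real (g x)" for x
  have [measurable]: "f \<in> borel_measurable borel" unfolding f_def by simp
  have "(\<integral>\<^sup>+x. ennreal (f x) \<partial>lborel) = 1"
    unfolding g1[symmetric] f_def using g_eq by (intro nn_integral_cong_AE) auto
  then have f: "integrable lborel f" by (intro integrableI_nonneg) (auto simp: f_def)
  have S': "distr M borel ?S = density lborel f"
    unfolding S f_def using g_eq by (intro density_cong) auto
  have FT: "(CLINT x|lborel. of_real (h x) * iexp (t * x)) = char (density lborel h) t"
    if "h \<in> borel_measurable borel" "\<And>x. 0 \<le> h x" for h t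
    unfolding char_def using that by (subst integral_density) (auto simp: scaleR_conv_of_real)
  have [simp]: "0 \<le> f x" for x by (simp add: f_def)
  have "AE x in lborel. f x = pdf_Y A x"
  proof (rule AE_eq_if_fourier_eq[OF f integrable_pdf_Y[OF diag pos]])
    fix t
    have "(CLINT x|lborel. of_real (f x) * iexp (t * x)) = char (distr M borel ?S) t"
      unfolding S' by (rule FT) auto
    also have "\<dots> = (\<Prod>a\<in>UNIV. char (distr M borel (Z a)) t)"
      by (rule char_distr_sum[OF indep])
    also have "\<dots> = (\<Prod>a\<in>UNIV. inverse (1 - \<i> * of_real (t * A $ a $ a)))"
    proof (rule prod.cong)
      fix a
      have "distr M borel (Z a) = density lborel (erlang_density 0 (1 / A $ a $ a))"
        using Z[of a] by (simp add: distributed_def cong: distr_cong)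
      then have "char (distr M borel (Z a)) t = (CLINT x|lborel. of_real (erlang_density 0 (1 / A $ a $ a) x) * iexp (t * x))"
        using pos[of a] by (subst FT) auto
      also have "\<dots> = inverse (1 - \<i> * of_real (t * A $ a $ a))"
        using pos[of a] by (subst fourier_erlang_density) auto
      finally show "char (distr M borel (Z a)) t = inverse (1 - \<i> * of_real (t * A $ a $ a))" .
    qed simp
    also have "\<dots> = (CLINT x|lborel. of_real (pdf_Y A x) * iexp (t * x))"
      by (subst fourier_pdf_Y[OF diag pos]) (simp_all add: prod_inversef[unfolded o_def])
    finally show "(CLINT x|lborel. of_real (f x) * iexp (t * x)) = (CLINT x|lborel. of_real (pdf_Y A x) * iexp (t * x))" .
  qed
  moreover have [measurable]: "pdf_Y A \<in> borel_measurable borel"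
    using integrable_pdf_Y[OF diag pos] by auto
  ultimately have "density lborel f = density lborel (pdf_Y A)"
    by (intro density_cong) auto
  then show ?thesis
    unfolding distributed_def using S' by (simp cong: distr_cong)
qed

section \<open>Pseudo-inverses and complex spans\<close>

lemma conj_transpose_mult: "conj_transpose (A ** B) = conj_transpose B ** conj_transpose A"
  by (simp add: conj_transpose_def matrix_matrix_mult_def vec_eq_iff mult.commute)

lemma conj_transpose_conj_transpose [simp]: "conj_transpose (conj_transpose A) = A"
  by (simp add: conj_transpose_def vec_eq_iff)

lemma is_pseudo_inverse_unique:
  assumes P: "is_pseudo_inverse A P" and Q: "is_pseudo_inverse A Q"
  shows "P = Q"
proof -
  have AP: "A ** P ** A = A" "P ** A ** P = P" "conj_transpose (A ** P) = A ** P" "conj_transpose (P ** A) = P ** A"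
    and AQ: "A ** Q ** A = A" "Q ** A ** Q = Q" "conj_transpose (A ** Q) = A ** Q" "conj_transpose (Q ** A) = Q ** A"
    using P Q by (auto simp: is_pseudo_inverse_def)
  have "A ** P = (A ** Q) ** (A ** P)"
    using AQ(1) by (simp add: matrix_mul_assoc)
  also have "\<dots> = conj_transpose ((A ** P) ** (A ** Q))"
    by (simp only: conj_transpose_mult[of "A ** P"] AP AQ)
  also have "(A ** P) ** (A ** Q) = A ** Q"
    using AP(1) by (simp add: matrix_mul_assoc)
  finally have 1: "A ** P = A ** Q" by (simp only: AQ)
  have "P ** A = (P ** A) ** (Q ** A)"
    using AQ(1) by (simp add: matrix_mul_assoc[symmetric])
  also have "\<dots> = conj_transpose ((Q ** A) ** (P ** A))"
    by (simp only: conj_transpose_mult[of "Q ** A"] AP AQ)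
  also have "(Q ** A) ** (P ** A) = Q ** A"
    using AP(1) by (simp add: matrix_mul_assoc[symmetric])
  finally have 2: "P ** A = Q ** A" by (simp only: AQ)
  have "P = P ** A ** P" using AP by simp
  also have "\<dots> = Q ** A ** Q" using 1 2 by (metis matrix_mul_assoc)
  finally show ?thesis using AQ by simp
qed

lemma norm_power2_vec: "(norm x)\<^sup>2 = (\<Sum>a\<in>UNIV. (cmod (x $ a))\<^sup>2)" for x :: "complex ^ 'n"
  unfolding norm_vec_def L2_set_def by (simp add: sum_nonneg)

lemma norm_power2_complex_vec: "of_real ((norm x)\<^sup>2) = (\<Sum>a\<in>UNIV. cnj (x $ a) * x $ a)" for x :: "complex ^ 'n"
  unfolding norm_power2_vec by (simp only: of_real_sum complex_norm_square mult.commute)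

lemma pseudo_inverse_full_rank:
  fixes A :: "complex ^ 'k ^ 'n"
  assumes full: "\<And>x. A *v x = 0 \<Longrightarrow> x = 0"
  shows "is_pseudo_inverse A (pseudo_inverse A)" and "pseudo_inverse A ** A = mat 1"
proof -
  let ?H = "conj_transpose A ** A"
  have ker: "x = 0" if "?H *v x = 0" for x
  proof -
    have "of_real ((norm (A *v x))\<^sup>2) = (\<Sum>a\<in>UNIV. \<Sum>j\<in>UNIV. cnj (x $ j) * (cnj (A $ a $ j) * (A *v x) $ a))"
      unfolding norm_power2_complex_vec by (subst (1) matrix_vector_mult_def) (simp add: sum_distrib_left sum_distrib_right mult_ac)
    also have "\<dots> = (\<Sum>j\<in>UNIV. cnj (x $ j) * (\<Sum>a\<in>UNIV. cnj (A $ a $ j) * (A *v x) $ a))"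
      by (subst sum.swap) (simp add: sum_distrib_left)
    also have "\<dots> = (\<Sum>j\<in>UNIV. cnj (x $ j) * (?H *v x) $ j)"
      by (simp add: matrix_vector_mul_assoc[symmetric]) (simp add: conj_transpose_def matrix_vector_mult_def)
    finally have "norm (A *v x) = 0" using that by simp
    then show "x = 0" using full by simp
  qed
  obtain B where B: "B ** ?H = mat 1" using ker matrix_left_invertible_ker[of ?H] by blast
  then have B': "?H ** B = mat 1" using matrix_left_right_inverse by blast
  have mat1: "conj_transpose (mat 1) = (mat 1 :: complex ^ 'a ^ 'a)"
    by (auto simp: conj_transpose_def mat_def vec_eq_iff)
  have Hc: "conj_transpose ?H = ?H" by (simp add: conj_transpose_mult)
  have Bc: "conj_transpose B = B"
  proof -
    have "conj_transpose B ** ?H = mat 1" using arg_cong[OF B', of conj_transpose] by (simp add: conj_transpose_mult mat1)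
    then have "conj_transpose B ** (?H ** B) = mat 1 ** B" by (simp add: matrix_mul_assoc)
    then show ?thesis by (simp add: B')
  qed
  let ?P = "B ** conj_transpose A"
  have PA: "?P ** A = mat 1" using B by (simp add: matrix_mul_assoc)
  have P: "is_pseudo_inverse A ?P"
    unfolding is_pseudo_inverse_def
  proof (intro conjI)
    show "A ** ?P ** A = A" using PA by (simp add: matrix_mul_assoc[symmetric])
    show "?P ** A ** ?P = ?P" using PA by simp
    show "conj_transpose (?P ** A) = ?P ** A" by (simp add: PA mat1)
    show "conj_transpose (A ** ?P) = A ** ?P" by (simp add: conj_transpose_mult Bc matrix_mul_assoc)
  qed
  then have "pseudo_inverse A = ?P"
    unfolding pseudo_inverse_def by (intro the_equality) (auto intro: is_pseudo_inverse_unique)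
  then show "is_pseudo_inverse A (pseudo_inverse A)" "pseudo_inverse A ** A = mat 1"
    using P PA by auto
qed

lemma pseudo_inverse_row:
  fixes A :: "complex ^ 'k ^ 'n" and k :: 'k
  assumes full: "\<And>x. A *v x = 0 \<Longrightarrow> x = 0"
  defines "w \<equiv> row k (pseudo_inverse A)"
  shows "(\<Sum>a\<in>UNIV. w $ a * A $ a $ j) = (if j = k then 1 else 0)"
    and "\<exists>c. c k = of_real ((norm w)\<^sup>2) \<and> (\<forall>a. cnj (w $ a) = (\<Sum>j\<in>UNIV. c j * A $ a $ j))"
proof -
  let ?P = "pseudo_inverse A"
  have PA: "?P ** A = mat 1" and P: "is_pseudo_inverse A ?P"
    using pseudo_inverse_full_rank[OF full] by auto
  have w: "w $ a = ?P $ k $ a" for a by (simp add: w_def row_def)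
  show "(\<Sum>a\<in>UNIV. w $ a * A $ a $ j) = (if j = k then 1 else 0)"
    using arg_cong[OF PA, of "\<lambda>X. X $ k $ j"] by (simp add: matrix_matrix_mult_def w mat_def eq_commute)
  let ?C = "?P ** conj_transpose ?P"
  have "?P = ?P ** conj_transpose (A ** ?P)"
    using P by (simp add: is_pseudo_inverse_def matrix_mul_assoc)
  then have eq: "?P = ?C ** conj_transpose A"
    by (simp add: conj_transpose_mult matrix_mul_assoc)
  define c where "c j = cnj (?C $ k $ j)" for j
  have "cnj (w $ a) = (\<Sum>j\<in>UNIV. c j * A $ a $ j)" for a
  proof -
    have "w $ a = (?C ** conj_transpose A) $ k $ a" unfolding w using eq by simp
    also have "\<dots> = (\<Sum>j\<in>UNIV. ?C $ k $ j * cnj (A $ a $ j))"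
      by (simp add: matrix_matrix_mult_def conj_transpose_def)
    finally show ?thesis by (simp add: c_def)
  qed
  moreover have "c k = of_real ((norm w)\<^sup>2)"
    unfolding norm_power2_complex_vec by (simp add: c_def matrix_matrix_mult_def conj_transpose_def w mult.commute)
  ultimately show "\<exists>c. c k = of_real ((norm w)\<^sup>2) \<and> (\<forall>a. cnj (w $ a) = (\<Sum>j\<in>UNIV. c j * A $ a $ j))" by blast
qed

definition cspan :: "('k \<Rightarrow> complex ^ 'n) \<Rightarrow> 'k set \<Rightarrow> (complex ^ 'n) set" where
  "cspan g J = range (\<lambda>c. \<Sum>j\<in>J. c j *s g j)"

lemma scaleR_complex_vec: "r *\<^sub>R x = complex_of_real r *s x" for x :: "complex ^ 'n"
  by (simp add: vec_eq_iff) (simp add: scaleR_conv_of_real)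

lemma cspan_smult: "x \<in> cspan g J \<Longrightarrow> z *s x \<in> cspan g J"
proof -
  assume "x \<in> cspan g J"
  then obtain c where c: "x = (\<Sum>j\<in>J. c j *s g j)" by (auto simp: cspan_def)
  have "z *s x = (\<Sum>j\<in>J. (z * c j) *s g j)"
    unfolding c by (simp add: vec_eq_iff sum_distrib_left mult.assoc)
  then show ?thesis by (auto simp: cspan_def)
qed

lemma subspace_cspan: "subspace (cspan g J)"
proof (rule subspaceI)
  show "0 \<in> cspan g J" unfolding cspan_def by (rule range_eqI[of _ _ "\<lambda>_. 0"]) simp
next
  fix x y assume "x \<in> cspan g J" "y \<in> cspan g J"
  then obtain c d where "x = (\<Sum>j\<in>J. c j *s g j)" "y = (\<Sum>j\<in>J. d j *s g j)" by (auto simp: cspan_def)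
  then show "x + y \<in> cspan g J" unfolding cspan_def
    by (intro range_eqI[of _ _ "\<lambda>j. c j + d j"]) (simp add: sum.distrib vector_sadd_rdistrib)
next
  fix r x assume "x \<in> cspan g J"
  then show "r *\<^sub>R x \<in> cspan g J" unfolding scaleR_complex_vec by (rule cspan_smult)
qed

lemma cspan_insert:
  assumes "finite J" "k \<notin> J"
  shows "cspan g (insert k J) = span (insert (\<i> *s g k) (insert (g k) (cspan g J)))" (is "?L = span ?R")
proof
  show "?L \<subseteq> span ?R"
  proof
    fix x assume "x \<in> ?L"
    then obtain c where x: "x = (\<Sum>j\<in>insert k J. c j *s g j)" by (auto simp: cspan_def)
    have "x = Re (c k) *\<^sub>R g k + Im (c k) *\<^sub>R (\<i> *s g k) + (\<Sum>j\<in>J. c j *s g j)"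
      unfolding x using assms
      by (simp add: scaleR_complex_vec vector_smult_assoc vector_sadd_rdistrib[symmetric] complex_eq[symmetric] mult.commute[of _ \<i>])
    moreover have "(\<Sum>j\<in>J. c j *s g j) \<in> cspan g J" by (auto simp: cspan_def)
    ultimately show "x \<in> span ?R"
      by (auto intro!: span_add span_scale intro: span_base)
  qed
  have gk: "g k \<in> ?L"
    unfolding cspan_def using assms by (intro range_eqI[of _ _ "\<lambda>j. if j = k then 1 else 0"])
      (simp add: if_distrib[of "\<lambda>c. c *s _"] cong: if_cong)
  have "cspan g J \<subseteq> ?L"
  proof
    fix x assume "x \<in> cspan g J"
    then obtain c where "x = (\<Sum>j\<in>J. c j *s g j)" by (auto simp: cspan_def)
    also have "\<dots> = (\<Sum>j\<in>J. (c(k := 0)) j *s g j)"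
      using assms by (intro sum.cong) auto
    also have "\<dots> = (\<Sum>j\<in>insert k J. (c(k := 0)) j *s g j)" using assms by simp
    finally show "x \<in> ?L" by (auto simp: cspan_def)
  qed
  then have "?R \<subseteq> ?L" using gk cspan_smult[OF gk] by auto
  then show "span ?R \<subseteq> ?L" by (rule span_minimal[OF _ subspace_cspan])
qed

lemma cspan_mono: "finite J \<Longrightarrow> I \<subseteq> J \<Longrightarrow> cspan g I \<subseteq> cspan g J"
proof
  fix x assume "finite J" "I \<subseteq> J" "x \<in> cspan g I"
  then obtain c where "x = (\<Sum>j\<in>I. c j *s g j)" by (auto simp: cspan_def)
  also have "\<dots> = (\<Sum>j\<in>J. (if j \<in> I then c j else 0) *s g j)"
    using \<open>finite J\<close> \<open>I \<subseteq> J\<close> by (intro sum.mono_neutral_cong_left) auto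
  finally show "x \<in> cspan g J" by (auto simp: cspan_def)
qed

lemma dim_cspan_le: "finite J \<Longrightarrow> dim (cspan g J) \<le> 2 * card J"
proof (induction J rule: finite_induct)
  case empty then show ?case by (simp add: cspan_def)
next
  case (insert k J)
  then show ?case by (simp add: cspan_insert dim_insert)
qed

lemma dim_cspan_eq:
  "finite J \<Longrightarrow> (\<And>j. j \<in> J \<Longrightarrow> g j \<notin> cspan g (J - {j})) \<Longrightarrow> dim (cspan g J) = 2 * card J"
proof (induction J rule: finite_induct)
  case empty then show ?case by (simp add: cspan_def)
next
  case (insert k J)
  have IH: "dim (cspan g J) = 2 * card J"
  proof (rule insert.IH)
    fix j assume j: "j \<in> J"
    then have "g j \<notin> cspan g (insert k J - {j})" using insert.prems by auto
    then show "g j \<notin> cspan g (J - {j})"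
      using cspan_mono[of "insert k J - {j}" "J - {j}" g] insert.hyps by auto
  qed
  have gk: "g k \<notin> cspan g J" using insert.prems[of k] insert.hyps by simp
  have span_J: "span (cspan g J) = cspan g J" by (rule span_eq_iff[THEN iffD2, OF subspace_cspan])
  have "\<i> *s g k \<notin> span (insert (g k) (cspan g J))"
  proof
    assume "\<i> *s g k \<in> span (insert (g k) (cspan g J))"
    then obtain r where r: "\<i> *s g k - r *\<^sub>R g k \<in> cspan g J"
      by (auto simp: span_insert span_J)
    have nz: "\<i> - of_real r \<noteq> 0" by (auto simp: complex_eq_iff)
    have "\<i> *s g k - r *\<^sub>R g k = (\<i> - of_real r) *s g k"
      by (simp add: scaleR_complex_vec vec_eq_iff algebra_simps)
    then have "inverse (\<i> - of_real r) *s ((\<i> - of_real r) *s g k) \<in> cspan g J"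
      using r cspan_smult by metis
    moreover have "inverse (\<i> - of_real r) *s ((\<i> - of_real r) *s g k) = g k"
      by (simp only: vector_smult_assoc left_inverse[OF nz] vector_smult_lid)
    ultimately show False using gk by simp
  qed
  then show ?case
    using insert.hyps IH gk by (simp add: cspan_insert dim_insert span_J)
qed

lemma inner_complex_vec: "x \<bullet> y = Re (\<Sum>a\<in>UNIV. cnj (x $ a) * y $ a)" for x y :: "complex ^ 'n"
  by (simp add: inner_vec_def inner_complex_def)

lemma sum_squares_orthonormal:
  fixes B :: "'a::euclidean_space set"
  assumes "pairwise orthogonal B" "\<And>b. b \<in> B \<Longrightarrow> norm b = 1" "x \<in> span B" "finite B"
  shows "(\<Sum>b\<in>B. (b \<bullet> x)\<^sup>2) = (norm x)\<^sup>2"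
proof -
  have "(\<Sum>b\<in>B. (b \<bullet> x)\<^sup>2) = (\<Sum>b\<in>B. (x \<bullet> b) *\<^sub>R b) \<bullet> x"
    unfolding inner_sum_left by (intro sum.cong refl) (simp add: power2_eq_square inner_commute)
  also have "\<dots> = x \<bullet> x" by (simp only: orthonormal_basis_expand[OF assms])
  finally show ?thesis by (simp only: power2_norm_eq_inner)
qed

text \<open>The conjugate of the \<open>k\<close>th row \<open>w\<close> is orthogonal to the other columns and is the combination of
  all columns in which column \<open>k\<close> has the coefficient \<open>(norm w)\<^sup>2\<close>; so it is \<open>(norm w)\<^sup>2\<close> times the
  component of column \<open>k\<close> orthogonal to the other columns.\<close>

lemma inverse_norm_pseudo_inverse_row:
  fixes A :: "complex ^ 'k ^ 'n"
  assumes full: "\<And>x. A *v x = 0 \<Longrightarrow> x = 0"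
    and B: "pairwise orthogonal B" "\<And>b. b \<in> B \<Longrightarrow> norm b = 1" "finite B"
    and span_B: "span B = {y. \<forall>x\<in>cspan (\<lambda>j. column j A) (UNIV - {k}). orthogonal x y}"
  shows "(\<Sum>b\<in>B. (b \<bullet> column k A)\<^sup>2) = 1 / (norm (row k (pseudo_inverse A)))\<^sup>2"
proof -
  define w where "w = row k (pseudo_inverse A)"
  define p where "p = (\<chi> a. cnj (w $ a))"
  have wA: "(\<Sum>a\<in>UNIV. w $ a * A $ a $ j) = (if j = k then 1 else 0)" for j
    unfolding w_def by (rule pseudo_inverse_row(1)[OF full])
  obtain c where c: "c k = of_real ((norm w)\<^sup>2)" "\<And>a. cnj (w $ a) = (\<Sum>j\<in>UNIV. c j * A $ a $ j)"
    using pseudo_inverse_row(2)[OF full, where k=k] unfolding w_def by auto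
  have norm_p: "norm p = norm w" by (simp add: p_def norm_vec_def)
  have w0: "w \<noteq> 0" using wA[of k] by auto
  have p: "p = c k *s column k A + (\<Sum>j\<in>UNIV - {k}. c j *s column j A)"
    by (simp add: p_def c(2) vec_eq_iff column_def sum.remove[of UNIV k])
  have pB: "p \<in> span B"
    unfolding span_B
  proof safe
    fix x assume "x \<in> cspan (\<lambda>j. column j A) (UNIV - {k})"
    then obtain d where x: "x = (\<Sum>j\<in>UNIV - {k}. d j *s column j A)" by (auto simp: cspan_def)
    have "(\<Sum>a\<in>UNIV. cnj (p $ a) * x $ a) = (\<Sum>a\<in>UNIV. \<Sum>j\<in>UNIV - {k}. d j * (w $ a * A $ a $ j))"
      by (simp add: x p_def column_def sum_distrib_left mult_ac)
    also have "\<dots> = (\<Sum>j\<in>UNIV - {k}. d j * (\<Sum>a\<in>UNIV. w $ a * A $ a $ j))"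
      by (subst sum.swap) (simp add: sum_distrib_left)
    also have "\<dots> = 0" by (simp add: wA)
    finally have "p \<bullet> x = 0" by (simp add: inner_complex_vec)
    then show "orthogonal x p" by (simp add: orthogonal_def inner_commute)
  qed
  have bp: "b \<bullet> p = (norm w)\<^sup>2 * (b \<bullet> column k A)" if b: "b \<in> B" for b
  proof -
    have "(\<Sum>j\<in>UNIV - {k}. c j *s column j A) \<in> cspan (\<lambda>j. column j A) (UNIV - {k})" by (auto simp: cspan_def)
    moreover have "b \<in> span B" using b by (rule span_base)
    ultimately have "b \<bullet> (\<Sum>j\<in>UNIV - {k}. c j *s column j A) = 0"
      unfolding span_B by (auto simp: orthogonal_def inner_commute)
    then show ?thesis
      by (subst p) (simp add: c(1) inner_add_right scaleR_complex_vec[symmetric] del: of_real_power)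
  qed
  have "(norm w)\<^sup>2 = (\<Sum>b\<in>B. (b \<bullet> p)\<^sup>2)"
    using sum_squares_orthonormal[OF B(1,2) pB B(3)] norm_p by simp
  also have "\<dots> = ((norm w)\<^sup>2)\<^sup>2 * (\<Sum>b\<in>B. (b \<bullet> column k A)\<^sup>2)"
    by (simp add: bp power_mult_distrib sum_distrib_left)
  finally show ?thesis using w0 by (simp add: w_def[symmetric] field_simps power2_eq_square)
qed

lemma borel_fst_closed:
  fixes F :: "('a::euclidean_space \<times> 'b::euclidean_space) set"
  assumes "closed F" shows "fst ` F \<in> sets borel"
proof -
  have "fst ` (F \<inter> cball 0 (real n)) \<in> sets borel" for n
  proof -
    have "compact (F \<inter> cball 0 (real n))" using assms by (intro closed_Int_compact compact_cball)
    then have "compact (fst ` (F \<inter> cball 0 (real n)))"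
      by (intro compact_continuous_image continuous_intros)
    then show ?thesis by (intro borel_closed compact_imp_closed)
  qed
  moreover have "fst ` F = (\<Union>n. fst ` (F \<inter> cball 0 (real n)))"
  proof -
    have "\<exists>n::nat. norm x \<le> real n" for x :: "'a \<times> 'b" by (rule real_arch_simple)
    then show ?thesis by (fastforce simp: image_iff)
  qed
  ultimately show ?thesis by simp
qed

text \<open>The preimage of a closed set is the projection of a closed set, hence a countable union of compact
  sets; where the relation has no witness, the description operator takes one fixed value.\<close>

lemma borel_measurable_THE_closed:
  fixes R :: "'a::euclidean_space \<Rightarrow> 'b::euclidean_space \<Rightarrow> bool"
  assumes closed_R: "closed {p. R (fst p) (snd p)}"
    and unique: "\<And>x y z. R x y \<Longrightarrow> R x z \<Longrightarrow> y = z"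
  shows "(\<lambda>x. THE y. R x y) \<in> borel_measurable borel"
proof (rule borel_measurableI)
  define f where "f x = (THE y. R x y)" for x
  define d :: 'b where "d = (THE y. False)"
  have eq: "f x = y" if "R x y" for x y
    unfolding f_def using that unique by (intro the_equality) auto
  have eq': "f x = d" if "\<And>y. \<not> R x y" for x
    using that by (simp add: f_def d_def)
  fix S :: "'b set" assume "open S"
  define F where "F C = fst ` ({p. R (fst p) (snd p)} \<inter> UNIV \<times> C)" for C
  have F_borel: "F C \<in> sets borel" if "closed C" for C
    unfolding F_def using that closed_R by (intro borel_fst_closed closed_Int closed_Times) auto
  have "f -` (- S) = F (- S) \<union> (if d \<in> - S then - F UNIV else {})"
  proof (rule set_eqI)
    fix x
    show "x \<in> f -` (- S) \<longleftrightarrow> x \<in> F (- S) \<union> (if d \<in> - S then - F UNIV else {})"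
    proof (cases "\<exists>y. R x y")
      case True
      then obtain y where y: "R x y" by auto
      have "x \<in> F C \<longleftrightarrow> y \<in> C" for C
      proof
        assume "x \<in> F C"
        then obtain y' where "R x y'" "y' \<in> C" by (auto simp: F_def)
        then show "y \<in> C" using unique[OF y] by simp
      next
        assume "y \<in> C"
        then show "x \<in> F C" using y unfolding F_def by (intro image_eqI[of _ _ "(x, y)"]) auto
      qed
      then show ?thesis using eq[OF y] by simp
    next
      case False
      then have "x \<notin> F C" for C by (auto simp: F_def)
      then show ?thesis using eq'[of x] False by simp
    qed
  qed
  also have "\<dots> \<in> sets borel"
    using F_borel[of UNIV] F_borel[of "- S"] \<open>open S\<close> by (auto intro!: sets.Un)
  finally have "f -` (- S) \<in> sets borel" .
  then have "UNIV - f -` (- S) \<in> sets borel" by (metis sets.compl_sets space_borel)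
  moreover have "UNIV - f -` (- S) = f -` S \<inter> space borel" by auto
  ultimately show "(\<lambda>x. THE y. R x y) -` S \<inter> space borel \<in> sets borel" by (simp add: f_def[abs_def])
qed

lemma continuous_on_matrix_matrix_mult [continuous_intros]:
  fixes f :: "'a::topological_space \<Rightarrow> complex ^ 'k ^ 'n" and g :: "'a \<Rightarrow> complex ^ 'm ^ 'k"
  shows "continuous_on S f \<Longrightarrow> continuous_on S g \<Longrightarrow> continuous_on S (\<lambda>x. f x ** g x)"
  unfolding matrix_matrix_mult_def by (intro continuous_intros)

lemma continuous_on_matrix_vector_mult_complex [continuous_intros]:
  fixes f :: "'a::topological_space \<Rightarrow> complex ^ 'k ^ 'n" and g :: "'a \<Rightarrow> complex ^ 'k"
  shows "continuous_on S f \<Longrightarrow> continuous_on S g \<Longrightarrow> continuous_on S (\<lambda>x. f x *v g x)"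
  unfolding matrix_vector_mult_def by (intro continuous_intros)

lemma continuous_on_conj_transpose [continuous_intros]:
  "continuous_on S f \<Longrightarrow> continuous_on S (\<lambda>x. conj_transpose (f x))"
  unfolding conj_transpose_def by (intro continuous_intros)

lemma borel_measurable_pseudo_inverse [measurable]:
  "(pseudo_inverse :: complex ^ 'k ^ 'n \<Rightarrow> _) \<in> borel_measurable borel"
  unfolding pseudo_inverse_def[abs_def]
proof (rule borel_measurable_THE_closed)
  show "closed {p :: (complex ^ 'k ^ 'n) \<times> (complex ^ 'n ^ 'k). is_pseudo_inverse (fst p) (snd p)}"
    unfolding is_pseudo_inverse_def
    by (intro closed_Collect_conj closed_Collect_eq continuous_intros)
qed (rule is_pseudo_inverse_unique)

lemma borel_dependent_column:
  "{A :: complex ^ 'k ^ 'n. column k A \<in> cspan (\<lambda>j. column j A) (UNIV - {k})} \<in> sets borel"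
proof -
  have "{A :: complex ^ 'k ^ 'n. column k A \<in> cspan (\<lambda>j. column j A) (UNIV - {k})} =
     fst ` {p. snd p $ k = 0 \<and> fst p *v snd p = column k (fst p)}"
  proof (intro equalityI subsetI)
    fix A :: "complex ^ 'k ^ 'n" assume "A \<in> {A. column k A \<in> cspan (\<lambda>j. column j A) (UNIV - {k})}"
    then obtain c where c: "column k A = (\<Sum>j\<in>UNIV - {k}. c j *s column j A)" by (auto simp: cspan_def)
    let ?x = "\<chi> j. if j = k then 0 else c j"
    have "A *v ?x = (\<Sum>j\<in>UNIV - {k}. c j *s column j A)"
      unfolding matrix_mult_sum by (intro sum.mono_neutral_cong_right) auto
    then show "A \<in> fst ` {p. snd p $ k = 0 \<and> fst p *v snd p = column k (fst p)}"
      by (intro image_eqI[of _ _ "(A, ?x)"]) (auto simp: c)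
  next
    fix A :: "complex ^ 'k ^ 'n"
    assume "A \<in> fst ` {p. snd p $ k = 0 \<and> fst p *v snd p = column k (fst p)}"
    then obtain x where x: "x $ k = 0" "A *v x = column k A" by auto
    have "column k A = (\<Sum>j\<in>UNIV - {k}. x $ j *s column j A)"
      unfolding x(2)[symmetric] matrix_mult_sum using x(1) by (intro sum.mono_neutral_right) auto
    then show "A \<in> {A. column k A \<in> cspan (\<lambda>j. column j A) (UNIV - {k})}"
      unfolding cspan_def by auto
  qed
  moreover have "closed {p :: (complex ^ 'k ^ 'n) \<times> (complex ^ 'k). snd p $ k = 0 \<and> fst p *v snd p = column k (fst p)}"
    unfolding column_def by (intro closed_Collect_conj closed_Collect_eq continuous_intros)
  ultimately show ?thesis by (simp only: borel_fst_closed)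
qed

lemma full_rank_if_columns_independent:
  fixes A :: "complex ^ 'k ^ 'n"
  assumes ind: "\<And>k. column k A \<notin> cspan (\<lambda>j. column j A) (UNIV - {k})" and x: "A *v x = 0"
  shows "x = 0"
proof (rule ccontr)
  assume "x \<noteq> 0"
  then obtain k where k: "x $ k \<noteq> 0" by (auto simp: vec_eq_iff)
  have "0 = x $ k *s column k A + (\<Sum>j\<in>UNIV - {k}. x $ j *s column j A)"
    using x unfolding matrix_mult_sum by (simp add: sum.remove[of UNIV k])
  then have "x $ k *s column k A = (- 1) *s (\<Sum>j\<in>UNIV - {k}. x $ j *s column j A)"
    by (metis add_eq_0_iff2 vector_smult_lneg vector_smult_lid)
  moreover have "(- 1) *s (\<Sum>j\<in>UNIV - {k}. x $ j *s column j A) \<in> cspan (\<lambda>j. column j A) (UNIV - {k})"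
    by (rule cspan_smult) (auto simp: cspan_def)
  ultimately have "x $ k *s column k A \<in> cspan (\<lambda>j. column j A) (UNIV - {k})"
    by (simp only:)
  from cspan_smult[OF this, of "inverse (x $ k)"] have "column k A \<in> cspan (\<lambda>j. column j A) (UNIV - {k})"
    using k by (simp add: vector_smult_assoc)
  then show False using ind by blast
qed

section \<open>Conditioning on independent variables\<close>

lemma (in prob_space) indep_var_if_sections_eq:
  assumes indep: "indep_var S A T B" and f[measurable]: "f \<in> measurable (S \<Otimes>\<^sub>M T) N"
    and \<rho>: "sets \<rho> = sets N"
    and sections: "AE a in distr M S A. distr M N (\<lambda>\<omega>. f (a, B \<omega>)) = \<rho>"
  shows "distr M N (\<lambda>\<omega>. f (A \<omega>, B \<omega>)) = \<rho>" (is ?law)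
    and "\<psi> \<in> measurable S N \<Longrightarrow> indep_var N (\<lambda>\<omega>. \<psi> (A \<omega>)) N (\<lambda>\<omega>. f (A \<omega>, B \<omega>))" (is "_ \<Longrightarrow> ?indep")
proof -
  have [measurable]: "A \<in> measurable M S" "B \<in> measurable M T"
    using indep by (auto dest: indep_var_rv1 indep_var_rv2)
  have space: "A \<omega> \<in> space S" "B \<omega> \<in> space T" if "\<omega> \<in> space M" for \<omega>
    using that by (auto intro: measurable_space)
  interpret A: prob_space "distr M S A" by (rule prob_space_distr) simp
  interpret B: prob_space "distr M T B" by (rule prob_space_distr) simp
  have joint: "distr M (S \<Otimes>\<^sub>M T) (\<lambda>\<omega>. (A \<omega>, B \<omega>)) = distr M S A \<Otimes>\<^sub>M distr M T B"
    using indep unfolding indep_var_distribution_eq by simp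
  have rect: "emeasure M {\<omega>\<in>space M. A \<omega> \<in> U \<and> f (A \<omega>, B \<omega>) \<in> V} = emeasure (distr M S A) U * emeasure \<rho> V"
    if [measurable]: "U \<in> sets S" "V \<in> sets N" for U V
  proof -
    let ?E = "{p \<in> space (S \<Otimes>\<^sub>M T). fst p \<in> U \<and> f p \<in> V}"
    have E[measurable]: "?E \<in> sets (S \<Otimes>\<^sub>M T)" by measurable
    have "{\<omega>\<in>space M. A \<omega> \<in> U \<and> f (A \<omega>, B \<omega>) \<in> V} = (\<lambda>\<omega>. (A \<omega>, B \<omega>)) -` ?E \<inter> space M"
      by (auto simp: space_pair_measure space)
    then have "emeasure M {\<omega>\<in>space M. A \<omega> \<in> U \<and> f (A \<omega>, B \<omega>) \<in> V} = emeasure (distr M (S \<Otimes>\<^sub>M T) (\<lambda>\<omega>. (A \<omega>, B \<omega>))) ?E"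
      by (simp add: emeasure_distr)
    also have "\<dots> = (\<integral>\<^sup>+a. emeasure (distr M T B) (Pair a -` ?E) \<partial>distr M S A)"
      unfolding joint by (rule B.emeasure_pair_measure_alt) simp
    also have "\<dots> = (\<integral>\<^sup>+a. indicator U a * emeasure \<rho> V \<partial>distr M S A)"
    proof (rule nn_integral_cong_AE)
      show "AE a in distr M S A. emeasure (distr M T B) (Pair a -` ?E) = indicator U a * emeasure \<rho> V"
        using sections AE_space
      proof eventually_elim
        fix a assume law: "distr M N (\<lambda>\<omega>. f (a, B \<omega>)) = \<rho>" and a: "a \<in> space (distr M S A)"
        then have [measurable]: "a \<in> space S" by simp
        show "emeasure (distr M T B) (Pair a -` ?E) = indicator U a * emeasure \<rho> V"
        proof (cases "a \<in> U")
          case True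
          have "Pair a -` ?E = (\<lambda>b. f (a, b)) -` V \<inter> space T"
            using True a by (auto simp: space_pair_measure)
          then have "emeasure (distr M T B) (Pair a -` ?E) = emeasure (distr (distr M T B) N (\<lambda>b. f (a, b))) V"
            by (simp add: emeasure_distr)
          also have "distr (distr M T B) N (\<lambda>b. f (a, b)) = \<rho>"
            unfolding law[symmetric] by (subst distr_distr) (auto simp: o_def)
          finally show ?thesis using True by simp
        qed simp
      qed
    qed
    also have "\<dots> = emeasure (distr M S A) U * emeasure \<rho> V"
      by (simp add: nn_integral_multc)
    finally show ?thesis .
  qed
  have rv[measurable]: "(\<lambda>\<omega>. f (A \<omega>, B \<omega>)) \<in> measurable M N" by measurable
  show law: ?law
  proof (rule measure_eqI)
    fix V assume "V \<in> sets (distr M N (\<lambda>\<omega>. f (A \<omega>, B \<omega>)))"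
    then have V: "V \<in> sets N" by simp
    have "{\<omega>\<in>space M. A \<omega> \<in> space S \<and> f (A \<omega>, B \<omega>) \<in> V} = (\<lambda>\<omega>. f (A \<omega>, B \<omega>)) -` V \<inter> space M"
      by (auto simp: space)
    then show "emeasure (distr M N (\<lambda>\<omega>. f (A \<omega>, B \<omega>))) V = emeasure \<rho> V"
      using rect[OF sets.top V] V A.emeasure_space_1 by (simp add: emeasure_distr)
  qed (simp add: \<rho>)
  assume \<psi>[measurable]: "\<psi> \<in> measurable S N"
  interpret A': prob_space "distr M N (\<lambda>\<omega>. \<psi> (A \<omega>))" by (rule prob_space_distr) simp
  interpret N: prob_space "distr M N (\<lambda>\<omega>. f (A \<omega>, B \<omega>))" by (rule prob_space_distr) simp
  have "distr M N (\<lambda>\<omega>. \<psi> (A \<omega>)) \<Otimes>\<^sub>M distr M N (\<lambda>\<omega>. f (A \<omega>, B \<omega>)) = distr M (N \<Otimes>\<^sub>M N) (\<lambda>\<omega>. (\<psi> (A \<omega>), f (A \<omega>, B \<omega>)))"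
  proof (rule pair_measure_eqI)
    fix U V assume "U \<in> sets (distr M N (\<lambda>\<omega>. \<psi> (A \<omega>)))" "V \<in> sets (distr M N (\<lambda>\<omega>. f (A \<omega>, B \<omega>)))"
    then have [measurable]: "U \<in> sets N" and V[measurable]: "V \<in> sets N" by auto
    define U' where "U' = \<psi> -` U \<inter> space S"
    have U'[measurable]: "U' \<in> sets S" unfolding U'_def by measurable
    have "(\<lambda>\<omega>. \<psi> (A \<omega>)) -` U \<inter> space M = A -` U' \<inter> space M"
      by (auto simp: U'_def space)
    then have "emeasure (distr M N (\<lambda>\<omega>. \<psi> (A \<omega>))) U = emeasure (distr M S A) U'"
      by (simp add: emeasure_distr)
    moreover have "{\<omega>\<in>space M. A \<omega> \<in> U' \<and> f (A \<omega>, B \<omega>) \<in> V} = (\<lambda>\<omega>. (\<psi> (A \<omega>), f (A \<omega>, B \<omega>))) -` (U \<times> V) \<inter> space M"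
      by (auto simp: U'_def space)
    ultimately show "emeasure (distr M N (\<lambda>\<omega>. \<psi> (A \<omega>))) U * emeasure (distr M N (\<lambda>\<omega>. f (A \<omega>, B \<omega>))) V =
        emeasure (distr M (N \<Otimes>\<^sub>M N) (\<lambda>\<omega>. (\<psi> (A \<omega>), f (A \<omega>, B \<omega>)))) (U \<times> V)"
      using rect[OF U' V] unfolding law by (simp add: emeasure_distr)
  next
    show "sets (distr M N (\<lambda>\<omega>. \<psi> (A \<omega>)) \<Otimes>\<^sub>M distr M N (\<lambda>\<omega>. f (A \<omega>, B \<omega>))) =
        sets (distr M (N \<Otimes>\<^sub>M N) (\<lambda>\<omega>. (\<psi> (A \<omega>), f (A \<omega>, B \<omega>))))"
      unfolding sets_distr by (rule sets_pair_measure_cong) simp_all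
  qed (rule A'.sigma_finite_measure_axioms N.sigma_finite_measure_axioms)+
  then show ?indep unfolding indep_var_distribution_eq by simp
qed

lemma (in prob_space) indep_var_AE_iff_sections:
  assumes indep: "indep_var S A T B" and P[measurable]: "Measurable.pred (S \<Otimes>\<^sub>M T) (\<lambda>p. P (fst p) (snd p))"
  shows "(AE \<omega> in M. P (A \<omega>) (B \<omega>)) \<longleftrightarrow> (AE a in distr M S A. AE \<omega> in M. P a (B \<omega>))"
proof -
  have [measurable]: "A \<in> measurable M S" "B \<in> measurable M T"
    using indep by (auto dest: indep_var_rv1 indep_var_rv2)
  interpret A: prob_space "distr M S A" by (rule prob_space_distr) simp
  interpret B: prob_space "distr M T B" by (rule prob_space_distr) simp
  interpret AB: pair_sigma_finite "distr M S A" "distr M T B" ..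
  have joint: "distr M S A \<Otimes>\<^sub>M distr M T B = distr M (S \<Otimes>\<^sub>M T) (\<lambda>\<omega>. (A \<omega>, B \<omega>))"
    using indep unfolding indep_var_distribution_eq by simp
  have "(AE \<omega> in M. P (A \<omega>) (B \<omega>)) \<longleftrightarrow> (AE p in distr M (S \<Otimes>\<^sub>M T) (\<lambda>\<omega>. (A \<omega>, B \<omega>)). P (fst p) (snd p))"
    by (subst AE_distr_iff) auto
  also have "\<dots> \<longleftrightarrow> (AE p in distr M S A \<Otimes>\<^sub>M distr M T B. P (fst p) (snd p))"
    using joint by (simp only:)
  also have "\<dots> \<longleftrightarrow> (AE a in distr M S A. AE b in distr M T B. P a b)"
  proof (rule AB.AE_pair_iff[symmetric])
    have "space (distr M S A \<Otimes>\<^sub>M distr M T B) = space (S \<Otimes>\<^sub>M T)" by (simp add: space_pair_measure)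
    then show "{p \<in> space (distr M S A \<Otimes>\<^sub>M distr M T B). P (fst p) (snd p)} \<in> sets (distr M S A \<Otimes>\<^sub>M distr M T B)"
      using P by (simp add: pred_def)
  qed
  also have "\<dots> \<longleftrightarrow> (AE a in distr M S A. AE \<omega> in M. P a (B \<omega>))"
  proof (rule AE_cong)
    fix a assume "a \<in> space (distr M S A)"
    then have [measurable]: "a \<in> space S" by simp
    show "(AE b in distr M T B. P a b) \<longleftrightarrow> (AE \<omega> in M. P a (B \<omega>))"
    proof (rule AE_distr_iff)
      have "(\<lambda>b. P (fst (a, b)) (snd (a, b))) \<in> measurable T (count_space UNIV)"
        by (rule measurable_compose[OF _ P]) simp
      then show "{b \<in> space T. P a b} \<in> sets T" by simp
    qed simp
  qed
  finally show ?thesis .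
qed

lemma (in prob_space) AE_notin_subspace_if_gauss:
  fixes X :: "'a \<Rightarrow> 'b::euclidean_space"
  assumes X[measurable]: "X \<in> borel_measurable M" and law: "distr M borel X = gauss v"
    and S: "subspace S" "dim S < DIM('b)"
  shows "AE \<omega> in M. X \<omega> \<notin> S"
proof -
  have closed: "closed S" using S(1) by (rule closed_subspace)
  have "negligible S" using S(2) by (rule negligible_lowdim)
  then have "S \<in> null_sets lborel"
    using closed by (simp add: negligible_iff_null_sets null_sets_completion_iff)
  then have "AE x in lborel. x \<notin> S" by (rule AE_not_in)
  then have "AE x in gauss v. x \<notin> S"
    by (subst AE_density) (auto elim: eventually_mono)
  then have "AE x in distr M borel X. x \<notin> S" by (subst law)
  with X show ?thesis by (rule AE_distrD)
qed

lemma borel_measurable_columns_matrix [measurable (raw)]: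
  fixes X :: "'k::finite \<Rightarrow> 'a \<Rightarrow> complex ^ 'n"
  assumes [measurable]: "\<And>j. X j \<in> borel_measurable M"
  shows "(\<lambda>\<omega>. columns_matrix (\<lambda>j. X j \<omega>)) \<in> borel_measurable M"
proof -
  have "(\<lambda>\<omega>. columns_matrix (\<lambda>j. X j \<omega>)) = (\<lambda>\<omega>. \<Sum>j\<in>UNIV. columns_matrix (\<lambda>i. if i = j then X j \<omega> else 0))"
    by (simp add: columns_matrix_def vec_eq_iff fun_eq_iff if_distrib[of "\<lambda>x. x $ _"] cong: if_cong)
  moreover have "(\<lambda>x :: complex ^ 'n. columns_matrix (\<lambda>i. if i = j then x else 0)) \<in> borel_measurable borel" for j :: 'k
  proof -
    have "continuous_on UNIV (\<lambda>x :: complex ^ 'n. columns_matrix (\<lambda>i. if i = j then x else 0))"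
    proof -
      have *: "continuous_on UNIV (\<lambda>x :: complex ^ 'n. (if i = j then x else 0) $ a)" for i a
        by (cases "i = j") (simp_all add: continuous_on_component)
      show ?thesis unfolding columns_matrix_def by (intro continuous_on_vec_lambda *)
    qed
    then show ?thesis by (rule borel_measurable_continuous_onI)
  qed
  ultimately show ?thesis
    by (auto intro!: borel_measurable_sum measurable_compose[OF assms])
qed

lemma column_columns_matrix [simp]: "column j (columns_matrix c) = c j"
  by (simp add: column_def columns_matrix_def)

lemma borel_measurable_row [measurable]: "row k \<in> borel_measurable (borel :: (complex ^ 'k ^ 'n) measure)"
  unfolding row_def by (intro borel_measurable_continuous_onI continuous_intros)

lemma borel_measurable_vec_nth [measurable]: "(\<lambda>x. x $ i) \<in> borel_measurable (borel :: (complex ^ 'n) measure)"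
  by (intro borel_measurable_continuous_onI continuous_intros)

lemma sum_squares_complex_functional:
  fixes w :: "complex ^ 'n"
  assumes w: "w \<noteq> 0"
  obtains B where "pairwise orthogonal B" "\<And>b. b \<in> B \<Longrightarrow> norm b = 1" "card B = 2"
    "\<And>x. (\<Sum>b\<in>B. (b \<bullet> x)\<^sup>2) = (norm (\<Sum>a\<in>UNIV. w $ a * x $ a))\<^sup>2 / (norm w)\<^sup>2"
proof -
  define p where "p = (\<chi> a. cnj (w $ a / of_real (norm w)))"
  define q where "q = \<i> *s p"
  have p_inner: "p \<bullet> x = Re (\<Sum>a\<in>UNIV. w $ a * x $ a) / norm w" for x
    by (simp add: inner_complex_vec p_def sum_divide_distrib diff_divide_distrib)
  have q_inner: "q \<bullet> x = Im (\<Sum>a\<in>UNIV. w $ a * x $ a) / norm w" for x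
    by (simp add: inner_complex_vec q_def p_def sum_divide_distrib) (intro sum.cong refl, simp add: add_divide_distrib diff_divide_distrib)
  have norm_p: "norm p = 1"
  proof -
    have "p = (1 / norm w) *\<^sub>R (\<chi> a. cnj (w $ a))"
      by (simp add: p_def vec_eq_iff) (simp add: scaleR_conv_of_real)
    moreover have "norm (\<chi> a. cnj (w $ a)) = norm w" by (simp add: norm_vec_def)
    ultimately show ?thesis using w by simp
  qed
  have norm_q: "norm q = 1"
    using norm_p by (simp add: q_def norm_vec_def norm_mult)
  have ww: "(\<Sum>a\<in>UNIV. w $ a * p $ a) = of_real (norm w)"
  proof -
    have "(\<Sum>a\<in>UNIV. w $ a * p $ a) = (\<Sum>a\<in>UNIV. cnj (w $ a) * w $ a) / of_real (norm w)"
      by (simp add: p_def sum_divide_distrib mult.commute)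
    also have "\<dots> = of_real (norm w)"
      using w unfolding norm_power2_complex_vec[symmetric] by (simp add: power2_eq_square)
    finally show ?thesis .
  qed
  have "q \<bullet> p = 0" unfolding q_inner ww by simp
  then have orth: "orthogonal q p" "orthogonal p q" by (simp_all add: orthogonal_def inner_commute)
  have "p \<noteq> q" using orth norm_p by (auto simp: orthogonal_self)
  show ?thesis
  proof (rule that[of "{p, q}"])
    show "pairwise orthogonal {p, q}" using orth by (auto simp: pairwise_def)
    show "(\<Sum>b\<in>{p, q}. (b \<bullet> x)\<^sup>2) = (norm (\<Sum>a\<in>UNIV. w $ a * x $ a))\<^sup>2 / (norm w)\<^sup>2" for x
      using \<open>p \<noteq> q\<close> by (simp add: p_inner q_inner cmod_power2 power_divide add_divide_distrib)
  qed (use \<open>p \<noteq> q\<close> norm_p norm_q in auto)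
qed

lemma (in prob_space) exponential_complex_functional:
  fixes X :: "'a \<Rightarrow> complex ^ 'n"
  assumes [measurable]: "X \<in> borel_measurable M" and law: "distr M borel X = gauss v" and v: "0 < v" and w: "w \<noteq> 0"
  shows "distributed M lborel (\<lambda>\<omega>. (norm (\<Sum>a\<in>UNIV. w $ a * X \<omega> $ a))\<^sup>2 / (norm w)\<^sup>2) (erlang_density 0 (1 / v))"
proof -
  obtain B where B: "pairwise orthogonal B" "\<And>b. b \<in> B \<Longrightarrow> norm b = 1" "card B = 2"
    and eq: "\<And>x. (\<Sum>b\<in>B. (b \<bullet> x)\<^sup>2) = (norm (\<Sum>a\<in>UNIV. w $ a * x $ a))\<^sup>2 / (norm w)\<^sup>2"
    by (rule sum_squares_complex_functional[OF w]) blast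
  have "distr M borel (\<lambda>\<omega>. \<Sum>b\<in>B. (b \<bullet> X \<omega>)\<^sup>2) = distr (distr M borel X) borel (\<lambda>x. \<Sum>b\<in>B. (b \<bullet> x)\<^sup>2)"
    by (subst distr_distr) (auto simp: o_def)
  also have "\<dots> = density lborel (erlang_density 0 (1 / v))"
    unfolding law using B by (intro distr_gauss_sum_squares v) auto
  finally have "distr M lborel (\<lambda>\<omega>. \<Sum>b\<in>B. (b \<bullet> X \<omega>)\<^sup>2) = density lborel (erlang_density 0 (1 / v))"
    by (simp cong: distr_cong)
  moreover have "(\<lambda>\<omega>. \<Sum>b\<in>B. (b \<bullet> X \<omega>)\<^sup>2) \<in> borel_measurable M" by measurable
  ultimately show ?thesis unfolding distributed_def eq by simp
qed

lemma orthonormal_complement_basis: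
  fixes g :: "'k::finite \<Rightarrow> complex ^ 'n"
  assumes card: "CARD('k) \<le> CARD('n)" and dim: "dim (cspan g (UNIV - {k})) = 2 * (CARD('k) - 1)"
  obtains B where "pairwise orthogonal B" "\<And>b. b \<in> B \<Longrightarrow> norm b = 1" "finite B"
    "card B = 2 * Suc (CARD('n) - CARD('k))" "span B = {y. \<forall>x\<in>cspan g (UNIV - {k}). orthogonal x y}"
proof -
  let ?W = "{y. \<forall>x\<in>cspan g (UNIV - {k}). orthogonal x y}"
  have "subspace ?W" by (rule subspace_orthogonal_to_vectors)
  then obtain B where B: "B \<subseteq> ?W" "pairwise orthogonal B" "\<And>x. x \<in> B \<Longrightarrow> norm x = 1" "independent B" "card B = dim ?W" "span B = ?W"
    by (rule orthonormal_basis_subspace) metis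
  have "dim {y \<in> UNIV. \<forall>x\<in>cspan g (UNIV - {k}). orthogonal x y} + dim (cspan g (UNIV - {k})) = dim (UNIV :: (complex ^ 'n) set)"
    by (intro dim_subspace_orthogonal_to_vectors subspace_cspan) auto
  then have "dim ?W + 2 * (CARD('k) - 1) = 2 * CARD('n)" using dim by simp
  moreover have "1 \<le> CARD('k)" by (simp add: Suc_le_eq)
  ultimately have "dim ?W = 2 * Suc (CARD('n) - CARD('k))" using card by arith
  then show ?thesis using B by (intro that[of B]) (auto intro: independent_imp_finite)
qed

section \<open>Gaussian matrices\<close>

lemma (in prob_space) indep_vars_reindex_inj:
  assumes ind: "indep_vars (\<lambda>_. N) X UNIV" and f: "inj f"
  shows "indep_vars (\<lambda>_. N) (\<lambda>j. X (f j)) UNIV"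
proof -
  have "indep_vars (\<lambda>j. PiM {f j} (\<lambda>_. N)) (\<lambda>j \<omega>. restrict (\<lambda>i. X i \<omega>) {f j}) UNIV"
    using f by (intro indep_vars_restrict[OF ind]) (auto simp: disjoint_family_on_def inj_def)
  then have "indep_vars (\<lambda>_. N) (\<lambda>j \<omega>. (\<lambda>h. h (f j)) (restrict (\<lambda>i. X i \<omega>) {f j})) UNIV"
    by (rule indep_vars_compose2) (auto intro: measurable_component_singleton)
  then show ?thesis by simp
qed

definition replace_column :: "'k::finite \<Rightarrow> ('k \<Rightarrow> complex ^ 'n) \<Rightarrow> complex ^ 'n \<Rightarrow> complex ^ 'k ^ 'n" where
  "replace_column k f x = columns_matrix (\<lambda>j. if j = k then x else f j)"

lemma column_replace_column [simp]: "column j (replace_column k f x) = (if j = k then x else f j)"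
  by (simp add: replace_column_def)

lemma borel_measurable_replace_column [measurable]:
  "(\<lambda>p. replace_column k (fst p) (snd p k)) \<in> borel_measurable (PiM (UNIV - {k}) (\<lambda>_. borel) \<Otimes>\<^sub>M PiM {k} (\<lambda>_. borel))"
proof -
  have "(\<lambda>p. if j = k then snd p k else fst p j) \<in> borel_measurable (PiM (UNIV - {k}) (\<lambda>_. borel) \<Otimes>\<^sub>M PiM {k} (\<lambda>_. borel))" for j
    by (cases "j = k") (auto intro!: measurable_compose[OF measurable_fst measurable_component_singleton]
        measurable_compose[OF measurable_snd measurable_component_singleton])
  then show ?thesis unfolding replace_column_def by (rule borel_measurable_columns_matrix)
qed

lemma cspan_replace_column [simp]:
  "cspan (\<lambda>j. column j (replace_column k f x)) (UNIV - {k}) = cspan f (UNIV - {k})"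
  unfolding cspan_def by (intro arg_cong[where f=range] ext sum.cong) auto

locale gauss_columns = prob_space +
  fixes g :: "'k::finite \<Rightarrow> 'a \<Rightarrow> complex ^ 'n" and b :: "'k \<Rightarrow> real"
  assumes card_le: "CARD('k) \<le> CARD('n)"
    and indep_g: "indep_vars (\<lambda>_. borel) g UNIV"
    and law_g: "\<And>j. distr M borel (g j) = gauss (b j)"
    and b_pos: "\<And>j. 0 < b j"
begin

definition G :: "'a \<Rightarrow> complex ^ 'k ^ 'n" where "G \<omega> = columns_matrix (\<lambda>j. g j \<omega>)"

lemma measurable_g [measurable]: "g j \<in> borel_measurable M"
  using indep_g by (auto simp: indep_vars_def)

lemma G_eq_replace_column:
  "G \<omega> = replace_column k (restrict (\<lambda>j. g j \<omega>) (UNIV - {k})) (restrict (\<lambda>j. g j \<omega>) {k} k)"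
  unfolding G_def replace_column_def by (rule arg_cong[where f=columns_matrix]) auto

lemma indep_column:
  "indep_var (PiM (UNIV - {k}) (\<lambda>_. borel)) (\<lambda>\<omega>. restrict (\<lambda>j. g j \<omega>) (UNIV - {k}))
     (PiM {k} (\<lambda>_. borel)) (\<lambda>\<omega>. restrict (\<lambda>j. g j \<omega>) {k})"
  by (rule indep_var_restrict[OF indep_g]) auto

lemma AE_column_independent: "AE \<omega> in M. column k (G \<omega>) \<notin> cspan (\<lambda>j. column j (G \<omega>)) (UNIV - {k})"
proof -
  let ?P = "\<lambda>f (x :: complex ^ 'n). column k (replace_column k f x) \<notin> cspan (\<lambda>j. column j (replace_column k f x)) (UNIV - {k})"
  have "Measurable.pred (borel :: (complex ^ 'k ^ 'n) measure) (\<lambda>A. column k A \<notin> cspan (\<lambda>j. column j A) (UNIV - {k}))"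
    using borel_dependent_column[of k] by (intro pred_intros_logic) (simp add: pred_def)
  from measurable_compose[OF borel_measurable_replace_column[of k] this]
  have pred: "Measurable.pred (PiM (UNIV - {k}) (\<lambda>_. borel) \<Otimes>\<^sub>M PiM {k} (\<lambda>_. borel)) (\<lambda>p. ?P (fst p) (snd p k))" .
  have "AE \<omega> in M. ?P f (g k \<omega>)" for f
  proof -
    have "dim (cspan f (UNIV - {k})) \<le> 2 * (CARD('k) - 1)"
      using dim_cspan_le[of "UNIV - {k}" f] by simp
    also have "\<dots> < DIM(complex ^ 'n)" using card_le zero_less_card_finite[where 'a='k] by (simp; arith)
    finally have "AE \<omega> in M. g k \<omega> \<notin> cspan f (UNIV - {k})"
      by (rule AE_notin_subspace_if_gauss[OF measurable_g law_g subspace_cspan])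
    then show ?thesis unfolding cspan_replace_column by simp
  qed
  then show ?thesis
    unfolding G_eq_replace_column[of _ k] by (subst indep_var_AE_iff_sections[OF indep_column pred]) simp
qed

lemma AE_columns_independent:
  "AE \<omega> in M. \<forall>k. column k (G \<omega>) \<notin> cspan (\<lambda>j. column j (G \<omega>)) (UNIV - {k})"
proof -
  have "AE \<omega> in M. \<forall>k\<in>UNIV. column k (G \<omega>) \<notin> cspan (\<lambda>j. column j (G \<omega>)) (UNIV - {k})"
    by (rule AE_finite_allI) (auto intro: AE_column_independent)
  then show ?thesis by simp
qed

lemma AE_full_rank: "AE \<omega> in M. \<forall>x. G \<omega> *v x = 0 \<longrightarrow> x = 0"
  using AE_columns_independent by eventually_elim (use full_rank_if_columns_independent in blast)

definition pinv_row :: "'k \<Rightarrow> 'a \<Rightarrow> complex ^ 'n" where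
  "pinv_row k \<omega> = row k (pseudo_inverse (G \<omega>))"

lemma column_notin_cspan_if_full_rank:
  fixes A :: "complex ^ 'k ^ 'n"
  assumes "\<forall>x. A *v x = 0 \<longrightarrow> x = 0" "J \<subseteq> UNIV - {k}"
  shows "column k A \<notin> cspan (\<lambda>j. column j A) J"
proof
  assume "column k A \<in> cspan (\<lambda>j. column j A) J"
  then have "column k A \<in> cspan (\<lambda>j. column j A) (UNIV - {k})"
    using cspan_mono[of "UNIV - {k}" J] assms(2) by auto
  then obtain c where c: "column k A = (\<Sum>j\<in>UNIV - {k}. c j *s column j A)" by (auto simp: cspan_def)
  let ?x = "\<chi> j. if j = k then - 1 else c j"
  have "A *v ?x = - column k A + (\<Sum>j\<in>UNIV - {k}. c j *s column j A)"
    unfolding matrix_mult_sum by (subst sum.remove[of UNIV k]) auto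
  then have "?x = 0" using assms(1) c by simp
  then have "?x $ k = 0" by (simp only: zero_index)
  then show False by simp
qed

lemma law_inverse_norm_pinv_row:
  "distr M borel (\<lambda>\<omega>. 1 / (norm (pinv_row k \<omega>))\<^sup>2) = density lborel (erlang_density (CARD('n) - CARD('k)) (1 / b k))"
proof -
  let ?R = "replace_column k"
  define \<phi> :: "complex ^ 'k ^ 'n \<Rightarrow> real" where "\<phi> A = 1 / (norm (row k (pseudo_inverse A)))\<^sup>2" for A
  have \<phi>[measurable]: "\<phi> \<in> borel_measurable borel" unfolding \<phi>_def by measurable
  let ?P = "\<lambda>f (x :: complex ^ 'n). \<forall>j. column j (?R f x) \<notin> cspan (\<lambda>i. column i (?R f x)) (UNIV - {j})"
  have "Measurable.pred (borel :: (complex ^ 'k ^ 'n) measure) (\<lambda>A. \<forall>j. column j A \<notin> cspan (\<lambda>i. column i A) (UNIV - {j}))"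
    using borel_dependent_column by (intro pred_intros_countable pred_intros_logic) (simp add: pred_def)
  from measurable_compose[OF borel_measurable_replace_column[of k] this]
  have pred: "Measurable.pred (PiM (UNIV - {k}) (\<lambda>_. borel) \<Otimes>\<^sub>M PiM {k} (\<lambda>_. borel)) (\<lambda>p. ?P (fst p) (snd p k))" .
  have "AE \<omega> in M. ?P (restrict (\<lambda>j. g j \<omega>) (UNIV - {k})) (restrict (\<lambda>j. g j \<omega>) {k} k)"
    using AE_columns_independent unfolding G_eq_replace_column[of _ k] .
  then have AE_P: "AE f in distr M (PiM (UNIV - {k}) (\<lambda>_. borel)) (\<lambda>\<omega>. restrict (\<lambda>j. g j \<omega>) (UNIV - {k})).
      AE \<omega> in M. ?P f (restrict (\<lambda>j. g j \<omega>) {k} k)"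
    by (rule indep_var_AE_iff_sections[OF indep_column pred, THEN iffD1])
  define F where "F p = \<phi> (?R (fst p) (snd p k))" for p :: "('k \<Rightarrow> complex ^ 'n) \<times> ('k \<Rightarrow> complex ^ 'n)"
  have "distr M borel (\<lambda>\<omega>. F (restrict (\<lambda>j. g j \<omega>) (UNIV - {k}), restrict (\<lambda>j. g j \<omega>) {k})) =
      density lborel (erlang_density (CARD('n) - CARD('k)) (1 / b k))"
  proof (rule indep_var_if_sections_eq(1)[OF indep_column, where f=F])
    show "F \<in> borel_measurable (PiM (UNIV - {k}) (\<lambda>_. borel) \<Otimes>\<^sub>M PiM {k} (\<lambda>_. borel))"
      using measurable_compose[OF borel_measurable_replace_column[of k] \<phi>] by (simp add: F_def[abs_def])
    show "AE f in distr M (PiM (UNIV - {k}) (\<lambda>_. borel)) (\<lambda>\<omega>. restrict (\<lambda>j. g j \<omega>) (UNIV - {k})).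
       distr M borel (\<lambda>\<omega>. F (f, restrict (\<lambda>j. g j \<omega>) {k})) = density lborel (erlang_density (CARD('n) - CARD('k)) (1 / b k))"
    proof (rule eventually_mono[OF AE_P])
      fix f assume P: "AE \<omega> in M. ?P f (restrict (\<lambda>j. g j \<omega>) {k} k)"
      have restr: "restrict (\<lambda>j. g j \<omega>) {k} k = g k \<omega>" for \<omega> by simp
      have full: "AE \<omega> in M. \<forall>x. ?R f (g k \<omega>) *v x = 0 \<longrightarrow> x = 0"
      proof (rule eventually_mono[OF P[unfolded restr]])
        fix \<omega> assume "?P f (g k \<omega>)"
        then show "\<forall>x. ?R f (g k \<omega>) *v x = 0 \<longrightarrow> x = 0"
          using full_rank_if_columns_independent[of "?R f (g k \<omega>)"] by blast
      qed
      have "\<exists>\<omega>. \<forall>x. ?R f (g k \<omega>) *v x = 0 \<longrightarrow> x = 0"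
      proof (rule ccontr)
        assume neg: "\<not> (\<exists>\<omega>. \<forall>x. ?R f (g k \<omega>) *v x = 0 \<longrightarrow> x = 0)"
        have "AE \<omega> in M. False" by (rule eventually_mono[OF full]) (use neg in blast)
        then show False by simp
      qed
      then obtain \<omega> where \<omega>: "\<forall>x. ?R f (g k \<omega>) *v x = 0 \<longrightarrow> x = 0" by blast
      have "dim (cspan (\<lambda>j. column j (?R f (g k \<omega>))) (UNIV - {k})) = 2 * card (UNIV - {k})"
      proof (rule dim_cspan_eq)
        fix j
        show "column j (?R f (g k \<omega>)) \<notin> cspan (\<lambda>j. column j (?R f (g k \<omega>))) (UNIV - {k} - {j})"
          by (rule column_notin_cspan_if_full_rank[OF \<omega>]) blast
      qed simp
      then have "dim (cspan f (UNIV - {k})) = 2 * (CARD('k) - 1)"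
        unfolding cspan_replace_column by simp
      then obtain B where B: "pairwise orthogonal B" "\<And>b. b \<in> B \<Longrightarrow> norm b = 1" "finite B"
          "card B = 2 * Suc (CARD('n) - CARD('k))" "span B = {y. \<forall>x\<in>cspan f (UNIV - {k}). orthogonal x y}"
        by (rule orthonormal_complement_basis[OF card_le]) blast
      have "AE \<omega> in M. \<phi> (?R f (g k \<omega>)) = (\<Sum>b\<in>B. (b \<bullet> g k \<omega>)\<^sup>2)"
      proof (rule eventually_mono[OF full])
        fix \<omega> assume "\<forall>x. ?R f (g k \<omega>) *v x = 0 \<longrightarrow> x = 0"
        then show "\<phi> (?R f (g k \<omega>)) = (\<Sum>b\<in>B. (b \<bullet> g k \<omega>)\<^sup>2)"
          using inverse_norm_pseudo_inverse_row[of "?R f (g k \<omega>)" B k, unfolded cspan_replace_column] B by (simp add: \<phi>_def)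
      qed
      then have "distr M borel (\<lambda>\<omega>. \<phi> (?R f (g k \<omega>))) = distr M borel (\<lambda>\<omega>. \<Sum>b\<in>B. (b \<bullet> g k \<omega>)\<^sup>2)"
        by (intro distr_cong_AE) (auto simp: replace_column_def)
      also have "\<dots> = distr (distr M borel (g k)) borel (\<lambda>x. \<Sum>b\<in>B. (b \<bullet> x)\<^sup>2)"
        by (subst distr_distr) (auto simp: o_def)
      also have "\<dots> = density lborel (erlang_density (CARD('n) - CARD('k)) (1 / b k))"
        unfolding law_g by (rule distr_gauss_sum_squares[OF b_pos B(1,2,4)])
      finally show "distr M borel (\<lambda>\<omega>. F (f, restrict (\<lambda>j. g j \<omega>) {k})) = density lborel (erlang_density (CARD('n) - CARD('k)) (1 / b k))"
        by (simp add: F_def)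
    qed
  qed simp
  then show ?thesis by (simp add: F_def \<phi>_def pinv_row_def G_eq_replace_column[of _ k])
qed

end

lemma borel_measurable_vec_functional [measurable (raw)]:
  fixes u x :: "'a \<Rightarrow> complex ^ 'n"
  assumes "u \<in> borel_measurable M" "x \<in> borel_measurable M"
  shows "(\<lambda>p. \<Sum>i\<in>UNIV. u p $ i * x p $ i) \<in> borel_measurable M"
  using assms by (intro borel_measurable_sum borel_measurable_times measurable_compose[OF _ borel_measurable_vec_nth])

context gauss_columns
begin

lemma AE_pinv_row_nonzero: "AE \<omega> in M. pinv_row k \<omega> \<noteq> 0"
proof (rule eventually_mono[OF AE_full_rank])
  fix \<omega> assume full: "\<forall>x. G \<omega> *v x = 0 \<longrightarrow> x = 0"
  have "(\<Sum>a\<in>UNIV. pinv_row k \<omega> $ a * G \<omega> $ a $ k) = 1"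
    unfolding pinv_row_def using pseudo_inverse_row(1)[of "G \<omega>" k k] full by simp
  then show "pinv_row k \<omega> \<noteq> 0" by auto
qed

lemma error_energy:
  fixes e :: "'m::finite \<Rightarrow> 'a \<Rightarrow> complex ^ 'n" and A :: "real ^ 'm ^ 'm" and k :: 'k
  assumes ind: "indep_vars (\<lambda>_. borel) (case_sum e g) UNIV"
    and diag: "\<And>a a'. a \<noteq> a' \<Longrightarrow> A $ a $ a' = 0" and pos: "\<And>a. 0 < A $ a $ a"
    and law_e: "\<And>a. distr M borel (e a) = gauss (A $ a $ a)"
  defines "Y \<equiv> \<lambda>\<omega>. \<Sum>a\<in>UNIV. (norm (\<Sum>i\<in>UNIV. pinv_row k \<omega> $ i * e a \<omega> $ i))\<^sup>2 / (norm (pinv_row k \<omega>))\<^sup>2"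
  shows "distributed M lborel Y (\<lambda>y. ennreal (pdf_Y A y))"
    and "indep_var borel (\<lambda>\<omega>. 1 / (norm (pinv_row k \<omega>))\<^sup>2) borel Y"
proof -
  let ?S = "PiM (range Inr) (\<lambda>_. borel) :: ('m + 'k \<Rightarrow> complex ^ 'n) measure"
  let ?T = "PiM (range Inl) (\<lambda>_. borel) :: ('m + 'k \<Rightarrow> complex ^ 'n) measure"
  define U where "U \<omega> = restrict (\<lambda>s. case_sum e g s \<omega>) (range Inr)" for \<omega>
  define V where "V \<omega> = restrict (\<lambda>s. case_sum e g s \<omega>) (range Inl)" for \<omega>
  have UV: "indep_var ?S U ?T V"
    unfolding U_def V_def by (rule indep_var_restrict[OF ind]) auto
  have U[measurable]: "U \<in> measurable M ?S" and V[measurable]: "V \<in> measurable M ?T"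
    using UV by (auto dest: indep_var_rv1 indep_var_rv2)
  have me[measurable]: "e a \<in> borel_measurable M" for a
    using ind unfolding indep_vars_def by (metis UNIV_I sum.case(1))
  define u where "u \<gamma> = row k (pseudo_inverse (columns_matrix (\<lambda>j. \<gamma> (Inr j))))" for \<gamma> :: "'m + 'k \<Rightarrow> complex ^ 'n"
  have u[measurable]: "u \<in> borel_measurable ?S"
  proof -
    have "(\<lambda>\<gamma>. \<gamma> (Inr j)) \<in> borel_measurable ?S" for j by (rule measurable_component_singleton) auto
    then have "(\<lambda>\<gamma>. columns_matrix (\<lambda>j. \<gamma> (Inr j))) \<in> borel_measurable ?S" by (rule borel_measurable_columns_matrix)
    from measurable_compose[OF measurable_compose[OF this borel_measurable_pseudo_inverse] borel_measurable_row]
    show ?thesis unfolding u_def .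
  qed
  have uU: "u (U \<omega>) = pinv_row k \<omega>" for \<omega>
    by (simp add: u_def U_def pinv_row_def G_def)
  define f where "f p = (\<Sum>a\<in>UNIV. (norm (\<Sum>i\<in>UNIV. u (fst p) $ i * snd p (Inl a) $ i))\<^sup>2 / (norm (u (fst p)))\<^sup>2)"
    for p :: "('m + 'k \<Rightarrow> complex ^ 'n) \<times> ('m + 'k \<Rightarrow> complex ^ 'n)"
  have f: "f \<in> borel_measurable (?S \<Otimes>\<^sub>M ?T)"
  proof -
    have u': "(\<lambda>p. u (fst p)) \<in> borel_measurable (?S \<Otimes>\<^sub>M ?T)"
      by (rule measurable_compose[OF measurable_fst u])
    have "(\<lambda>p. snd p (Inl a)) \<in> borel_measurable (?S \<Otimes>\<^sub>M ?T)" for a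
      by (rule measurable_compose[OF measurable_snd measurable_component_singleton]) auto
    with u' show ?thesis unfolding f_def
      by (intro borel_measurable_sum borel_measurable_divide borel_measurable_power measurable_compose[OF _ borel_measurable_norm]
          borel_measurable_vec_functional)
  qed
  have Y: "Y = (\<lambda>\<omega>. f (U \<omega>, V \<omega>))"
    by (simp add: Y_def f_def uU fun_eq_iff) (simp add: V_def)
  have indep_e: "indep_vars (\<lambda>_. borel) e UNIV"
    using indep_vars_reindex_inj[OF ind, of Inl] by simp
  define \<rho> where "\<rho> = density lborel (\<lambda>y. ennreal (pdf_Y A y))"
  have sections: "AE \<gamma> in distr M ?S U. distr M borel (\<lambda>\<omega>. f (\<gamma>, V \<omega>)) = \<rho>"
  proof -
    have "AE \<gamma> in distr M ?S U. u \<gamma> \<noteq> 0"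
      using AE_pinv_row_nonzero[of k] by (subst AE_distr_iff) (auto simp: uU)
    then show ?thesis
    proof (rule eventually_mono)
      fix \<gamma> assume nz: "u \<gamma> \<noteq> 0"
      let ?Z = "\<lambda>x. (norm (\<Sum>i\<in>UNIV. u \<gamma> $ i * x $ i))\<^sup>2 / (norm (u \<gamma>))\<^sup>2"
      have "?Z \<in> borel_measurable borel" by measurable
      then have "indep_vars (\<lambda>_. borel) (\<lambda>a \<omega>. ?Z (e a \<omega>)) UNIV"
        by (intro indep_vars_compose2[OF indep_e])
      then have "distributed M lborel (\<lambda>\<omega>. \<Sum>a\<in>UNIV. ?Z (e a \<omega>)) (\<lambda>y. ennreal (pdf_Y A y))"
        by (intro distributed_sum_exponential diag pos exponential_complex_functional me law_e nz)
      then have "distr M borel (\<lambda>\<omega>. \<Sum>a\<in>UNIV. ?Z (e a \<omega>)) = \<rho>"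
        by (simp add: distributed_def \<rho>_def cong: distr_cong)
      moreover have "(\<lambda>\<omega>. f (\<gamma>, V \<omega>)) = (\<lambda>\<omega>. \<Sum>a\<in>UNIV. ?Z (e a \<omega>))"
        by (simp add: f_def V_def)
      ultimately show "distr M borel (\<lambda>\<omega>. f (\<gamma>, V \<omega>)) = \<rho>"
        by (simp only:)
    qed
  qed
  have sets: "sets \<rho> = sets (borel :: real measure)" by (simp add: \<rho>_def)
  note law = indep_var_if_sections_eq[OF UV f sets sections]
  have pdf: "(\<lambda>y. ennreal (pdf_Y A y)) \<in> borel_measurable lborel"
    using borel_measurable_integrable[OF integrable_pdf_Y[OF diag pos]] by simp
  have "distr M borel Y = \<rho>" unfolding Y by (rule law(1))
  moreover have "Y \<in> borel_measurable M" unfolding Y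
    by (rule measurable_compose[OF _ f]) simp
  ultimately show "distributed M lborel Y (\<lambda>y. ennreal (pdf_Y A y))"
    using pdf unfolding distributed_def \<rho>_def by (simp cong: distr_cong)
  have "(\<lambda>\<gamma>. 1 / (norm (u \<gamma>))\<^sup>2) \<in> borel_measurable ?S" by measurable
  from law(2)[OF this] show "indep_var borel (\<lambda>\<omega>. 1 / (norm (pinv_row k \<omega>))\<^sup>2) borel Y"
    unfolding Y uU .
qed

end

lemma cn_density_eq_gauss: "0 < v \<Longrightarrow> cn_density v x = ennreal (gauss_density v x)"
  for x :: "complex ^ 'n"
  by (simp add: cn_density_def gauss_density_def mult.commute[of _ 2] power_mult)

text \<open>For \<open>v = 0\<close> the density is \<open>0\<close> (division by zero); for \<open>v < 0\<close> it is \<open>0\<close> or bounded below by a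
  positive constant, depending on the parity of the dimension.\<close>

lemma (in prob_space) distributed_cn_density_pos:
  fixes X :: "'a \<Rightarrow> complex ^ 'n"
  assumes X: "distributed M lborel X (cn_density v)"
  shows "0 < v"
proof (rule ccontr)
  assume "\<not> 0 < v"
  then have v: "v \<le> 0" by simp
  have D: "distr M lborel X = density lborel (cn_density v)" and [measurable]: "cn_density v \<in> borel_measurable (lborel :: (complex ^ 'n) measure)" and Xm: "X \<in> measurable M lborel"
    using X unfolding distributed_def by blast+
  have "prob_space (density lborel (cn_density v :: complex ^ 'n \<Rightarrow> ennreal))"
    unfolding D[symmetric] by (rule prob_space_distr[OF Xm])
  from prob_space.emeasure_space_1[OF this]
  have total: "(\<integral>\<^sup>+x. cn_density v (x :: complex ^ 'n) \<partial>lborel) = 1" by (simp add: emeasure_density)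
  define c where "c = 1 / (pi * v) ^ CARD('n)"
  have cn: "cn_density v x = ennreal (exp (- (norm x)\<^sup>2 / v) * c)" for x :: "complex ^ 'n"
    by (simp add: cn_density_def c_def)
  show False
  proof (cases "c \<le> 0")
    case True
    then have "cn_density v x = 0" for x :: "complex ^ 'n" unfolding cn by (simp add: mult_nonneg_nonpos ennreal_neg)
    then show False using total by simp
  next
    case False
    then have c: "0 < c" by simp
    have "ennreal c \<le> cn_density v x" for x :: "complex ^ 'n"
    proof -
      have "1 \<le> exp (- (norm x)\<^sup>2 / v)" using v by (simp add: divide_nonneg_nonpos)
      then show ?thesis unfolding cn using c by (intro ennreal_leI) simp
    qed
    then have "(\<integral>\<^sup>+x. ennreal c \<partial>(lborel :: (complex ^ 'n) measure)) \<le> 1"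
      unfolding total[symmetric] by (intro nn_integral_mono)
    then show False using c by (simp add: ennreal_mult_top top_unique)
  qed
qed

lemma (in prob_space) distributed_cn_density_gauss:
  fixes X :: "'a \<Rightarrow> complex ^ 'n"
  assumes "distributed M lborel X (cn_density v)"
  shows "0 < v" "X \<in> borel_measurable M" "distr M borel X = gauss v"
proof -
  show v: "0 < v" by (rule distributed_cn_density_pos[OF assms])
  have eq: "(cn_density v :: complex ^ 'n \<Rightarrow> _) = (\<lambda>x. ennreal (gauss_density v x))"
    using v by (simp add: cn_density_eq_gauss fun_eq_iff)
  show "X \<in> borel_measurable M" "distr M borel X = gauss v"
    using assms unfolding distributed_def eq by (simp_all cong: distr_cong)
qed

lemma (in prob_space) distr_sum_indep_gauss_finite:
  fixes X :: "'i \<Rightarrow> 'a \<Rightarrow> 'b::euclidean_space"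
  assumes "finite I" "I \<noteq> {}" "\<And>i. i \<in> I \<Longrightarrow> 0 < v i" "\<And>i. i \<in> I \<Longrightarrow> distr M borel (X i) = gauss (v i)"
    and "indep_vars (\<lambda>_. borel) X I"
  shows "distr M borel (\<lambda>\<omega>. \<Sum>i\<in>I. X i \<omega>) = gauss (\<Sum>i\<in>I. v i)"
  using assms
proof (induction I rule: finite_ne_induct)
  case (singleton i) then show ?case by simp
next
  case (insert i I)
  have "indep_var (PiM {i} (\<lambda>_. borel)) (\<lambda>\<omega>. restrict (\<lambda>j. X j \<omega>) {i}) (PiM I (\<lambda>_. borel)) (\<lambda>\<omega>. restrict (\<lambda>j. X j \<omega>) I)"
    using insert.hyps by (intro indep_var_restrict[OF insert.prems(3)]) auto
  then have "indep_var borel ((\<lambda>f. f i) \<circ> (\<lambda>\<omega>. restrict (\<lambda>j. X j \<omega>) {i})) borel ((\<lambda>f. \<Sum>j\<in>I. f j) \<circ> (\<lambda>\<omega>. restrict (\<lambda>j. X j \<omega>) I))"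
    by (rule indep_var_compose) (auto intro!: borel_measurable_sum measurable_component_singleton)
  then have ind: "indep_var borel (X i) borel (\<lambda>\<omega>. \<Sum>j\<in>I. X j \<omega>)"
    by (simp add: o_def cong: sum.cong)
  have "distr M borel (\<lambda>\<omega>. \<Sum>j\<in>I. X j \<omega>) = gauss (\<Sum>j\<in>I. v j)"
    using insert.prems indep_vars_subset[OF insert.prems(3), of I] by (intro insert.IH) auto
  then have "distr M borel (\<lambda>\<omega>. X i \<omega> + (\<Sum>j\<in>I. X j \<omega>)) = gauss (v i + (\<Sum>j\<in>I. v j))"
    using insert by (intro distr_sum_indep_gauss ind sum_pos) auto
  then show ?case using insert.hyps by simp
qed

section \<open>The signal-to-interference-plus-noise ratio\<close>

lemma (in prob_space) distr_mmse_estimate: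
  fixes h :: "int \<Rightarrow> 'c::finite \<Rightarrow> 'c \<Rightarrow> 'k::finite \<Rightarrow> 'a \<Rightarrow> complex ^ 'n"
  assumes p_tr: "0 < p_tr" and \<beta>: "\<And>i j. 0 < \<beta> l i j"
    and h: "\<And>i j. distributed M lborel (h m l i j) (cn_density 1)"
    and z: "\<And>j. distributed M lborel (z m l j) (cn_density 1)"
    and indep: "indep_vars (\<lambda>_. borel) (case_sum (\<lambda>(i, j). h m l i j) (\<lambda>j. z m l j)) UNIV"
  shows "distr M borel (mmse_estimate \<beta> p_tr h z m l i j) = gauss (beta_hat \<beta> p_tr l i j)"
    and "mmse_estimate \<beta> p_tr h z m l i j \<in> borel_measurable M"
    and "0 < beta_hat \<beta> p_tr l i j"
proof -
  let ?H = "case_sum (\<lambda>(i, j). h m l i j) (\<lambda>j. z m l j)"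
  define c where "c = case_sum (\<lambda>(i, j). sqrt (\<beta> l i j)) (\<lambda>_ :: 'k. 1 / sqrt p_tr)"
  define I where "I = insert (Inr j) ((\<lambda>i. Inl (i, j)) ` (UNIV :: 'c set)) "
  define D where "D = (\<Sum>i\<in>UNIV. \<beta> l i j) + 1 / p_tr"
  have D: "0 < D" unfolding D_def using p_tr \<beta> by (intro add_nonneg_pos sum_nonneg) (auto intro: less_imp_le)
  have c0: "c s \<noteq> 0" for s
    using \<beta> p_tr by (cases s) (auto simp: c_def less_imp_neq[symmetric] split: prod.split)
  have H: "distr M borel (?H s) = gauss 1" "?H s \<in> borel_measurable M" for s
    using distributed_cn_density_gauss[OF h] distributed_cn_density_gauss[OF z]
    by (cases s; auto split: prod.split)+
  have X: "distr M borel (\<lambda>\<omega>. c s *\<^sub>R ?H s \<omega>) = gauss ((c s)\<^sup>2)" for s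
  proof -
    have "distr M borel (\<lambda>\<omega>. c s *\<^sub>R ?H s \<omega>) = distr (distr M borel (?H s)) borel (\<lambda>x. c s *\<^sub>R x)"
      using H(2)[of s] by (subst distr_distr) (auto simp: o_def)
    then show ?thesis using distr_gauss_scaleR[OF c0[of s], of 1] by (simp add: H(1))
  qed
  have "indep_vars (\<lambda>_. borel) (\<lambda>s \<omega>. c s *\<^sub>R ?H s \<omega>) UNIV"
    by (rule indep_vars_compose2[OF indep]) simp
  then have "indep_vars (\<lambda>_. borel) (\<lambda>s \<omega>. c s *\<^sub>R ?H s \<omega>) I" by (rule indep_vars_subset) simp
  then have sum: "distr M borel (\<lambda>\<omega>. \<Sum>s\<in>I. c s *\<^sub>R ?H s \<omega>) = gauss (\<Sum>s\<in>I. (c s)\<^sup>2)"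
    using c0 by (intro distr_sum_indep_gauss_finite X) (auto simp: I_def)
  have inj: "inj (\<lambda>i. Inl (i, j) :: 'c \<times> 'k + 'k)" by (simp add: inj_def)
  have var: "(\<Sum>s\<in>I. (c s)\<^sup>2) = D"
    unfolding I_def using inj \<beta> p_tr by (subst sum.insert) (auto simp: sum.reindex c_def D_def power_divide less_imp_le)
  define C where "C = \<beta> l i j * inverse (1 / p_tr + (\<Sum>i'\<in>UNIV. \<beta> l i' j))"
  have C: "C = \<beta> l i j / D" by (simp add: C_def D_def divide_inverse add.commute)
  have C0: "C \<noteq> 0" unfolding C using D \<beta>[of i j] by simp
  have mmse: "mmse_estimate \<beta> p_tr h z m l i j = (\<lambda>\<omega>. C *\<^sub>R (\<Sum>s\<in>I. c s *\<^sub>R ?H s \<omega>))"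
    unfolding I_def using inj by (subst sum.insert) (auto simp: sum.reindex fun_eq_iff mmse_estimate_def channel_def c_def C_def add.commute)
  have meas: "(\<lambda>\<omega>. \<Sum>s\<in>I. c s *\<^sub>R ?H s \<omega>) \<in> borel_measurable M"
    using H(2) by (intro borel_measurable_sum borel_measurable_scaleR) auto
  then show "mmse_estimate \<beta> p_tr h z m l i j \<in> borel_measurable M"
    unfolding mmse by (intro borel_measurable_scaleR) auto
  have "C\<^sup>2 * D = beta_hat \<beta> p_tr l i j"
    using D unfolding C beta_hat_def D_def[symmetric] by (simp add: power2_eq_square)
  moreover have "distr M borel (\<lambda>\<omega>. C *\<^sub>R (\<Sum>s\<in>I. c s *\<^sub>R ?H s \<omega>)) =
      distr (distr M borel (\<lambda>\<omega>. \<Sum>s\<in>I. c s *\<^sub>R ?H s \<omega>)) borel (\<lambda>x. C *\<^sub>R x)"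
    using meas by (subst distr_distr) (auto simp: o_def)
  ultimately show "distr M borel (mmse_estimate \<beta> p_tr h z m l i j) = gauss (beta_hat \<beta> p_tr l i j)"
    unfolding mmse sum var using distr_gauss_scaleR[OF C0, of D] by simp
  show "0 < beta_hat \<beta> p_tr l i j"
    using D \<beta>[of i j] unfolding beta_hat_def D_def[symmetric] by simp
qed

lemma mmse_estimate_ratio:
  fixes \<beta> :: "'c::finite \<Rightarrow> 'c \<Rightarrow> 'k \<Rightarrow> real"
  assumes "\<beta> l l j \<noteq> 0"
  shows "mmse_estimate \<beta> p_tr h z m l i j \<omega> = (\<beta> l i j / \<beta> l l j) *\<^sub>R mmse_estimate \<beta> p_tr h z m l l j \<omega>"
  using assms by (simp add: mmse_estimate_def)

lemma borel_measurable_norm_row_mult: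
  fixes P :: "'a \<Rightarrow> complex ^ 'n ^ 'k" and A :: "'a \<Rightarrow> complex ^ 'm ^ 'n"
  assumes P: "P \<in> borel_measurable M" and A: "A \<in> borel_measurable M"
  shows "(\<lambda>\<omega>. norm (row k (P \<omega>) v* A \<omega>)) \<in> borel_measurable M"
proof -
  have "continuous_on UNIV (\<lambda>p :: (complex ^ 'n ^ 'k) \<times> (complex ^ 'm ^ 'n). norm (row k (fst p) v* snd p))"
    unfolding row_def vector_matrix_mult_def by (intro continuous_intros)
  from measurable_compose[OF borel_measurable_Pair[OF P A] borel_measurable_continuous_onI[OF this]]
  show ?thesis by simp
qed

lemma zf_sinr_eq:
  fixes g :: "'c::finite \<Rightarrow> 'k::finite \<Rightarrow> complex ^ 'n" and e :: "'c \<Rightarrow> 'k \<Rightarrow> complex ^ 'n" and r :: "'c \<Rightarrow> 'k \<Rightarrow> real"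
    and l :: 'c and k :: 'k
  assumes full: "\<forall>x. columns_matrix (g l) *v x = 0 \<longrightarrow> x = 0"
    and ratio: "\<And>i j. g i j = r i j *\<^sub>R g l j"
  defines "w \<equiv> row k (pseudo_inverse (columns_matrix (g l)))"
  defines "X \<equiv> 1 / (norm w)\<^sup>2"
    and "Y \<equiv> \<Sum>(i, j)\<in>UNIV. (norm (\<Sum>a\<in>UNIV. w $ a * e i j $ a))\<^sup>2 / (norm w)\<^sup>2"
  shows "zf_sinr \<alpha> p (\<lambda>i. columns_matrix (g i)) (\<lambda>i. columns_matrix (e i)) l k =
    \<alpha>\<^sup>2 * p * X / (\<alpha>\<^sup>2 * p * (\<Sum>i\<in>UNIV - {l}. (r i k)\<^sup>2) * X + p * Y + 1)"
proof -
  have wg: "(\<Sum>a\<in>UNIV. w $ a * g l j $ a) = (if j = k then 1 else 0)" for j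
    using pseudo_inverse_row(1)[of "columns_matrix (g l)" k j] full by (simp add: w_def columns_matrix_def)
  have w0: "w \<noteq> 0" using wg[of k] by auto
  have interf: "(norm (w v* columns_matrix (g i)))\<^sup>2 = (r i k)\<^sup>2" for i
  proof -
    have "(w v* columns_matrix (g i)) $ j = of_real (r i j) * (\<Sum>a\<in>UNIV. w $ a * g l j $ a)" for j
      unfolding vector_matrix_mult_def columns_matrix_def ratio[of i]
      by (simp add: scaleR_conv_of_real[where 'a=complex] sum_distrib_left mult_ac)
    then have "(norm (w v* columns_matrix (g i)))\<^sup>2 = (\<Sum>j\<in>UNIV. if j = k then (r i k)\<^sup>2 else 0)"
      unfolding norm_power2_vec wg by (intro sum.cong) (auto simp: norm_mult)
    then show ?thesis by simp
  qed
  have err: "(\<Sum>i\<in>UNIV. (norm (w v* columns_matrix (e i)))\<^sup>2) = (norm w)\<^sup>2 * Y"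
  proof -
    have "(norm w)\<^sup>2 * Y = (\<Sum>(i, j)\<in>UNIV \<times> UNIV. (norm (\<Sum>a\<in>UNIV. w $ a * e i j $ a))\<^sup>2)"
      unfolding Y_def sum_distrib_left using w0 by (intro sum.cong) auto
    also have "\<dots> = (\<Sum>i\<in>UNIV. \<Sum>j\<in>UNIV. (norm (\<Sum>a\<in>UNIV. w $ a * e i j $ a))\<^sup>2)"
      by (rule sum.cartesian_product[symmetric])
    also have "\<dots> = (\<Sum>i\<in>UNIV. (norm (w v* columns_matrix (e i)))\<^sup>2)"
      unfolding norm_power2_vec by (simp add: vector_matrix_mult_def columns_matrix_def mult.commute)
    finally show ?thesis by simp
  qed
  have "zf_sinr \<alpha> p (\<lambda>i. columns_matrix (g i)) (\<lambda>i. columns_matrix (e i)) l k =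
    \<alpha>\<^sup>2 * p / (\<alpha>\<^sup>2 * p * (\<Sum>i\<in>UNIV - {l}. (r i k)\<^sup>2) + p * ((norm w)\<^sup>2 * Y) + (norm w)\<^sup>2)"
    unfolding zf_sinr_def w_def[symmetric] interf err ..
  also have "\<dots> = (\<alpha>\<^sup>2 * p) * X / ((\<alpha>\<^sup>2 * p * (\<Sum>i\<in>UNIV - {l}. (r i k)\<^sup>2) + p * ((norm w)\<^sup>2 * Y) + (norm w)\<^sup>2) * X)"
    using w0 by (simp add: X_def)
  also have "(\<alpha>\<^sup>2 * p * (\<Sum>i\<in>UNIV - {l}. (r i k)\<^sup>2) + p * ((norm w)\<^sup>2 * Y) + (norm w)\<^sup>2) * X =
      \<alpha>\<^sup>2 * p * (\<Sum>i\<in>UNIV - {l}. (r i k)\<^sup>2) * X + p * Y + 1"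
    using w0 by (simp add: X_def add_divide_distrib)
  finally show ?thesis .
qed

theorem proposition1:
  fixes M :: "'w measure"
    and \<beta> :: "'c::finite \<Rightarrow> 'c \<Rightarrow> 'k::finite \<Rightarrow> real"
    and h :: "int \<Rightarrow> 'c \<Rightarrow> 'c \<Rightarrow> 'k \<Rightarrow> 'w \<Rightarrow> complex ^ 'n::finite"
    and z :: "int \<Rightarrow> 'c \<Rightarrow> 'k \<Rightarrow> 'w \<Rightarrow> complex ^ 'n"
    and \<alpha> f_D T_s p_r p_tr :: real
    and \<tau> :: nat and n :: int and l :: 'c and k :: 'k
  assumes "prob_space M"
    and "CARD('k) \<le> CARD('n)"
    and "CARD('k) \<le> \<tau>"
    and "0 < p_r"
    and p_tr: "p_tr = real \<tau> * p_r"
    and "\<And>l i j. 0 < \<beta> l i j"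
    and alpha: "\<alpha> = bessel_J0 (2 * pi * f_D * T_s)"
    and fading: "\<And>m l i j. distributed M lborel (h m l i j) (cn_density 1)"
    and noise: "\<And>m l j. distributed M lborel (z m l j) (cn_density 1)"
    and training_indep:
      "prob_space.indep_vars M (\<lambda>_. borel)
         (case_sum (\<lambda>(i, j). h (n - 1) l i j) (\<lambda>j. z (n - 1) l j))
         (UNIV :: ('c \<times> 'k + 'k) set)"
    and error_law:
      "\<And>i j. distributed M lborel (prediction_error \<alpha> \<beta> p_tr h z n l i j)
                (cn_density (\<beta> l i j - \<alpha>\<^sup>2 * beta_hat \<beta> p_tr l i j))"
    and error_indep:
      "prob_space.indep_vars M (\<lambda>_. borel)
         (case_sum (\<lambda>(i, j). prediction_error \<alpha> \<beta> p_tr h z n l i j)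
                   (\<lambda>j. mmse_estimate \<beta> p_tr h z (n - 1) l l j))
         (UNIV :: ('c \<times> 'k + 'k) set)"
  shows "sinr \<alpha> p_r \<beta> p_tr h z n l k \<in> borel_measurable M \<and>
    (\<exists>X Y :: 'w \<Rightarrow> real.
       prob_space.indep_var M borel X borel Y \<and>
       distributed M lborel X
         (\<lambda>x. ennreal (pdf_X (CARD('n) - CARD('k)) (beta_hat \<beta> p_tr l l k) x)) \<and>
       distributed M lborel Y (\<lambda>y. ennreal (pdf_Y (error_cov \<alpha> \<beta> p_tr l) y)) \<and>
       distr M borel (sinr \<alpha> p_r \<beta> p_tr h z n l k) =
       distr M borel (\<lambda>\<omega>. \<alpha>\<^sup>2 * p_r * X \<omega> /
          (\<alpha>\<^sup>2 * p_r * (\<Sum>i\<in>UNIV - {l}. (\<beta> l i k / \<beta> l l k)\<^sup>2) * X \<omega> + p_r * Y \<omega> + 1)))"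
proof -
  interpret prob_space M by fact
  note card = \<open>CARD('k) \<le> CARD('n)\<close> and \<beta> = \<open>\<And>l i j. 0 < \<beta> l i j\<close>
  have "0 < CARD('k)" by simp
  then have "0 < \<tau>" using \<open>CARD('k) \<le> \<tau>\<close> by linarith
  then have ptr: "0 < p_tr" using \<open>0 < p_r\<close> by (simp add: p_tr)
  let ?est = "\<lambda>i j. mmse_estimate \<beta> p_tr h z (n - 1) l i j"
  let ?err = "\<lambda>i j. prediction_error \<alpha> \<beta> p_tr h z n l i j"
  let ?A = "error_cov \<alpha> \<beta> p_tr l"
  let ?b = "\<lambda>j. beta_hat \<beta> p_tr l l j"
  note est = distr_mmse_estimate[where h=h and z=z, OF ptr \<beta> fading noise training_indep]
  note err = distributed_cn_density_gauss[OF error_law]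
  interpret gauss_columns M "?est l" ?b
  proof
    show "indep_vars (\<lambda>_. borel) (?est l) UNIV"
      using indep_vars_reindex_inj[OF error_indep, of Inr] by simp
  qed (use card est in auto)
  define X where "X = (\<lambda>\<omega>. 1 / (norm (pinv_row k \<omega>))\<^sup>2)"
  define Y where "Y = (\<lambda>\<omega>. \<Sum>a\<in>UNIV. (norm (\<Sum>i\<in>UNIV. pinv_row k \<omega> $ i * (case a of (i, j) \<Rightarrow> ?err i j) \<omega> $ i))\<^sup>2 / (norm (pinv_row k \<omega>))\<^sup>2)"
  have Y: "distributed M lborel Y (\<lambda>y. ennreal (pdf_Y ?A y))" "indep_var borel X borel Y"
  proof -
    have diag: "?A $ a $ a' = 0" if "a \<noteq> a'" for a a'
      using that by (simp add: error_cov_def)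
    have pos: "0 < ?A $ a $ a" for a
      using err(1) by (simp add: error_cov_def)
    have law: "distr M borel (case a of (i, j) \<Rightarrow> ?err i j) = gauss (?A $ a $ a)" for a
      using err(3) by (simp add: error_cov_def case_prod_unfold)
    show "distributed M lborel Y (\<lambda>y. ennreal (pdf_Y ?A y))" "indep_var borel X borel Y"
      unfolding X_def Y_def by (rule error_energy[OF error_indep, where A="?A", OF diag pos law], assumption)+
  qed
  have [measurable]: "X \<in> borel_measurable M" "Y \<in> borel_measurable M"
    using Y(2) by (auto dest: indep_var_rv1 indep_var_rv2)
  have pdf_X: "pdf_X (CARD('n) - CARD('k)) (?b k) = erlang_density (CARD('n) - CARD('k)) (1 / ?b k)"
    using b_pos[of k] by (auto simp: pdf_X_def erlang_density_def fun_eq_iff power_divide mult_ac)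
  have X: "distributed M lborel X (\<lambda>x. ennreal (pdf_X (CARD('n) - CARD('k)) (?b k) x))"
    unfolding distributed_def pdf_X using law_inverse_norm_pinv_row[of k, folded X_def]
    by (simp cong: distr_cong)
  have sinr_meas: "sinr \<alpha> p_r \<beta> p_tr h z n l k \<in> borel_measurable M"
  proof -
    have G: "(\<lambda>\<omega>. columns_matrix (\<lambda>j. ?est i j \<omega>)) \<in> borel_measurable M"
      and E: "(\<lambda>\<omega>. columns_matrix (\<lambda>j. ?err i j \<omega>)) \<in> borel_measurable M" for i
      using est(2) err(2) by (auto intro!: borel_measurable_columns_matrix)
    note P = measurable_compose[OF G borel_measurable_pseudo_inverse]
    show ?thesis
      unfolding sinr_def[abs_def] zf_sinr_def
      by (intro borel_measurable_divide borel_measurable_add borel_measurable_times borel_measurable_sum borel_measurable_power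
          borel_measurable_norm_row_mult P G E measurable_compose[OF _ borel_measurable_norm]
          measurable_compose[OF P borel_measurable_row] borel_measurable_const)
  qed
  have "AE \<omega> in M. sinr \<alpha> p_r \<beta> p_tr h z n l k \<omega> = \<alpha>\<^sup>2 * p_r * X \<omega> /
          (\<alpha>\<^sup>2 * p_r * (\<Sum>i\<in>UNIV - {l}. (\<beta> l i k / \<beta> l l k)\<^sup>2) * X \<omega> + p_r * Y \<omega> + 1)"
  proof (rule eventually_mono[OF AE_full_rank])
    fix \<omega> assume full: "\<forall>x. G \<omega> *v x = 0 \<longrightarrow> x = 0"
    have ratio: "?est i j \<omega> = (\<beta> l i j / \<beta> l l j) *\<^sub>R ?est l j \<omega>" for i j
      using \<beta>[of l l j] by (intro mmse_estimate_ratio) simp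
    have "sinr \<alpha> p_r \<beta> p_tr h z n l k \<omega> = zf_sinr \<alpha> p_r (\<lambda>i. columns_matrix (\<lambda>j. ?est i j \<omega>)) (\<lambda>i. columns_matrix (\<lambda>j. ?err i j \<omega>)) l k"
      by (simp add: sinr_def)
    also have "\<dots> = \<alpha>\<^sup>2 * p_r * X \<omega> /
          (\<alpha>\<^sup>2 * p_r * (\<Sum>i\<in>UNIV - {l}. (\<beta> l i k / \<beta> l l k)\<^sup>2) * X \<omega> + p_r * Y \<omega> + 1)"
      using zf_sinr_eq[of "\<lambda>i j. ?est i j \<omega>" l "\<lambda>i j. \<beta> l i j / \<beta> l l j" \<alpha> p_r "\<lambda>i j. ?err i j \<omega>" k, OF full[unfolded G_def] ratio]
      unfolding X_def Y_def pinv_row_def G_def by (simp add: case_prod_unfold)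
    finally show "sinr \<alpha> p_r \<beta> p_tr h z n l k \<omega> = \<alpha>\<^sup>2 * p_r * X \<omega> /
          (\<alpha>\<^sup>2 * p_r * (\<Sum>i\<in>UNIV - {l}. (\<beta> l i k / \<beta> l l k)\<^sup>2) * X \<omega> + p_r * Y \<omega> + 1)" .
  qed
  then have "distr M borel (sinr \<alpha> p_r \<beta> p_tr h z n l k) =
       distr M borel (\<lambda>\<omega>. \<alpha>\<^sup>2 * p_r * X \<omega> /
          (\<alpha>\<^sup>2 * p_r * (\<Sum>i\<in>UNIV - {l}. (\<beta> l i k / \<beta> l l k)\<^sup>2) * X \<omega> + p_r * Y \<omega> + 1))"
    by (intro distr_cong_AE sinr_meas) auto
  then show ?thesis using sinr_meas X Y by blast
qed

end
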